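(* Let $n\ge 4$. Up to isomorphism there are eight (parametrized families of) solvable indecomposable left Leibniz algebras over $\mathbb{C}$ of dimension $n+1$ whose nilradical is $\mathcal{L}^4$ (a nilradical of codimension one). That is, each algebra listed below is such an algebra, and every such algebra is isomorphic to one of those listed, for some admissible complex values of the parameters. In each item the brackets are those of $\mathcal{L}^4$ on $e_1,\dots,e_n$ together with the ones displayed. For every $n\ge4$: (i) $l_{n+1,1}$: $[e_1,e_{n+1}]=e_1+(a-1)e_3$, $[e_3,e_{n+1}]=ae_3$, $[e_4,e_{n+1}]=(a+1)(e_4-e_2)$, $[e_i,e_{n+1}]=(a+i-3)e_i$, $[e_{n+1},e_1]=-e_1-(a-1)e_3$, $[e_{n+1},e_2]=-2ae_2$, $[e_{n+1},e_3]=-ae_3$, $[e_{n+1},e_4]=(1-a)e_2-(a+1)e_4$, $[e_{n+1},e_i]=(3-i-a)e_i$, $(5\le i\le n)$. (ii) $l_{n+1,2}$: $[e_1,e_{n+1}]=e_1+(2-n)e_3$, $[e_3,e_{n+1}]=(3-n)e_3$, $[e_4,e_{n+1}]=(n-4)(e_2-e_4)$, $[e_i,e_{n+1}]=(i-n)e_i$, $[e_{n+1},e_{n+1}]=e_n$, $[e_{n+1},e_1]=-e_1+(n-2)e_3$, $[e_{n+1},e_2]=(2n-6)e_2$, $[e_{n+1},e_3]=(n-3)e_3$, $[e_{n+1},e_4]=(n-2)e_2+(n-4)e_4$, $[e_{n+1},e_i]=(n-i)e_i$, $(5\le i\le n)$. (iii) $l_{n+1,3}$: $[e_1,e_{n+1}]=e_3$,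 $[e_{n+1},e_1]=-e_3$, $[e_{n+1},e_2]=-2e_2$, and for $3\le i\le n$: $[e_i,e_{n+1}]=-\delta_{i,4}e_2+e_i+\epsilon e_{i+2}+\sum_{k=i+3}^n b_{k-i-2}e_k$, $[e_{n+1},e_i]=-\delta_{i,4}e_2-e_i-\epsilon e_{i+2}-\sum_{k=i+3}^n b_{k-i-2}e_k$, where $\epsilon\in\{0,1\}$, $\delta_{i,4}$ is the Kronecker delta, and $e_k:=0$ for $n<k$ in these formulas (so that $\epsilon=0$ when $n=4$). (iv) $\mathfrak{g}_{n+1,4}$: $[e_1,e_{n+1}]=e_1-e_3$, $[e_3,e_{n+1}]=fe_2$, $[e_4,e_{n+1}]=-e_2+e_4$, $[e_i,e_{n+1}]=(i-3)e_i$, $[e_{n+1},e_{n+1}]=\epsilon e_2$, $[e_{n+1},e_1]=-e_1+(d+f)e_2+e_3$, $[e_{n+1},e_3]=de_2$, $[e_{n+1},e_4]=e_2-e_4$, $[e_{n+1},e_i]=(3-i)e_i$, $(5\le i\le n)$, where $\epsilon\in\{0,1\}$ and, if $\epsilon=0$, then $(d,f)\ne(0,0)$. For $n=4$ only: (v) $l_{5,5}$: $[e_1,e_5]=ae_1+(b-a+1)e_3$, $[e_3,e_5]=e_1+be_3$, $[e_4,e_5]=(a+b)(e_4-e_2)$, $[e_5,e_1]=-ae_1+(a-b-1)e_3$, $[e_5,e_2]=-2(b+1)e_2$, $[e_5,e_3]=-e_1-be_3$, $[e_5,e_4]=(a-b-2)e_2-(a+b)e_4$, where $a\ne1$ if $b=-1$.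 (vi) $l_{5,6}$: $[e_1,e_5]=ae_1+(1-2a)e_3$, $[e_3,e_5]=e_1-ae_3$, $[e_5,e_5]=e_4$, $[e_5,e_1]=-ae_1+(2a-1)e_3$, $[e_5,e_2]=2(a-1)e_2$, $[e_5,e_3]=ae_3-e_1$, $[e_5,e_4]=2(a-1)e_2$, where $a\ne1$. (vii) $\mathfrak{g}_{5,7}$: $[e_1,e_5]=a(e_1-e_3)$, $[e_3,e_5]=e_1+fe_2-e_3$, $[e_4,e_5]=(1-a)(e_2-e_4)$, $[e_5,e_5]=\epsilon e_2$, $[e_5,e_1]=-ae_1+(d+f)e_2+ae_3$, $[e_5,e_3]=-e_1+de_2+e_3$, $[e_5,e_4]=(a-1)(e_2-e_4)$, where $\epsilon\in\{0,1\}$, $a\ne1$ and, if $\epsilon=0$, then $(d,f)\ne(0,0)$. (viii) $\mathfrak{g}_{5,8}$: $[e_1,e_5]=ce_2$, $[e_3,e_5]=e_1-e_3$, $[e_4,e_5]=e_2-e_4$, $[e_5,e_5]=\epsilon e_2$, $[e_5,e_1]=(c+d)e_2$, $[e_5,e_3]=-e_1+(d+2c)e_2+e_3$, $[e_5,e_4]=e_4-e_2$, where $c\ne0$ and $\epsilon\in\{0,1\}$.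
   Context: All algebras are finite dimensional over $\mathbb{C}$. A left Leibniz algebra is a vector space $L$ with a bilinear bracket satisfying $[[x,y],z]=[x,[y,z]]-[y,[x,z]]$ for all $x,y,z\in L$. $L$ is nilpotent (solvable) if the series $L^0=L$, $L^{k+1}=[L^k,L]$ (resp. $L^{(0)}=L$, $L^{(k+1)}=[L^{(k)},L^{(k)}]$) reaches $0$ (for left Leibniz algebras, the lower central series may be taken as $L^{k+1}=[L,L^k]$). The nilradical of a solvable Leibniz algebra is its unique maximal nilpotent (two-sided) ideal. An algebra is indecomposable if it is not a direct sum of two nonzero ideals. For $n\ge4$, $\mathcal{L}^4$ is the $n$-dimensional nilpotent (left and right) Leibniz algebra with basis $e_1,\dots,e_n$ and only nonzero brackets $[e_1,e_1]=e_2$, $[e_i,e_1]=e_{i+1}$ $(3\le i\le n-1)$, $[e_1,e_3]=2e_2-e_4$, $[e_3,e_3]=e_2$, $[e_1,e_j]=-e_{j+1}$ $(4\le j\le n-1)$. The extended algebra has basis $e_1,\dots,e_n,e_{n+1}$. Brackets of basis elements that are neither displayed nor among those of $\mathcal{L}^4$ are zero. All unspecified parameters are arbitrary complex numbers. *)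

theory Defs
  imports Complex_Main "HOL-Library.Function_Algebras"
begin

section \<open>Finite-dimensional complex algebras\<close>

text \<open>
  An algebra is carried by a linear subspace \<open>carr\<close> of an ambient complex vector space
  (addition is that of the type \<open>'a\<close>), so that ideals, subalgebras and algebras whose dimension
  is a variable are all objects of the same kind. Values of \<open>brk\<close> outside \<open>carr\<close> are irrelevant.
\<close>

record 'a calg =
  carr :: "'a set"
  scal :: "complex \<Rightarrow> 'a \<Rightarrow> 'a"
  brk :: "'a \<Rightarrow> 'a \<Rightarrow> 'a"

definition fd_algebra :: "'a::ab_group_add calg \<Rightarrow> bool" where
  "fd_algebra L \<longleftrightarrow>
     vector_space (scal L) \<and>
     module.subspace (scal L) (carr L) \<and>
     (\<exists>B. finite B \<and> module.span (scal L) B = carr L) \<and>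
     (\<forall>x\<in>carr L. \<forall>y\<in>carr L. brk L x y \<in> carr L) \<and>
     (\<forall>x\<in>carr L. \<forall>y\<in>carr L. \<forall>z\<in>carr L. brk L (x + y) z = brk L x z + brk L y z) \<and>
     (\<forall>x\<in>carr L. \<forall>y\<in>carr L. \<forall>z\<in>carr L. brk L x (y + z) = brk L x y + brk L x z) \<and>
     (\<forall>c. \<forall>x\<in>carr L. \<forall>y\<in>carr L. brk L (scal L c x) y = scal L c (brk L x y)) \<and>
     (\<forall>c. \<forall>x\<in>carr L. \<forall>y\<in>carr L. brk L x (scal L c y) = scal L c (brk L x y))"

definition left_leibniz :: "'a::ab_group_add calg \<Rightarrow> bool" where
  "left_leibniz L \<longleftrightarrow>
     fd_algebra L \<and>
     (\<forall>x\<in>carr L. \<forall>y\<in>carr L. \<forall>z\<in>carr L.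
        brk L (brk L x y) z = brk L x (brk L y z) - brk L y (brk L x z))"

definition alg_dim :: "'a::ab_group_add calg \<Rightarrow> nat" where
  "alg_dim L = vector_space.dim (scal L) (carr L)"

definition subalg :: "'a calg \<Rightarrow> 'a set \<Rightarrow> 'a calg" where
  "subalg L S = L\<lparr>carr := S\<rparr>"

definition bracket_span :: "'a::ab_group_add calg \<Rightarrow> 'a set \<Rightarrow> 'a set \<Rightarrow> 'a set" where
  "bracket_span L A B = module.span (scal L) {brk L x y | x y. x \<in> A \<and> y \<in> B}"

primrec derived_series :: "'a::ab_group_add calg \<Rightarrow> nat \<Rightarrow> 'a set" where
  "derived_series L 0 = carr L"
| "derived_series L (Suc k) = bracket_span L (derived_series L k) (derived_series L k)"

text \<open>
  For left Leibniz algebras the lower central series has to be formed with the whole algebra on the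
  left: in the left Leibniz algebra with basis \<open>y, z\<close> and only nonzero bracket \<open>[y, z] = z\<close>,
  the series with the algebra on the right reaches zero.
\<close>

primrec lower_central_series :: "'a::ab_group_add calg \<Rightarrow> nat \<Rightarrow> 'a set" where
  "lower_central_series L 0 = carr L"
| "lower_central_series L (Suc k) = bracket_span L (carr L) (lower_central_series L k)"

definition solvable_alg :: "'a::ab_group_add calg \<Rightarrow> bool" where
  "solvable_alg L \<longleftrightarrow> (\<exists>k. derived_series L k = {0})"

definition nilpotent_alg :: "'a::ab_group_add calg \<Rightarrow> bool" where
  "nilpotent_alg L \<longleftrightarrow> (\<exists>k. lower_central_series L k = {0})"

definition alg_ideal :: "'a::ab_group_add calg \<Rightarrow> 'a set \<Rightarrow> bool" where
  "alg_ideal L I \<longleftrightarrow>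
     module.subspace (scal L) I \<and> I \<subseteq> carr L \<and>
     (\<forall>x\<in>carr L. \<forall>y\<in>I. brk L x y \<in> I \<and> brk L y x \<in> I)"

definition nilpotent_ideal :: "'a::ab_group_add calg \<Rightarrow> 'a set \<Rightarrow> bool" where
  "nilpotent_ideal L I \<longleftrightarrow> alg_ideal L I \<and> nilpotent_alg (subalg L I)"

definition maximal_nilpotent_ideal :: "'a::ab_group_add calg \<Rightarrow> 'a set \<Rightarrow> bool" where
  "maximal_nilpotent_ideal L N \<longleftrightarrow>
     nilpotent_ideal L N \<and> (\<forall>I. nilpotent_ideal L I \<and> N \<subseteq> I \<longrightarrow> I = N)"

definition is_nilradical :: "'a::ab_group_add calg \<Rightarrow> 'a set \<Rightarrow> bool" where
  "is_nilradical L N \<longleftrightarrow>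
     maximal_nilpotent_ideal L N \<and> (\<forall>M. maximal_nilpotent_ideal L M \<longrightarrow> M = N)"

definition indecomposable_alg :: "'a::ab_group_add calg \<Rightarrow> bool" where
  "indecomposable_alg L \<longleftrightarrow>
     \<not> (\<exists>I J. alg_ideal L I \<and> alg_ideal L J \<and> I \<noteq> {0} \<and> J \<noteq> {0} \<and>
          I \<inter> J = {0} \<and> {x + y | x y. x \<in> I \<and> y \<in> J} = carr L)"

definition alg_iso :: "'a::ab_group_add calg \<Rightarrow> 'b::ab_group_add calg \<Rightarrow> bool"
    (infix "\<cong>\<^sub>a" 50) where
  "L \<cong>\<^sub>a M \<longleftrightarrow>
     (\<exists>f. bij_betw f (carr L) (carr M) \<and>
        (\<forall>x\<in>carr L. \<forall>y\<in>carr L. f (x + y) = f x + f y) \<and>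
        (\<forall>c. \<forall>x\<in>carr L. f (scal L c x) = scal M c (f x)) \<and>
        (\<forall>x\<in>carr L. \<forall>y\<in>carr L. f (brk L x y) = brk M (f x) (f y)))"


section \<open>Algebras given by a multiplication table\<close>

type_synonym cvec = "nat \<Rightarrow> complex"

definition cscale :: "complex \<Rightarrow> cvec \<Rightarrow> cvec" (infixr "\<odot>" 75) where
  "c \<odot> v = (\<lambda>k. c * v k)"

definition bvec :: "nat \<Rightarrow> cvec" ("\<e>") where
  "\<e> i = (\<lambda>k. if k = i then 1 else 0)"

text \<open>The \<open>d\<close>-dimensional algebra with basis \<open>\<e> 1, \<dots>, \<e> d\<close> and \<open>[\<e> i, \<e> j] = T i j\<close>.\<close>

definition table_alg :: "nat \<Rightarrow> (nat \<Rightarrow> nat \<Rightarrow> cvec) \<Rightarrow> cvec calg" where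
  "table_alg d T =
     \<lparr>carr = {x. \<forall>i. i \<notin> {1..d} \<longrightarrow> x i = 0},
      scal = cscale,
      brk = (\<lambda>x y. \<Sum>i=1..d. \<Sum>j=1..d. (x i * y j) \<odot> T i j)\<rparr>"

definition L4_table :: "nat \<Rightarrow> nat \<Rightarrow> nat \<Rightarrow> cvec" where
  "L4_table n i j =
     (if i = 1 \<and> j = 1 then \<e> 2
      else if 3 \<le> i \<and> i \<le> n - 1 \<and> j = 1 then \<e> (i + 1)
      else if i = 1 \<and> j = 3 then 2 \<odot> \<e> 2 - \<e> 4
      else if i = 3 \<and> j = 3 then \<e> 2
      else if i = 1 \<and> 4 \<le> j \<and> j \<le> n - 1 then - \<e> (j + 1)
      else 0)"

definition L4 :: "nat \<Rightarrow> cvec calg" where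
  "L4 n = table_alg n (L4_table n)"

text \<open>
  The \<open>(n + 1)\<close>-dimensional algebra that extends the brackets of \<open>L4 n\<close> by
  \<open>[\<e> i, \<e> (n + 1)] = r i\<close> and \<open>[\<e> (n + 1), \<e> i] = l i\<close> for \<open>1 \<le> i \<le> n\<close>, and
  \<open>[\<e> (n + 1), \<e> (n + 1)] = s\<close>.
\<close>

definition L4_ext :: "nat \<Rightarrow> (nat \<Rightarrow> cvec) \<Rightarrow> (nat \<Rightarrow> cvec) \<Rightarrow> cvec \<Rightarrow> cvec calg" where
  "L4_ext n r l s = table_alg (n + 1) (\<lambda>i j.
     if i \<le> n \<and> j \<le> n then L4_table n i j
     else if i \<le> n then r i
     else if j \<le> n then l j
     else s)"


section \<open>The listed algebras\<close>

definition alg1 :: "nat \<Rightarrow> complex \<Rightarrow> cvec calg" where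
  "alg1 n a = L4_ext n
     (\<lambda>i. if i = 1 then \<e> 1 + (a - 1) \<odot> \<e> 3
          else if i = 3 then a \<odot> \<e> 3
          else if i = 4 then (a + 1) \<odot> (\<e> 4 - \<e> 2)
          else if 5 \<le> i \<and> i \<le> n then (a + of_nat i - 3) \<odot> \<e> i
          else 0)
     (\<lambda>i. if i = 1 then - \<e> 1 - (a - 1) \<odot> \<e> 3
          else if i = 2 then (- 2 * a) \<odot> \<e> 2
          else if i = 3 then (- a) \<odot> \<e> 3
          else if i = 4 then (1 - a) \<odot> \<e> 2 - (a + 1) \<odot> \<e> 4
          else if 5 \<le> i \<and> i \<le> n then (3 - of_nat i - a) \<odot> \<e> i
          else 0)
     0"

definition alg2 :: "nat \<Rightarrow> cvec calg" where
  "alg2 n = L4_ext n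
     (\<lambda>i. if i = 1 then \<e> 1 + (2 - of_nat n) \<odot> \<e> 3
          else if i = 3 then (3 - of_nat n) \<odot> \<e> 3
          else if i = 4 then (of_nat n - 4) \<odot> (\<e> 2 - \<e> 4)
          else if 5 \<le> i \<and> i \<le> n then (of_nat i - of_nat n) \<odot> \<e> i
          else 0)
     (\<lambda>i. if i = 1 then - \<e> 1 + (of_nat n - 2) \<odot> \<e> 3
          else if i = 2 then (2 * of_nat n - 6) \<odot> \<e> 2
          else if i = 3 then (of_nat n - 3) \<odot> \<e> 3
          else if i = 4 then (of_nat n - 2) \<odot> \<e> 2 + (of_nat n - 4) \<odot> \<e> 4
          else if 5 \<le> i \<and> i \<le> n then (of_nat n - of_nat i) \<odot> \<e> i
          else 0)
     (\<e> n)"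

definition alg3 :: "nat \<Rightarrow> complex \<Rightarrow> (nat \<Rightarrow> complex) \<Rightarrow> cvec calg" where
  "alg3 n \<epsilon> b =
     (let ee = (\<lambda>k. if k \<le> n then \<e> k else 0);
          \<delta> = (\<lambda>i. if i = 4 then 1 else 0)
      in L4_ext n
        (\<lambda>i. if i = 1 then ee 3
             else if 3 \<le> i \<and> i \<le> n then
               - (\<delta> i \<odot> ee 2) + ee i + \<epsilon> \<odot> ee (i + 2) + (\<Sum>k=i+3..n. b (k - i - 2) \<odot> ee k)
             else 0)
        (\<lambda>i. if i = 1 then - ee 3
             else if i = 2 then (- 2) \<odot> ee 2
             else if 3 \<le> i \<and> i \<le> n then
               - (\<delta> i \<odot> ee 2) - ee i - \<epsilon> \<odot> ee (i + 2) - (\<Sum>k=i+3..n. b (k - i - 2) \<odot> ee k)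
             else 0)
        0)"

definition alg4 :: "nat \<Rightarrow> complex \<Rightarrow> complex \<Rightarrow> complex \<Rightarrow> cvec calg" where
  "alg4 n \<epsilon> d f = L4_ext n
     (\<lambda>i. if i = 1 then \<e> 1 - \<e> 3
          else if i = 3 then f \<odot> \<e> 2
          else if i = 4 then - \<e> 2 + \<e> 4
          else if 5 \<le> i \<and> i \<le> n then (of_nat i - 3) \<odot> \<e> i
          else 0)
     (\<lambda>i. if i = 1 then - \<e> 1 + (d + f) \<odot> \<e> 2 + \<e> 3
          else if i = 3 then d \<odot> \<e> 2
          else if i = 4 then \<e> 2 - \<e> 4
          else if 5 \<le> i \<and> i \<le> n then (3 - of_nat i) \<odot> \<e> i
          else 0)
     (\<epsilon> \<odot> \<e> 2)"

definition alg5 :: "complex \<Rightarrow> complex \<Rightarrow> cvec calg" where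
  "alg5 a b = L4_ext 4
     (\<lambda>i. if i = 1 then a \<odot> \<e> 1 + (b - a + 1) \<odot> \<e> 3
          else if i = 3 then \<e> 1 + b \<odot> \<e> 3
          else if i = 4 then (a + b) \<odot> (\<e> 4 - \<e> 2)
          else 0)
     (\<lambda>i. if i = 1 then (- a) \<odot> \<e> 1 + (a - b - 1) \<odot> \<e> 3
          else if i = 2 then (- 2 * (b + 1)) \<odot> \<e> 2
          else if i = 3 then - \<e> 1 - b \<odot> \<e> 3
          else if i = 4 then (a - b - 2) \<odot> \<e> 2 - (a + b) \<odot> \<e> 4
          else 0)
     0"

definition alg6 :: "complex \<Rightarrow> cvec calg" where
  "alg6 a = L4_ext 4
     (\<lambda>i. if i = 1 then a \<odot> \<e> 1 + (1 - 2 * a) \<odot> \<e> 3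
          else if i = 3 then \<e> 1 - a \<odot> \<e> 3
          else 0)
     (\<lambda>i. if i = 1 then (- a) \<odot> \<e> 1 + (2 * a - 1) \<odot> \<e> 3
          else if i = 2 then (2 * (a - 1)) \<odot> \<e> 2
          else if i = 3 then a \<odot> \<e> 3 - \<e> 1
          else if i = 4 then (2 * (a - 1)) \<odot> \<e> 2
          else 0)
     (\<e> 4)"

definition alg7 :: "complex \<Rightarrow> complex \<Rightarrow> complex \<Rightarrow> complex \<Rightarrow> cvec calg" where
  "alg7 \<epsilon> a d f = L4_ext 4
     (\<lambda>i. if i = 1 then a \<odot> (\<e> 1 - \<e> 3)
          else if i = 3 then \<e> 1 + f \<odot> \<e> 2 - \<e> 3
          else if i = 4 then (1 - a) \<odot> (\<e> 2 - \<e> 4)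
          else 0)
     (\<lambda>i. if i = 1 then (- a) \<odot> \<e> 1 + (d + f) \<odot> \<e> 2 + a \<odot> \<e> 3
          else if i = 3 then - \<e> 1 + d \<odot> \<e> 2 + \<e> 3
          else if i = 4 then (a - 1) \<odot> (\<e> 2 - \<e> 4)
          else 0)
     (\<epsilon> \<odot> \<e> 2)"

definition alg8 :: "complex \<Rightarrow> complex \<Rightarrow> complex \<Rightarrow> cvec calg" where
  "alg8 \<epsilon> c d = L4_ext 4
     (\<lambda>i. if i = 1 then c \<odot> \<e> 2
          else if i = 3 then \<e> 1 - \<e> 3
          else if i = 4 then \<e> 2 - \<e> 4
          else 0)
     (\<lambda>i. if i = 1 then (c + d) \<odot> \<e> 2
          else if i = 3 then - \<e> 1 + (d + 2 * c) \<odot> \<e> 2 + \<e> 3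
          else if i = 4 then \<e> 4 - \<e> 2
          else 0)
     (\<epsilon> \<odot> \<e> 2)"

definition listed_algs :: "nat \<Rightarrow> cvec calg set" where
  "listed_algs n =
     {alg1 n a | a. True}
   \<union> {alg2 n}
   \<union> {alg3 n \<epsilon> b | \<epsilon> b. \<epsilon> \<in> {0, 1}}
   \<union> {alg4 n \<epsilon> d f | \<epsilon> d f. \<epsilon> \<in> {0, 1} \<and> (\<epsilon> = 0 \<longrightarrow> (d, f) \<noteq> (0, 0))}
   \<union> (if n = 4 then
          {alg5 a b | a b. b = - 1 \<longrightarrow> a \<noteq> 1}
        \<union> {alg6 a | a. a \<noteq> 1}
        \<union> {alg7 \<epsilon> a d f | \<epsilon> a d f.
             \<epsilon> \<in> {0, 1} \<and> a \<noteq> 1 \<and> (\<epsilon> = 0 \<longrightarrow> (d, f) \<noteq> (0, 0))}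
        \<union> {alg8 \<epsilon> c d | \<epsilon> c d. \<epsilon> \<in> {0, 1} \<and> c \<noteq> 0}
      else {})"

definition solvable_ext_of_L4 :: "nat \<Rightarrow> 'a::ab_group_add calg \<Rightarrow> bool" where
  "solvable_ext_of_L4 n L \<longleftrightarrow>
     left_leibniz L \<and> solvable_alg L \<and> indecomposable_alg L \<and> alg_dim L = n + 1 \<and>
     (\<exists>N. is_nilradical L N \<and> subalg L N \<cong>\<^sub>a L4 n)"

end

theory Submission
  imports Defs
begin

text \<open>
  Put \<open>u = e\<^sub>1 - e\<^sub>3\<close>, \<open>w = e\<^sub>2\<close>, \<open>g 0 = e\<^sub>3\<close>, \<open>g 1 = e\<^sub>4 - e\<^sub>2\<close> and \<open>g i = e (i + 3)\<close> for \<open>i \<ge> 2\<close>. In this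
  basis the nilradical \<open>N\<close> has the brackets \<open>[g i, u] = g (i + 1) = - [u, g i]\<close> and \<open>[g 0, g 0] = w\<close>
  only: it is a filiform Lie algebra, centrally extended by a rank one symmetric form. If \<open>x\<close> spans a
  complement of \<open>N\<close>, the Leibniz identity makes left multiplication \<open>D\<close> by \<open>x\<close> a derivation of \<open>N\<close> and
  forces right multiplication to be \<open>- D\<close> up to central terms, so that everything is determined by
  \<open>[x, u]\<close>, \<open>[x, g 0]\<close>, \<open>[x, x]\<close> and a few scalars.

  Modulo the span of \<open>w\<close> and the \<open>g i\<close> with \<open>i \<ge> 1\<close>, the derivation \<open>D\<close> is triangular on \<open>u\<close>, \<open>g 0\<close>
  with eigenvalues \<open>al\<close>, \<open>ga\<close>. They are not both zero, since otherwise the whole algebra would be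
  nilpotent. Changing \<open>u\<close>, \<open>g 0\<close> and \<open>x\<close> removes the remaining parameters one after the other; the
  outcome is family (i) or (ii) if \<open>al\<close> and \<open>ga\<close> are nonzero and \<open>D\<close> is diagonalisable, (iii) if
  \<open>al = 0\<close>, (i) or (iv) if \<open>ga = 0\<close>, and (v) if \<open>D\<close> has a Jordan block, which happens only for
  \<open>n = 4\<close>. Families (vi), (vii) and (viii) are isomorphic to algebras of the families (i) to (iv).

  Conversely, a nilpotent ideal \<open>I\<close> lies in \<open>N\<close>, because \<open>D\<close> has a nonzero eigenvalue; and of two
  complementary ideals the one not contained in \<open>N\<close> contains \<open>w\<close> and the last \<open>g i\<close>, hence meets every
  nonzero ideal inside \<open>N\<close>.
\<close>

section \<open>Frames of the nilradical\<close>

interpretation cv: vector_space cscale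
  by unfold_locales (simp_all add: cscale_def fun_eq_iff algebra_simps)

lemma cscale_apply: "(c \<odot> v) k = c * v k"
  by (simp add: cscale_def)

lemma sum_fun_apply: "(\<Sum>i\<in>A. f i) k = (\<Sum>i\<in>A. f i k)"
  for f :: "'b \<Rightarrow> 'c \<Rightarrow> 'd::comm_monoid_add"
  by (induction A rule: infinite_finite_induct) simp_all

declare plus_fun_apply [simp del] zero_fun_apply [simp del] minus_apply [simp del] uminus_apply [simp del]

text \<open>Vector identities are first simplified as such, with the brackets evaluated; the linear
  rearrangement that remains is then checked coordinate by coordinate with these rules.\<close>

lemmas pointwise = cscale_apply plus_fun_apply zero_fun_apply minus_apply uminus_apply

definition coords :: "nat \<Rightarrow> cvec set" where
  "coords d = {x. \<forall>i. i \<notin> {1..d} \<longrightarrow> x i = 0}"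

lemma subspace_coords: "cv.subspace (coords d)"
  by (auto simp: cv.subspace_def coords_def pointwise)

text \<open>When \<open>g\<close> is continued by zero and \<open>[g i, u] = g (i + 1)\<close>, this
  is the polynomial with coefficients \<open>p\<close> in right multiplication by \<open>u\<close>,
  applied to \<open>g i\<close>. Bracketing with \<open>u\<close> only raises
  \<open>i\<close>.\<close>

definition gsum :: "nat \<Rightarrow> (nat \<Rightarrow> cvec) \<Rightarrow> (nat \<Rightarrow> complex) \<Rightarrow> nat \<Rightarrow> cvec" where
  "gsum m g p i = (\<Sum>k<m. p k \<odot> g (k + i))"

locale bilinear_bracket =
  fixes B :: "cvec \<Rightarrow> cvec \<Rightarrow> cvec"
  assumes add_left: "B (a + b) c = B a c + B b c"
    and add_right: "B c (a + b) = B c a + B c b"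
    and scale_left: "B (r \<odot> a) c = r \<odot> B a c"
    and scale_right: "B c (r \<odot> a) = r \<odot> B c a"
begin

lemma zero_left: "B 0 c = 0"
  using scale_left[of 0 0 c] by simp

lemma zero_right: "B c 0 = 0"
  using scale_right[of c 0 0] by simp

lemma minus_left: "B (- a) c = - B a c"
  using scale_left[of "-1" a c] by simp

lemma minus_right: "B c (- a) = - B c a"
  using scale_right[of c "-1" a] by simp

lemma diff_left: "B (a - b) c = B a c - B b c"
  using add_left[of a "- b" c] by (simp add: minus_left)

lemma diff_right: "B c (a - b) = B c a - B c b"
  using add_right[of c a "- b"] by (simp add: minus_right)

lemma sum_left: "B (\<Sum>i\<in>A. f i) c = (\<Sum>i\<in>A. B (f i) c)"
  by (rule additive.sum[of "\<lambda>a. B a c"]) (simp add: additive_def add_left)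

lemma sum_right: "B c (\<Sum>i\<in>A. f i) = (\<Sum>i\<in>A. B c (f i))"
  by (rule additive.sum[of "B c"]) (simp add: additive_def add_right)

lemmas bilin = add_left add_right scale_left scale_right zero_left zero_right
  minus_left minus_right diff_left diff_right sum_left sum_right

end

text \<open>Here \<open>m = n - 2\<close>, and \<open>g\<close> is continued by zero from \<open>m\<close> on, so that shifts need no bounds.\<close>

locale L4_frame = bilinear_bracket +
  fixes m :: nat and u w :: cvec and g :: "nat \<Rightarrow> cvec"
  assumes m_ge: "2 \<le> m"
    and g_zero: "m \<le> i \<Longrightarrow> g i = 0"
    and uu: "B u u = 0"
    and uw: "B u w = 0" and wu: "B w u = 0" and ww: "B w w = 0"
    and gu: "B (g i) u = g (Suc i)"
    and ug: "B u (g i) = - g (Suc i)"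
    and gg: "B (g i) (g j) = (if i = 0 \<and> j = 0 then w else 0)"
    and gw: "B (g i) w = 0" and wg: "B w (g i) = 0"
    and indep_center: "a \<odot> w + b \<odot> g (m - 1) = 0 \<Longrightarrow> a = 0 \<and> b = 0"
begin

abbreviation G :: "(nat \<Rightarrow> complex) \<Rightarrow> nat \<Rightarrow> cvec" where
  "G \<equiv> gsum m g"

lemma w_nonzero: "w \<noteq> 0"
  using indep_center[of 1 0] by auto

lemma g_last_nonzero: "g (m - 1) \<noteq> 0"
  using indep_center[of 0 1] by auto

lemma Gu: "B (G p i) u = G p (Suc i)"
  by (simp add: gsum_def bilin gu)

lemma uG: "B u (G p i) = - G p (Suc i)"
  by (simp add: gsum_def bilin ug sum_negf)

lemma Gw: "B (G p i) w = 0" and wG: "B w (G p i) = 0"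
  by (simp_all add: gsum_def bilin gw wg)

lemma Gg: "B (G p (Suc i)) (g j) = 0" and gG: "B (g j) (G p (Suc i)) = 0"
  by (simp_all add: gsum_def bilin gg)

lemma GG: "B (G p (Suc i)) (G q j) = 0" and GG': "B (G q j) (G p (Suc i)) = 0"
  by (simp_all add: gsum_def bilin gg)

lemma G_add: "G (\<lambda>k. p k + q k) i = G p i + G q i"
  by (simp add: gsum_def cv.scale_left_distrib sum.distrib)

lemma G_scale: "G (\<lambda>k. c * p k) i = c \<odot> G p i"
  by (simp add: gsum_def cv.scale_sum_right)

lemma G_minus: "G (\<lambda>k. - p k) i = - G p i"
  by (simp add: gsum_def sum_negf)

lemma G_zero: "G (\<lambda>k. 0) i = 0"
  by (simp add: gsum_def)

lemma G_split: "G p i = p 0 \<odot> g i + G (\<lambda>k. p (Suc k)) (Suc i)"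
proof -
  \<comment> \<open>The sum may run one step further, because the additional term contains
    \<open>g (m + i) = 0\<close>.\<close>
  have "(\<Sum>k<Suc m. p k \<odot> g (k + i)) = p 0 \<odot> g i + G (\<lambda>k. p (Suc k)) (Suc i)"
    by (simp only: sum.lessThan_Suc_shift gsum_def) simp
  then show ?thesis by (simp add: gsum_def g_zero)
qed

lemma G_ge: "m \<le> i \<Longrightarrow> G p i = 0"
  by (simp add: gsum_def g_zero)

lemma G_last: "G p (m - 1) = p 0 \<odot> g (m - 1)"
  using G_split[of p "m - 1"] G_ge[of m] m_ge by simp

text \<open>Terms below \<open>k\<close> vanish by hypothesis, and the shift by
  \<open>m - 1 - k\<close> moves all terms above \<open>k\<close> past the end.\<close>

lemma G_lead:
  assumes "k < m" "\<And>i. i < k \<Longrightarrow> p i = 0"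
  shows "G p (m - 1 - k) = p k \<odot> g (m - 1)"
proof -
  have "G p (m - 1 - k) = (\<Sum>i<m. if i = k then p k \<odot> g (m - 1) else 0)"
    unfolding gsum_def
  proof (rule sum.cong[OF refl])
    fix i assume "i \<in> {..<m}"
    consider "i < k" | "i = k" | "k < i" by linarith
    then show "p i \<odot> g (i + (m - 1 - k)) = (if i = k then p k \<odot> g (m - 1) else 0)"
      using assms by cases (auto simp: g_zero)
  qed
  then show ?thesis using assms by simp
qed

definition right_u :: "cvec \<Rightarrow> cvec" where "right_u y = B y u"

lemma right_u_iter: "(right_u ^^ j) (G p i) = G p (j + i)"
  by (induction j) (simp_all add: right_u_def Gu)

text \<open>Independence of \<open>w\<close> and \<open>g (m - 1)\<close> propagates: right
  multiplication by \<open>u\<close> kills \<open>u\<close> and \<open>w\<close>, so all shifts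
  \<open>G p (Suc i)\<close> vanish, and \<open>G_lead\<close> reads off the \<open>p k\<close> with
  \<open>k < m - 1\<close> one by one. Bracketing the remaining terms with \<open>g 0\<close>
  isolates \<open>a\<close>.\<close>

lemma N_indep:
  assumes "a \<odot> u + b \<odot> w + G p 0 = 0"
  shows "a = 0" "b = 0" "k < m \<Longrightarrow> p k = 0"
proof -
  have shifted: "G p (Suc i) = 0" for i
  proof (induction i)
    case 0
    have "B (a \<odot> u + b \<odot> w + G p 0) u = G p (Suc 0)" by (simp add: bilin uu wu Gu)
    with assms show ?case by (simp add: zero_left)
  next
    case (Suc i)
    then show ?case by (metis Gu zero_left)
  qed
  have low: "p k = 0" if "k < m - 1" for k
    using that
  proof (induction k rule: less_induct)
    case (less k)
    then have "G p (m - 1 - k) = p k \<odot> g (m - 1)" by (intro G_lead) auto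
    moreover have "m - 1 - k = Suc (m - 2 - k)" using less.prems by simp
    ultimately show ?case using shifted g_last_nonzero by simp
  qed
  then have top: "G p 0 = p (m - 1) \<odot> g (m - 1)"
    using G_lead[of "m - 1" p] m_ge by simp
  have "B (a \<odot> u + b \<odot> w + G p 0) (g 0) = - (a \<odot> g 1)"
    using m_ge by (simp add: top bilin ug wg gg)
  with assms have "a \<odot> g 1 = 0" by (simp add: zero_left)
  moreover have "g 1 \<noteq> 0"
  proof
    assume "g 1 = 0"
    have "g (Suc i) = 0" for i
    proof (induction i)
      case 0
      then show ?case using \<open>g 1 = 0\<close> by simp
    next
      case (Suc i)
      then show "g (Suc (Suc i)) = 0" by (metis gu zero_left)
    qed
    from this[of "m - 2"] show False using g_last_nonzero m_ge by (simp add: Suc_diff_Suc numeral_2_eq_2)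
  qed
  ultimately show "a = 0" by simp
  with assms top have "b \<odot> w + p (m - 1) \<odot> g (m - 1) = 0" by simp
  from indep_center[OF this] have "b = 0" "p (m - 1) = 0" by auto
  then show "b = 0" "k < m \<Longrightarrow> p k = 0"
    using low[of k] by (cases "k = m - 1"; simp)+
qed

lemma g_nonzero: "k < m \<Longrightarrow> g k \<noteq> 0"
proof
  assume "k < m" "g k = 0"
  then have "0 \<odot> u + 0 \<odot> w + G (\<lambda>i. if i = k then 1 else 0) 0 = 0"
    by (simp add: gsum_def if_distrib[of "\<lambda>r. r \<odot> _"] cong: if_cong)
  from N_indep(3)[OF this \<open>k < m\<close>] show False by simp
qed

end

section \<open>Extensions by one element\<close>

context vector_space
begin

lemma independent_family:
  assumes fin: "finite I"
    and ind: "\<And>c i. (\<Sum>i\<in>I. c i *s F i) = 0 \<Longrightarrow> i \<in> I \<Longrightarrow> c i = 0"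
  shows "inj_on F I" and "independent (F ` I)"
proof -
  show inj: "inj_on F I"
  proof (rule inj_onI, rule ccontr)
    fix i j assume ij: "i \<in> I" "j \<in> I" "F i = F j" "i \<noteq> j"
    let ?c = "\<lambda>k. if k = i then 1 else if k = j then - 1 else (0::'a)"
    have "(\<Sum>k\<in>I. ?c k *s F k) = (\<Sum>k\<in>{i, j}. ?c k *s F k)"
      by (rule sum.mono_neutral_right) (use fin ij in auto)
    also have "\<dots> = 0" using ij by simp
    finally have "?c i = 0" using ind[of ?c i] ij(1) by blast
    then show False by simp
  qed
  show "independent (F ` I)"
  proof (rule independent_if_scalars_zero)
    show "finite (F ` I)" using fin by simp
    fix f x assume "(\<Sum>v\<in>F ` I. f v *s v) = 0" "x \<in> F ` I"
    then show "f x = 0" using ind[of "\<lambda>i. f (F i)"] by (auto simp: sum.reindex[OF inj])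
  qed
qed

text \<open>The independent set extends to a basis of \<open>V\<close>; the finite set
  \<open>T\<close> makes that basis finite, so that equal cardinalities force equality.\<close>

lemma full_independent_spans:
  assumes ind: "independent S" and fin: "finite S" and sub: "S \<subseteq> V" and card: "card S = dim V"
    and T: "finite T" "V \<subseteq> span T"
  shows "V \<subseteq> span S"
proof -
  obtain S' where S': "S \<subseteq> S'" "S' \<subseteq> V" "independent S'" "V \<subseteq> span S'"
    using maximal_independent_subset_extend[OF sub ind] by metis
  have "finite S'" using independent_span_bound[OF T(1) S'(3)] S'(2) T(2) by blast
  moreover have "card S' = dim V" using basis_card_eq_dim S' by blast
  ultimately have "S = S'" using S'(1) card by (metis card_subset_eq)
  then show ?thesis using S' by simp
qed

lemma span_family:
  assumes "inj_on F I" "finite I" "y \<in> span (F ` I)"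
  obtains c where "y = (\<Sum>i\<in>I. c i *s F i)"
proof -
  from assms obtain f where "y = (\<Sum>v\<in>F ` I. f v *s v)"
    by (auto simp: span_finite)
  then have "y = (\<Sum>i\<in>I. f (F i) *s F i)"
    using assms(1) by (simp add: sum.reindex)
  then show ?thesis by (rule that)
qed

end

lemma coords_expand:
  assumes "y \<in> coords d"
  shows "y = (\<Sum>i=1..d. y i \<odot> \<e> i)"
proof
  fix k
  have "(\<Sum>i=1..d. y i \<odot> \<e> i) k = (\<Sum>i=1..d. if i = k then y k else 0)"
    unfolding sum_fun_apply by (rule sum.cong) (auto simp: bvec_def pointwise)
  also have "\<dots> = y k" using assms by (auto simp: coords_def)
  finally show "y k = (\<Sum>i=1..d. y i \<odot> \<e> i) k" by simp
qed

lemma bvec_coords: "i \<in> {1..d} \<Longrightarrow> \<e> i \<in> coords d"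
  by (auto simp: coords_def bvec_def)

lemma bvec_family: "(\<Sum>i\<in>{1..d}. c i \<odot> \<e> i) = 0 \<Longrightarrow> i \<in> {1..d} \<Longrightarrow> c i = 0"
proof -
  assume s: "(\<Sum>i\<in>{1..d}. c i \<odot> \<e> i) = 0" and i: "i \<in> {1..d}"
  have "(\<Sum>j=1..d. c j \<odot> \<e> j) i = (\<Sum>j=1..d. if j = i then c i else 0)"
    unfolding sum_fun_apply by (rule sum.cong) (auto simp: bvec_def pointwise)
  also have "\<dots> = c i" using i by simp
  finally show "c i = 0" using s by (simp add: zero_fun_apply)
qed

lemma span_bvec: "cv.span (\<e> ` {1..d}) = coords d"
proof
  show "cv.span (\<e> ` {1..d}) \<subseteq> coords d"
    by (rule cv.span_minimal[OF _ subspace_coords]) (auto intro: bvec_coords)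
  show "coords d \<subseteq> cv.span (\<e> ` {1..d})"
  proof
    fix y assume "y \<in> coords d"
    then show "y \<in> cv.span (\<e> ` {1..d})"
      using coords_expand by (metis (no_types, lifting) cv.span_sum cv.span_scale cv.span_base imageI)
  qed
qed

lemma dim_coords: "cv.dim (coords d) = d"
proof -
  have fam: "inj_on \<e> {1..d}" "cv.independent (\<e> ` {1..d})"
    by (rule cv.independent_family; use bvec_family in blast)+
  have "cv.dim (coords d) = card (\<e> ` {1..d})"
    by (metis cv.dim_span_eq_card_independent fam(2) span_bvec)
  also have "\<dots> = d" using fam(1) by (simp add: card_image)
  finally show ?thesis .
qed

lemma bilinear_eq_on_span:
  assumes "bilinear_bracket B" "bilinear_bracket B'"
    and eq: "\<And>a b. a \<in> S \<Longrightarrow> b \<in> S \<Longrightarrow> B a b = B' a b"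
    and a: "a \<in> cv.span S" and b: "b \<in> cv.span S"
  shows "B a b = B' a b"
proof -
  interpret B: bilinear_bracket B by fact
  interpret B': bilinear_bracket B' by fact
  have 1: "B a b = B' a b" if "a \<in> S" for a
    using b
  proof (rule cv.span_induct)
    show "cv.subspace {b. B a b = B' a b}"
      unfolding cv.subspace_def by (simp add: B.bilin B'.bilin)
  qed (use eq that in blast)
  show ?thesis
    using a
  proof (rule cv.span_induct)
    show "cv.subspace {a. B a b = B' a b}"
      unfolding cv.subspace_def by (simp add: B.bilin B'.bilin)
  qed (use 1 in blast)
qed

text \<open>The nilradical is realised as \<open>coords (m + 2)\<close> inside
  \<open>coords (m + 3)\<close>, so that the coordinate \<open>m + 3\<close> of a vector measures
  its component along \<open>x\<close>.\<close>

locale L4_coords_frame = L4_frame +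
  fixes x :: cvec
  assumes u_coords: "u \<in> coords (m + 2)" and w_coords: "w \<in> coords (m + 2)"
    and g_coords: "g i \<in> coords (m + 2)"
    and x_coords: "x \<in> coords (m + 3)" and x_outside: "x (m + 3) \<noteq> 0"
begin

definition family :: "nat \<Rightarrow> cvec" where
  "family i = (if i = 0 then u else if i = 1 then w else if i = 2 then x else g (i - 3))"

lemma family_sum:
  "(\<Sum>i<m + 3. r i \<odot> family i) = r 0 \<odot> u + r 1 \<odot> w + r 2 \<odot> x + G (\<lambda>k. r (k + 3)) 0"
proof -
  have "{..<m + 3} = {0, 1, 2} \<union> {3..<m + 3}" by auto
  then have "(\<Sum>i<m + 3. r i \<odot> family i) = (\<Sum>i\<in>{0, 1, 2}. r i \<odot> family i) + (\<Sum>i=3..<m + 3. r i \<odot> family i)"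
    by (simp add: sum.union_disjoint)
  also have "(\<Sum>i=3..<m + 3. r i \<odot> family i) = G (\<lambda>k. r (k + 3)) 0"
    using sum.shift_bounds_nat_ivl[of "\<lambda>i. r i \<odot> family i" 0 3 m]
    by (simp add: gsum_def atLeast0LessThan family_def)
  finally show ?thesis by (simp add: family_def add.assoc)
qed

lemma coords_mono: "coords (m + 2) \<subseteq> coords (m + 3)"
  by (auto simp: coords_def)

lemma G_coords: "G p i \<in> coords (m + 2)"
  unfolding gsum_def
  by (intro cv.subspace_sum cv.subspace_scale subspace_coords g_coords)

lemma family_independent:
  assumes "(\<Sum>i<m + 3. r i \<odot> family i) = 0" "i < m + 3"
  shows "r i = 0"
proof -
  have 0: "r 0 \<odot> u + r 1 \<odot> w + r 2 \<odot> x + G (\<lambda>k. r (k + 3)) 0 = 0"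
    using assms(1) family_sum by simp
  have out: "y (m + 3) = 0" if "y \<in> coords (m + 2)" for y
    using that by (simp add: coords_def)
  have "(r 0 \<odot> u + r 1 \<odot> w + r 2 \<odot> x + G (\<lambda>k. r (k + 3)) 0) (m + 3) = r 2 * x (m + 3)"
    using out[OF u_coords] out[OF w_coords] out[OF G_coords] by (simp add: pointwise)
  then have "r 2 = 0" using 0 x_outside by (metis mult_eq_0_iff zero_fun_apply)
  with 0 have "r 0 \<odot> u + r 1 \<odot> w + G (\<lambda>k. r (k + 3)) 0 = 0" by simp
  note N_indep[OF this]
  then have "r 0 = 0" "r 1 = 0" "\<And>k. k < m \<Longrightarrow> r (k + 3) = 0" by auto
  moreover have "i = 0 \<or> i = 1 \<or> i = 2 \<or> i = i - 3 + 3 \<and> i - 3 < m" using assms(2) by linarith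
  ultimately show ?thesis using \<open>r 2 = 0\<close> by metis
qed

lemma family_coords: "family i \<in> coords (m + 3)"
  using u_coords w_coords x_coords g_coords coords_mono by (auto simp: family_def)

lemma inj_family: "inj_on family {..<m + 3}"
  and independent_family: "cv.independent (family ` {..<m + 3})"
  using cv.independent_family[of "{..<m + 3}" family] family_independent by auto

lemma span_family: "cv.span (family ` {..<m + 3}) = coords (m + 3)"
proof
  show "cv.span (family ` {..<m + 3}) \<subseteq> coords (m + 3)"
    by (rule cv.span_minimal[OF _ subspace_coords]) (auto intro: family_coords)
  show "coords (m + 3) \<subseteq> cv.span (family ` {..<m + 3})"
  proof (rule cv.full_independent_spans[OF independent_family])
    show "card (family ` {..<m + 3}) = cv.dim (coords (m + 3))"
      by (simp add: card_image[OF inj_family] dim_coords)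
    show "coords (m + 3) \<subseteq> cv.span (\<e> ` {1..m + 3})" using span_bvec by simp
  qed (use family_coords in auto)
qed

text \<open>A spanning set that contains 0, namely \<open>g i\<close> for large \<open>i\<close>:
  bilinear identities can be checked on it without index bounds.\<close>

definition basis :: "cvec set" where "basis = {u, w, x} \<union> range g"

lemma span_basis: "cv.span basis = coords (m + 3)"
proof
  show "cv.span basis \<subseteq> coords (m + 3)"
    by (rule cv.span_minimal[OF _ subspace_coords])
      (use u_coords w_coords x_coords g_coords coords_mono in \<open>auto simp: basis_def\<close>)
  have "family ` {..<m + 3} \<subseteq> basis" by (auto simp: family_def basis_def)
  then show "coords (m + 3) \<subseteq> cv.span basis"
    using cv.span_mono span_family by metis
qed

lemma coords_N_expand:
  assumes "y \<in> coords (m + 2)"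
  obtains a b p where "y = a \<odot> u + b \<odot> w + G p 0"
proof -
  have "y \<in> cv.span (family ` {..<m + 3})" using assms coords_mono span_family by auto
  then obtain r where r: "y = (\<Sum>i<m + 3. r i \<odot> family i)"
    using cv.span_family[OF inj_family] by blast
  have out: "y (m + 3) = 0" if "y \<in> coords (m + 2)" for y
    using that by (simp add: coords_def)
  have "y (m + 3) = r 2 * x (m + 3)"
    using out[OF u_coords] out[OF w_coords] out[OF G_coords] by (simp add: r family_sum pointwise)
  with out[OF assms] x_outside have "r 2 = 0" by simp
  then show ?thesis using r family_sum that[of "r 0" "r 1"] by simp
qed

lemma coords_expand_x:
  assumes "y \<in> coords (m + 3)"
  obtains z where "z \<in> coords (m + 2)" "y = (y (m + 3) / x (m + 3)) \<odot> x + z"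
proof (rule that)
  let ?z = "y - (y (m + 3) / x (m + 3)) \<odot> x"
  have "?z \<in> coords (m + 3)"
    by (intro cv.subspace_diff cv.subspace_scale subspace_coords assms x_coords)
  moreover have "?z (m + 3) = 0" using x_outside by (simp add: pointwise)
  ultimately show "?z \<in> coords (m + 2)"
    unfolding coords_def by (smt (verit) atLeastAtMost_iff mem_Collect_eq add.commute
        add_2_eq_Suc' add_Suc_right le_SucE numeral_3_eq_3 numeral_2_eq_2)
qed simp

end

text \<open>
  The sequences \<open>c\<close> and \<open>d\<close> are indexed so that their entry \<open>k\<close> is the coefficient of \<open>g (k + 1)\<close>.
  The scalars \<open>su\<close> and \<open>sv\<close> measure by how much \<open>[x, u]\<close> and \<open>[x, g 0]\<close> fail to be antisymmetric.
\<close>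

locale L4_ext_frame = L4_coords_frame +
  fixes al ga de :: complex and c d :: "nat \<Rightarrow> complex"
    and fu fv su sv ta ze :: complex
  assumes xu: "B x u = al \<odot> u + G d 1 + fu \<odot> w"
    and xg0: "B x (g 0) = ga \<odot> g 0 + de \<odot> u + G c 1 + fv \<odot> w"
    and ux: "B u x = su \<odot> w - B x u"
    and g0x: "B (g 0) x = sv \<odot> w - B x (g 0)"
    and xx: "B x x = ta \<odot> g (m - 1) + ze \<odot> w"

text \<open>These brackets follow from the Leibniz identity and those of
  \<open>L4_ext_frame\<close>, as is shown in \<open>L4_leibniz_frame\<close>. They are listed as
  hypotheses so that a multiplication table is covered before its Leibniz identity is known.\<close>

locale L4_ext_brackets = L4_ext_frame +
  assumes xw: "B x w = (2 * ga) \<odot> w" and wx: "B w x = 0"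
    and xg: "B x (g (Suc i)) = (ga + of_nat (Suc i) * al) \<odot> g (Suc i) + G c (Suc (Suc i))"
    and gx: "B (g (Suc i)) x = - B x (g (Suc i))"
begin

lemma Gx: "B (G p (Suc i)) x = - B x (G p (Suc i))"
  by (simp add: gsum_def bilin gx sum_negf)

lemma basis_cases:
  assumes "a \<in> basis"
  obtains "a = u" | "a = w" | "a = x" | "a = g 0" | i where "a = g (Suc i)"
proof -
  have "g i = g 0 \<or> (\<exists>j. g i = g (Suc j))" for i
    by (cases i) auto
  then show ?thesis using assms that unfolding basis_def by blast
qed

lemmas brackets = uu uw wu ww gu ug gg gw wg Gu uG Gw wG Gg gG GG GG' xu xg0 ux g0x xx xw wx xg gx Gx

end

text \<open>The parameters determine every bracket of two basis vectors, so the linear map that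
  takes one frame to the other is a homomorphism. Classification thus amounts to producing frames
  with equal parameters.\<close>

theorem ext_frames_iso:
  assumes "L4_ext_brackets B1 m u1 w1 g1 x1 al ga de c d fu fv su sv ta ze"
    and "L4_ext_brackets B2 m u2 w2 g2 x2 al ga de c d fu fv su sv ta ze"
    and M1: "carr M1 = coords (m + 3)" "scal M1 = cscale" "brk M1 = B1"
    and M2: "carr M2 = coords (m + 3)" "scal M2 = cscale" "brk M2 = B2"
  shows "M1 \<cong>\<^sub>a M2"
proof -
  interpret F1: L4_ext_brackets B1 m u1 w1 g1 x1 al ga de c d fu fv su sv ta ze by fact
  interpret F2: L4_ext_brackets B2 m u2 w2 g2 x2 al ga de c d fu fv su sv ta ze by fact
  interpret cp: vector_space_pair cscale cscale by unfold_locales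
  obtain h where lin: "Vector_Spaces.linear cscale cscale h"
    and h: "\<And>y. y \<in> F1.family ` {..<m + 3} \<Longrightarrow> h y = F2.family (inv_into {..<m + 3} F1.family y)"
    using cp.linear_independent_extend[OF F1.independent_family,
        of "\<lambda>y. F2.family (inv_into {..<m + 3} F1.family y)"] by blast
  interpret h: Vector_Spaces.linear cscale cscale h by fact
  have hF: "h (F1.family i) = F2.family i" if "i < m + 3" for i
    using h[of "F1.family i"] that inv_into_f_f[OF F1.inj_family] by simp
  have hu: "h u1 = u2" and hw: "h w1 = w2" and hx: "h x1 = x2"
    using hF[of 0] hF[of 1] hF[of 2] by (simp_all add: F1.family_def F2.family_def)
  have hg: "h (g1 i) = g2 i" for i
    using hF[of "i + 3"] by (cases "i < m") (simp_all add: F1.family_def F2.family_def F1.g_zero F2.g_zero)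
  have hG: "h (gsum m g1 p i) = gsum m g2 p i" for p i
    by (simp add: gsum_def h.sum h.scale hg)
  note hlin = h.add h.scale h.diff h.neg h.zero
  have hom: "h (B1 a b) = B2 (h a) (h b)" if "a \<in> coords (m + 3)" "b \<in> coords (m + 3)" for a b
  proof (rule bilinear_eq_on_span[of "\<lambda>a b. h (B1 a b)" "\<lambda>a b. B2 (h a) (h b)" F1.basis])
    show "bilinear_bracket (\<lambda>a b. h (B1 a b))"
      by unfold_locales (simp_all add: F1.bilin hlin)
    show "bilinear_bracket (\<lambda>a b. B2 (h a) (h b))"
      by unfold_locales (simp_all add: F2.bilin hlin)
    show "a \<in> cv.span F1.basis" "b \<in> cv.span F1.basis" using that F1.span_basis by auto
    fix a b assume a: "a \<in> F1.basis" and b: "b \<in> F1.basis"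
    show "h (B1 a b) = B2 (h a) (h b)"
      using a b
      by (elim F1.basis_cases) (simp_all add: F1.brackets F2.brackets hlin hu hw hx hg hG)
  qed
  have surj: "h ` coords (m + 3) = coords (m + 3)"
  proof -
    have "h ` F1.family ` {..<m + 3} = F2.family ` {..<m + 3}"
      using hF by (auto simp: image_iff)
    then show ?thesis using h.span_image[of "F1.family ` {..<m + 3}"] F1.span_family F2.span_family by simp
  qed
  have inj: "inj_on h (coords (m + 3))"
  proof -
    have "cv.independent (h ` F1.family ` {..<m + 3})"
      by (rule back_subst[of cv.independent, OF F2.independent_family]) (use hF in \<open>auto simp: image_iff\<close>)
    moreover have "inj_on h (F1.family ` {..<m + 3})"
      using F2.inj_family hF by (auto simp: inj_on_def)
    ultimately show ?thesis
      using h.inj_on_span_iff_independent_image F1.span_family by metis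
  qed
  show ?thesis
    unfolding alg_iso_def M1 M2
    by (rule exI[of _ h]) (use surj inj hom hlin in \<open>auto simp: bij_betw_def\<close>)
qed

section \<open>The filtration of the nilradical, and brackets modulo \<open>K\<close>\<close>

context L4_frame
begin

text \<open>The derived algebra of the nilradical; it has zero multiplication.\<close>

definition K :: "cvec set" where "K = {b \<odot> w + G q 1 | b q. True}"

definition H :: "nat \<Rightarrow> cvec set" where "H j = {G q j | q. True}"

lemma subspace_H: "cv.subspace (H j)"
proof -
  have "\<exists>q. G q j = 0" using G_zero by blast
  then show ?thesis
    unfolding cv.subspace_def H_def
    by (auto intro: G_add[symmetric] G_scale[symmetric] dest: sym)
qed

lemma subspace_K: "cv.subspace K"
proof (rule cv.subspaceI)
  show "0 \<in> K"
    unfolding K_def using G_zero[of 1] by (force intro: exI[of _ "0::complex"])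
next
  fix y z assume "y \<in> K" "z \<in> K"
  then obtain b q b' q' where "y = b \<odot> w + G q 1" "z = b' \<odot> w + G q' 1" by (auto simp: K_def)
  then have "y + z = (b + b') \<odot> w + G (\<lambda>k. q k + q' k) 1"
    unfolding G_add by (simp add: algebra_simps)
  then show "y + z \<in> K" unfolding K_def by blast
next
  fix r y assume "y \<in> K"
  then obtain b q where "y = b \<odot> w + G q 1" by (auto simp: K_def)
  then have "r \<odot> y = (r * b) \<odot> w + G (\<lambda>k. r * q k) 1"
    unfolding G_scale by (simp add: algebra_simps)
  then show "r \<odot> y \<in> K" unfolding K_def by blast
qed

lemma w_K: "w \<in> K"
proof -
  have "w = 1 \<odot> w + G (\<lambda>k. 0) 1" by (simp add: G_zero)
  then show ?thesis unfolding K_def by blast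
qed

lemma G1_K: "G p (Suc 0) \<in> K"
proof -
  have "G p (Suc 0) = 0 \<odot> w + G p 1" by simp
  then show ?thesis unfolding K_def by blast
qed

lemma g_H: "j \<le> i \<Longrightarrow> g i \<in> H j"
proof -
  assume ij: "j \<le> i"
  show "g i \<in> H j"
  proof (cases "i - j < m")
    case True
    then have "g i = G (\<lambda>k. if k = i - j then 1 else 0) j"
      using ij by (simp add: gsum_def if_distrib[of "\<lambda>r. r \<odot> _"] cong: if_cong)
    then show ?thesis unfolding H_def by blast
  next
    case False
    then show ?thesis using g_zero[of i] cv.subspace_0[OF subspace_H] by simp
  qed
qed

lemma G_H: "j \<le> i \<Longrightarrow> G p i \<in> H j"
  unfolding gsum_def by (intro cv.subspace_sum[OF subspace_H] cv.subspace_scale[OF subspace_H] g_H) simp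

lemma H_K: "H (Suc 0) \<subseteq> K"
  using G1_K unfolding H_def by blast

lemma g_K: "g (Suc i) \<in> K"
  using g_H[of "Suc 0" "Suc i"] H_K by auto

lemma G_K: "G p (Suc i) \<in> K"
  unfolding gsum_def by (intro cv.subspace_sum[OF subspace_K] cv.subspace_scale[OF subspace_K]) (simp add: g_K)

end

context L4_coords_frame
begin

abbreviation N :: "cvec set" where "N \<equiv> coords (m + 2)"

lemma K_coords: "K \<subseteq> N"
  unfolding K_def using subspace_coords[of "m + 2"] w_coords G_coords
  by (auto intro!: cv.subspace_add cv.subspace_scale)

lemma bracket_NN:
  assumes "y \<in> N" "z \<in> N"
  shows "B y z \<in> K"
proof -
  obtain a b p where "y = a \<odot> u + b \<odot> w + G p 0" using assms(1) by (rule coords_N_expand)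
  then have y: "y = a \<odot> u + b \<odot> w + (p 0 \<odot> g 0 + G (\<lambda>k. p (Suc k)) (Suc 0))"
    using G_split[of p 0] by simp
  obtain a' b' q where "z = a' \<odot> u + b' \<odot> w + G q 0" using assms(2) by (rule coords_N_expand)
  then have z: "z = a' \<odot> u + b' \<odot> w + (q 0 \<odot> g 0 + G (\<lambda>k. q (Suc k)) (Suc 0))"
    using G_split[of q 0] by simp
  have "B y z = (a' * p 0 - a * q 0) \<odot> g (Suc 0) + (p 0 * q 0) \<odot> w
      + (a' \<odot> G (\<lambda>k. p (Suc k)) (Suc (Suc 0)) - a \<odot> G (\<lambda>k. q (Suc k)) (Suc (Suc 0)))"
    by (simp add: y z bilin uu uw wu ww gu ug gg gw wg Gu uG Gw wG Gg gG GG)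
      (simp add: fun_eq_iff pointwise algebra_simps)
  also have "\<dots> \<in> K"
    by (intro cv.subspace_add[OF subspace_K] cv.subspace_diff[OF subspace_K] cv.subspace_scale[OF subspace_K]
        g_K w_K G_K)
  finally show ?thesis .
qed

lemma bracket_KK:
  assumes "y \<in> K" "z \<in> K"
  shows "B y z = 0"
proof -
  obtain b q b' q' where "y = b \<odot> w + G q (Suc 0)" "z = b' \<odot> w + G q' (Suc 0)"
    using assms by (auto simp: K_def)
  then show ?thesis by (simp add: bilin ww wG Gw GG)
qed

text \<open>On \<open>K\<close> only the component of \<open>y\<close> along \<open>u\<close> acts,
  as the shift by one up to a factor; \<open>w\<close> is lost. The two alternatives on
  \<open>z\<close> are the first and the later terms of the lower central series.\<close>

lemma bracket_NH:
  assumes "y \<in> N" "z \<in> K \<and> j = 1 \<or> z \<in> H j \<and> j \<ge> 1"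
  shows "B y z \<in> H (Suc j)"
proof -
  obtain a b p where y: "y = a \<odot> u + b \<odot> w + G p 0" using assms(1) by (rule coords_N_expand)
  obtain b' q where z: "z = b' \<odot> w + G q j" and j: "j \<ge> 1"
  proof -
    show thesis
      using assms(2)
    proof
      assume "z \<in> K \<and> j = 1"
      then show thesis using that unfolding K_def by blast
    next
      assume "z \<in> H j \<and> j \<ge> 1"
      then show thesis using that[of 0] unfolding H_def by auto
    qed
  qed
  obtain i where i: "j = Suc i" using j by (cases j) auto
  have "B y z = - (a \<odot> G q (Suc j))" by (simp add: y z i bilin uw ww Gw uG wG GG')
  also have "\<dots> = G (\<lambda>k. (- a) * q k) (Suc j)" unfolding G_scale by simp
  finally show ?thesis unfolding H_def by blast
qed

end

locale L4_frame_algebra = L4_coords_frame +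
  fixes A :: "cvec calg"
  assumes carr_A: "carr A = coords (m + 3)" and scal_A: "scal A = cscale" and brk_A: "brk A = B"
begin

lemma bracket_span_subset:
  assumes "cv.subspace W" "\<And>y z. y \<in> Y \<Longrightarrow> z \<in> Z \<Longrightarrow> B y z \<in> W"
  shows "bracket_span A Y Z \<subseteq> W"
  unfolding bracket_span_def scal_A brk_A by (rule cv.span_minimal) (use assms in auto)

lemma zero_bracket_span: "0 \<in> bracket_span A Y Z"
  unfolding bracket_span_def scal_A by (rule cv.span_zero)

end

context L4_ext_brackets
begin

lemma x_K:
  assumes "k \<in> K"
  shows "B x k \<in> K" "B k x \<in> K"
proof -
  obtain b q where k: "k = b \<odot> w + G q (Suc 0)" using assms by (auto simp: K_def)
  have xG: "B x (G q (Suc 0)) \<in> K"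
  proof -
    have "B x (G q (Suc 0)) = (\<Sum>k<m. q k \<odot> ((ga + of_nat (Suc k) * al) \<odot> g (Suc k) + G c (Suc (Suc k))))"
      by (simp add: gsum_def[of m g q] bilin xg)
    also have "\<dots> \<in> K"
      by (intro cv.subspace_sum[OF subspace_K] cv.subspace_scale[OF subspace_K]
          cv.subspace_add[OF subspace_K] g_K G_K)
    finally show ?thesis .
  qed
  show "B x k \<in> K"
    unfolding k bilin xw
    by (intro xG w_K cv.subspace_scale[OF subspace_K] cv.subspace_add[OF subspace_K])
  show "B k x \<in> K"
    unfolding k bilin wx Gx cv.scale_zero_right
    using cv.subspace_neg[OF subspace_K xG] by simp
qed

text \<open>\<open>rep y s a r\<close>: modulo \<open>K\<close>, the vector \<open>y\<close> has coordinates \<open>s\<close>, \<open>a\<close>, \<open>r\<close> with respect to \<open>x\<close>, \<open>u\<close>, \<open>g 0\<close>.\<close>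

definition rep :: "cvec \<Rightarrow> complex \<Rightarrow> complex \<Rightarrow> complex \<Rightarrow> bool" where
  "rep y s a r \<longleftrightarrow> y - (s \<odot> x + a \<odot> u + r \<odot> g 0) \<in> K"

lemma rep_N: "rep (a \<odot> u + b \<odot> w + G p 0) 0 a (p 0)"
proof -
  have "a \<odot> u + b \<odot> w + G p 0 - (0 \<odot> x + a \<odot> u + p 0 \<odot> g 0) = b \<odot> w + G (\<lambda>k. p (Suc k)) (Suc 0)"
    by (subst G_split[of p 0]) simp
  then show ?thesis unfolding rep_def K_def by auto
qed

lemma rep_unique:
  assumes "rep y s a r" "rep y s' a' r'"
  shows "s = s' \<and> a = a' \<and> r = r'"
proof -
  let ?k = "(y - (s \<odot> x + a \<odot> u + r \<odot> g 0)) - (y - (s' \<odot> x + a' \<odot> u + r' \<odot> g 0))"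
  have "?k \<in> K" using assms cv.subspace_diff[OF subspace_K] unfolding rep_def by blast
  then obtain b q where k: "?k = b \<odot> w + G q (Suc 0)" by (auto simp: K_def)
  define p where "p = (\<lambda>k. if k = 0 then r - r' else q (k - 1))"
  have Gp: "G p 0 = (r - r') \<odot> g 0 + G q (Suc 0)"
    by (subst G_split) (simp add: p_def)
  have eq: "(s - s') \<odot> x + ((a - a') \<odot> u + b \<odot> w + G p 0) = 0"
    using k unfolding Gp by (simp add: algebra_simps)
  have "((a - a') \<odot> u + b \<odot> w + G p 0) \<in> coords (m + 2)"
    by (intro cv.subspace_add cv.subspace_scale subspace_coords u_coords w_coords G_coords)
  then have "((s - s') \<odot> x + ((a - a') \<odot> u + b \<odot> w + G p 0)) (m + 3) = (s - s') * x (m + 3)"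
    by (simp add: coords_def pointwise)
  with eq x_outside have s: "s = s'" by (simp add: zero_fun_apply)
  with eq have "(a - a') \<odot> u + b \<odot> w + G p 0 = 0" by simp
  note N_indep[OF this]
  from this(1) this(3)[of 0] m_ge s show ?thesis by (auto simp: p_def)
qed

lemma rep_zero: "rep 0 0 0 0"
  by (simp add: rep_def cv.subspace_0[OF subspace_K])

lemma rep_exists:
  assumes "y \<in> coords (m + 3)"
  obtains s a r where "rep y s a r"
proof -
  obtain z where z: "z \<in> coords (m + 2)" "y = (y (m + 3) / x (m + 3)) \<odot> x + z"
    using coords_expand_x[OF assms] by blast
  obtain a b p where "z = a \<odot> u + b \<odot> w + G p 0" using coords_N_expand[OF z(1)] by blast
  then have "rep z 0 a (p 0)" using rep_N by simp
  then have "rep y (y (m + 3) / x (m + 3)) a (p 0)"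
    unfolding rep_def by (subst z(2)) (simp add: algebra_simps)
  then show ?thesis by (rule that)
qed

lemma rep_coords:
  assumes "rep y 0 a r"
  shows "y \<in> coords (m + 2)"
proof -
  have "y - (0 \<odot> x + a \<odot> u + r \<odot> g 0) \<in> coords (m + 2)"
    using assms K_coords unfolding rep_def by blast
  then have "(y - (0 \<odot> x + a \<odot> u + r \<odot> g 0)) + (a \<odot> u + r \<odot> g 0) \<in> coords (m + 2)"
    by (intro cv.subspace_add cv.subspace_scale subspace_coords u_coords g_coords)
  then show ?thesis by simp
qed

lemma rep_add: "rep y s a r \<Longrightarrow> rep y' s' a' r' \<Longrightarrow> rep (y + y') (s + s') (a + a') (r + r')"
proof -
  assume "rep y s a r" "rep y' s' a' r'"
  then have "(y - (s \<odot> x + a \<odot> u + r \<odot> g 0)) + (y' - (s' \<odot> x + a' \<odot> u + r' \<odot> g 0)) \<in> K"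
    unfolding rep_def by (rule cv.subspace_add[OF subspace_K])
  then show ?thesis by (simp add: rep_def algebra_simps)
qed

lemma K_bracket:
  assumes "y \<in> coords (m + 3)" "k \<in> K"
  shows "B y k \<in> K" "B k y \<in> K"
proof -
  obtain z where z: "z \<in> coords (m + 2)" "y = (y (m + 3) / x (m + 3)) \<odot> x + z"
    using coords_expand_x[OF assms(1)] by blast
  obtain a b p where zz: "z = a \<odot> u + b \<odot> w + G p 0" using coords_N_expand[OF z(1)] by blast
  obtain b' q where k: "k = b' \<odot> w + G q (Suc 0)" using assms(2) by (auto simp: K_def)
  have "B z k = - (a \<odot> G q (Suc (Suc 0)))" and "B k z = a \<odot> G q (Suc (Suc 0))"
    by (simp_all add: zz k bilin brackets)
  then have "B z k \<in> K" "B k z \<in> K"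
    using G_K cv.subspace_neg[OF subspace_K] cv.subspace_scale[OF subspace_K] by auto
  then have "B ((y (m + 3) / x (m + 3)) \<odot> x + z) k \<in> K" "B k ((y (m + 3) / x (m + 3)) \<odot> x + z) \<in> K"
    unfolding bilin using x_K[OF assms(2)] cv.subspace_add[OF subspace_K] cv.subspace_scale[OF subspace_K]
    by auto
  then show "B y k \<in> K" "B k y \<in> K" using z(2) by simp_all
qed

text \<open>\<open>K\<close> is an ideal, and modulo \<open>K\<close> the algebra is a Lie algebra
  on \<open>x\<close>, \<open>u\<close>, \<open>g 0\<close> in which \<open>u\<close> and
  \<open>g 0\<close> commute and \<open>x\<close> acts by a triangular matrix with diagonal
  \<open>al\<close>, \<open>ga\<close>.\<close>

lemma rep_bracket:
  assumes y: "rep y s a r" "y \<in> coords (m + 3)" and y': "rep y' s' a' r'" "y' \<in> coords (m + 3)"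
  shows "rep (B y y') 0 (al * (s * a' - s' * a) + de * (s * r' - s' * r)) (ga * (s * r' - s' * r))"
proof -
  define k k' where "k = y - (s \<odot> x + a \<odot> u + r \<odot> g 0)" and "k' = y' - (s' \<odot> x + a' \<odot> u + r' \<odot> g 0)"
  have kK: "k \<in> K" "k' \<in> K" using y y' by (simp_all add: rep_def k_def k'_def)
  let ?v' = "s' \<odot> x + a' \<odot> u + r' \<odot> g 0"
  have v': "?v' \<in> coords (m + 3)"
    using u_coords g_coords coords_mono x_coords
    by (auto intro!: cv.subspace_add cv.subspace_scale subspace_coords)
  have e: "B y k' \<in> K" "B k ?v' \<in> K" using K_bracket kK y(2) v' by auto
  have yy: "y = (s \<odot> x + a \<odot> u + r \<odot> g 0) + k" and yy': "y' = ?v' + k'" by (simp_all add: k_def k'_def)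
  have "B y y' = B y ?v' + B y k'" by (simp only: yy' bilin)
  also have "B y ?v' = B (s \<odot> x + a \<odot> u + r \<odot> g 0) ?v' + B k ?v'" by (subst yy) (rule add_left)
  \<comment> \<open>\<open>g (m - 1)\<close> is written as \<open>g (Suc (m - 2))\<close>, which
    \<open>g_K\<close> recognises as an element of \<open>K\<close>.\<close>
  finally have "B y y' - (0 \<odot> x + (al * (s * a' - s' * a) + de * (s * r' - s' * r)) \<odot> u + (ga * (s * r' - s' * r)) \<odot> g 0)
    = (s * s') \<odot> (ta \<odot> g (Suc (m - 2)) + ze \<odot> w) + (s * a') \<odot> (G d (Suc 0) + fu \<odot> w)
     + (s * r') \<odot> (G c (Suc 0) + fv \<odot> w) + (a * s') \<odot> (su \<odot> w - (G d (Suc 0) + fu \<odot> w))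
     + (r * s') \<odot> (sv \<odot> w - (G c (Suc 0) + fv \<odot> w)) + (r * a' - a * r') \<odot> g (Suc 0) + (r * r') \<odot> w
     + (B k ?v' + B y k')"
    using m_ge by (simp add: bilin brackets fun_eq_iff pointwise algebra_simps Suc_diff_Suc numeral_2_eq_2)
  also have "\<dots> \<in> K"
    by (intro cv.subspace_add[OF subspace_K] cv.subspace_diff[OF subspace_K] cv.subspace_scale[OF subspace_K]
        g_K G_K w_K e)
  finally show ?thesis unfolding rep_def .
qed

end

text \<open>Conditions under which the brackets satisfy the Leibniz identity and \<open>N\<close> is
  the nilradical. \<open>ta\<close> may be nonzero only if \<open>x\<close> annihilates
  \<open>g (m - 1)\<close>, because \<open>[[x, x], x] = 0\<close>; \<open>de\<close> only if
  \<open>g 2 = 0\<close>, because the derivation preserves \<open>[g 0, g 1] = 0\<close>;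
  \<open>not_nil\<close> gives \<open>x\<close> a nonzero eigenvalue.\<close>

locale L4_model = L4_ext_brackets +
  assumes su_zero: "su = 0"
    and center: "ga = 0 \<or> fu = 0 \<and> fv = 0 \<and> sv = 0"
    and ta: "ta = 0 \<or> ga + of_nat (m - 1) * al = 0"
    and de: "de = 0 \<or> m = 2"
    and not_nil: "al \<noteq> 0 \<or> ga \<noteq> 0"
begin

lemma de_g: "de \<odot> g (Suc (Suc i)) = 0"
  using de g_zero[of "Suc (Suc i)"] by auto

lemma last_brackets:
  "B (g (m - 1)) u = 0" "B u (g (m - 1)) = 0" "B (g (m - 1)) w = 0" "B w (g (m - 1)) = 0"
  "B (g (m - 1)) (g j) = 0" "B (g j) (g (m - 1)) = 0"
  "ta \<odot> B (g (m - 1)) x = 0" "ta \<odot> B x (g (m - 1)) = 0"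
proof -
  have m1: "m - 1 = Suc (m - 2)" using m_ge by simp
  have x: "B x (g (m - 1)) = (ga + of_nat (m - 1) * al) \<odot> g (m - 1)"
    unfolding m1 using xg[of "m - 2"] G_ge[of "Suc (Suc (m - 2))"] by simp
  show "B (g (m - 1)) u = 0" "B u (g (m - 1)) = 0"
    using g_zero[of m] by (simp_all add: m1 gu ug) (use m_ge g_zero in simp_all)
  show "B (g (m - 1)) w = 0" "B w (g (m - 1)) = 0" "B (g (m - 1)) (g j) = 0" "B (g j) (g (m - 1)) = 0"
    using m_ge by (simp_all add: gw wg gg)
  show "ta \<odot> B x (g (m - 1)) = 0" unfolding x using ta by (metis cv.scale_zero_left cv.scale_zero_right)
  then show "ta \<odot> B (g (m - 1)) x = 0" using gx[of "m - 2"] m1 by simp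
qed

lemma leibniz_basis:
  assumes "p \<in> basis" "q \<in> basis" "r \<in> basis"
  shows "B (B p q) r = B p (B q r) - B q (B p r)"
proof -
  have de_or: "de = 0 \<or> g (Suc (Suc i)) = 0" for i
    using de_g[of i] by simp
  have last: "g (Suc (m - Suc 0)) = 0" "m \<noteq> 0" "m \<noteq> Suc 0" "\<not> m \<le> Suc 0"
    using m_ge by (auto intro: g_zero)
  \<comment> \<open>Applied to all three variables, this splits the identity into 125 explicit
    ones.\<close>
  have basis_all: "(\<forall>a\<in>basis. P a) \<longleftrightarrow> P u \<and> P w \<and> P x \<and> P (g 0) \<and> (\<forall>i. P (g (Suc i)))" for P
    unfolding basis_def by (auto, metis not0_implies_Suc)
  have "\<forall>p\<in>basis. \<forall>q\<in>basis. \<forall>r\<in>basis. B (B p q) r = B p (B q r) - B q (B p r)"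
    using center
  proof
    assume z: "ga = 0"
    show ?thesis
      unfolding basis_all
      by (intro conjI allI;
          simp add: brackets bilin last_brackets[unfolded One_nat_def] su_zero z last de_or;
          simp add: fun_eq_iff pointwise algebra_simps)
  next
    assume z: "fu = 0 \<and> fv = 0 \<and> sv = 0"
    show ?thesis
      unfolding basis_all
      by (intro conjI allI;
          simp add: brackets bilin last_brackets[unfolded One_nat_def] su_zero z last de_or;
          simp add: fun_eq_iff pointwise algebra_simps)
  qed
  then show ?thesis using assms by blast
qed

lemma leibniz:
  assumes "p \<in> coords (m + 3)" "q \<in> coords (m + 3)" "r \<in> coords (m + 3)"
  shows "B (B p q) r = B p (B q r) - B q (B p r)"
proof -
  have *: "B (B p q) r = B p (B q r) - B q (B p r)" if "r \<in> basis" "q \<in> basis" for q r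
    using assms(1)[folded span_basis]
  proof (rule cv.span_induct)
    show "cv.subspace {p. B (B p q) r = B p (B q r) - B q (B p r)}"
      unfolding cv.subspace_def by (auto simp: bilin cv.scale_right_diff_distrib add_diff_add)
  qed (use that leibniz_basis in blast)
  show ?thesis
    by (rule bilinear_eq_on_span[of "\<lambda>q r. B (B p q) r" "\<lambda>q r. B p (B q r) - B q (B p r)" basis])
      (use * assms in \<open>auto simp: span_basis bilinear_bracket_def bilin algebra_simps\<close>)
qed

end

section \<open>Nilradical, solvability and indecomposability\<close>

locale L4_model_algebra = L4_model + L4_frame_algebra
begin

lemma bracket_N: "y \<in> coords (m + 3) \<Longrightarrow> z \<in> coords (m + 3) \<Longrightarrow> B y z \<in> coords (m + 2)"
  by (meson rep_bracket rep_coords rep_exists)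

lemma bracket_carr: "y \<in> coords (m + 3) \<Longrightarrow> z \<in> coords (m + 3) \<Longrightarrow> B y z \<in> coords (m + 3)"
  using bracket_N coords_mono by blast

lemma left_leibniz_A: "left_leibniz A"
proof -
  have "cv.span (\<e> ` {1..m + 3}) = coords (m + 3)" by (rule span_bvec)
  then have "\<exists>S. finite S \<and> cv.span S = coords (m + 3)" by blast
  then show ?thesis
    unfolding left_leibniz_def fd_algebra_def carr_A scal_A brk_A
    using bracket_carr leibniz
    by (auto simp: bilin subspace_coords cv.vector_space_axioms)
qed

lemma rep_N_iff:
  assumes "rep y s a r" "y \<in> coords (m + 3)"
  shows "y \<in> coords (m + 2) \<longleftrightarrow> s = 0"
proof
  assume "y \<in> coords (m + 2)"
  then obtain a b p where "y = a \<odot> u + b \<odot> w + G p 0" by (rule coords_N_expand)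
  then have "rep y 0 a (p 0)" using rep_N by simp
  then show "s = 0" using rep_unique assms by blast
next
  assume "s = 0"
  then show "y \<in> coords (m + 2)" using assms rep_coords by simp
qed

text \<open>\<open>w\<close> occurs in the first bracket only, which is why the first term is
  bounded by \<open>K\<close> and the later ones by \<open>H\<close>.\<close>

lemma lower_central_N:
  "lower_central_series (subalg A N) (Suc j) \<subseteq> (if j = 0 then K else H (Suc j))"
proof (induction j)
  case 0
  have "bracket_span A N N \<subseteq> K"
    by (rule bracket_span_subset[OF subspace_K]) (rule bracket_NN)
  then show ?case by (simp add: subalg_def bracket_span_def)
next
  case (Suc j)
  have "bracket_span A N (lower_central_series (subalg A N) (Suc j)) \<subseteq> H (Suc (Suc j))"
    by (rule bracket_span_subset[OF subspace_H]) (use Suc bracket_NH[of _ _ "Suc j"] in \<open>auto split: if_splits\<close>)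
  then show ?case by (simp add: subalg_def bracket_span_def)
qed

lemma nilpotent_N: "nilpotent_ideal A N"
proof -
  have "alg_ideal A N"
    unfolding alg_ideal_def carr_A scal_A brk_A
    using coords_mono bracket_N by (auto simp: subspace_coords)
  moreover have "lower_central_series (subalg A N) (Suc (m - 1)) = {0}"
  proof
    have "lower_central_series (subalg A N) (Suc (m - 1)) \<subseteq> H (Suc (m - 1))"
      using lower_central_N[of "m - 1"] m_ge by (auto split: if_splits)
    also have "H (Suc (m - 1)) \<subseteq> {0}" using m_ge by (auto simp: H_def G_ge)
    finally show "lower_central_series (subalg A N) (Suc (m - 1)) \<subseteq> {0}" .
    show "{0} \<subseteq> lower_central_series (subalg A N) (Suc (m - 1))"
      using zero_bracket_span by (simp add: bracket_span_def subalg_def)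
  qed
  ultimately show ?thesis unfolding nilpotent_ideal_def nilpotent_alg_def by blast
qed

text \<open>The derived series descends through \<open>N\<close> and \<open>K\<close>, and
  \<open>K\<close> has zero multiplication.\<close>

lemma solvable_A: "solvable_alg A"
  unfolding solvable_alg_def
proof (intro exI[of _ 3] equalityI)
  have "derived_series A 1 \<subseteq> N"
    using bracket_span_subset[OF subspace_coords[of "m + 2"] bracket_N] by (simp add: carr_A)
  then have "derived_series A 2 \<subseteq> K"
    using bracket_span_subset[OF subspace_K, of "derived_series A 1" "derived_series A 1"] bracket_NN
    by (auto simp: numeral_2_eq_2)
  then have "bracket_span A (derived_series A 2) (derived_series A 2) \<subseteq> {0}"
    by (intro bracket_span_subset) (auto intro: bracket_KK)
  then show "derived_series A 3 \<subseteq> {0}" by (simp add: numeral_3_eq_3 numeral_2_eq_2)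
  show "{0} \<subseteq> derived_series A 3" using zero_bracket_span by (simp add: numeral_3_eq_3)
qed

lemma idealD:
  assumes "alg_ideal A I"
  shows "cv.subspace I" "I \<subseteq> coords (m + 3)"
    "y \<in> coords (m + 3) \<Longrightarrow> z \<in> I \<Longrightarrow> B y z \<in> I" "y \<in> coords (m + 3) \<Longrightarrow> z \<in> I \<Longrightarrow> B z y \<in> I"
  using assms unfolding alg_ideal_def carr_A scal_A brk_A by auto

lemma u_carr: "u \<in> coords (m + 3)" and g_carr: "g i \<in> coords (m + 3)"
  using u_coords g_coords coords_mono by auto

lemma rep_u: "rep u 0 1 0" and rep_g0: "rep (g 0) 0 0 1"
  by (simp_all add: rep_def cv.subspace_0[OF subspace_K])

text \<open>If \<open>z \<in> I\<close> has a component along \<open>x\<close>, then left multiplication by \<open>z\<close> has a nonzero eigenvalue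
  on \<open>N\<close> modulo \<open>K\<close>, so the lower central series of \<open>I\<close> never vanishes.\<close>

lemma nilpotent_ideal_subset:
  assumes "nilpotent_ideal A I"
  shows "I \<subseteq> N"
proof
  fix z assume z: "z \<in> I"
  have I: "alg_ideal A I" using assms by (simp add: nilpotent_ideal_def)
  note ID = idealD[OF I]
  have zc: "z \<in> coords (m + 3)" using z ID(2) by blast
  obtain s a r where rep: "rep z s a r" using zc by (rule rep_exists)
  have "s = 0"
  proof (rule ccontr)
    assume s: "s \<noteq> 0"
    \<comment> \<open>For nonzero \<open>ga\<close> the coordinate along \<open>g 0\<close> is
      multiplied by \<open>ga * s\<close> in each step; for \<open>ga = 0\<close> the line of
      \<open>u\<close> is preserved modulo \<open>K\<close> and its coordinate is multiplied by
      \<open>al * s\<close>.\<close>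
    define P where "P y \<longleftrightarrow> y \<in> coords (m + 3) \<and>
      (\<exists>a r. rep y 0 a r \<and> (if ga = 0 then r = 0 \<and> a \<noteq> 0 else r \<noteq> 0))" for y
    have step: "P (B z y)" if "P y" for y
    proof -
      from that obtain a' r' where y: "rep y 0 a' r'" "y \<in> coords (m + 3)"
        "if ga = 0 then r' = 0 \<and> a' \<noteq> 0 else r' \<noteq> 0"
        unfolding P_def by blast
      have "rep (B z y) 0 (al * (s * a') + de * (s * r')) (ga * (s * r'))"
        using rep_bracket[OF rep zc y(1,2)] by simp
      moreover have "al \<noteq> 0" if "ga = 0" using that not_nil by auto
      ultimately show ?thesis
        unfolding P_def using y(3) s bracket_carr[OF zc y(2)]
        by (cases "ga = 0") (force intro!: exI)+
    qed
    define start where "start = (if ga = 0 then u else g 0)"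
    have "P start"
      unfolding P_def start_def using u_carr g_carr rep_u rep_g0 by (auto intro!: exI)
    have "\<exists>y \<in> lower_central_series (subalg A I) k. P y" for k
    proof (induction k)
      case 0
      \<comment> \<open>\<open>start\<close> need not lie in \<open>I\<close>, so the series is
        entered with \<open>[z, start]\<close>.\<close>
      have "B z start \<in> I" using ID(4)[OF _ z, of start] u_carr g_carr by (simp add: start_def)
      then show ?case using step[OF \<open>P start\<close>] by (auto simp: subalg_def)
    next
      case (Suc k)
      then obtain y where y: "y \<in> lower_central_series (subalg A I) k" "P y" by blast
      have "B z y \<in> lower_central_series (subalg A I) (Suc k)"
        using z y(1) by (auto simp: subalg_def bracket_span_def scal_A brk_A intro!: cv.span_base)
      then show ?case using step[OF y(2)] by blast
    qed
    moreover obtain k where "lower_central_series (subalg A I) k = {0}"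
      using assms unfolding nilpotent_ideal_def nilpotent_alg_def by blast
    ultimately have "P 0" by (metis singletonD)
    then show False unfolding P_def using rep_unique[OF rep_zero] by (auto split: if_splits)
  qed
  then show "z \<in> N" using rep rep_coords by simp
qed

lemma is_nilradical_N: "is_nilradical A N"
proof -
  have "maximal_nilpotent_ideal A N"
    unfolding maximal_nilpotent_ideal_def using nilpotent_N nilpotent_ideal_subset by blast
  moreover have "M = N" if "maximal_nilpotent_ideal A M" for M
    using that nilpotent_N nilpotent_ideal_subset unfolding maximal_nilpotent_ideal_def by blast
  ultimately show ?thesis unfolding is_nilradical_def by blast
qed

lemma right_u_closed:
  assumes "alg_ideal A I" "y \<in> I"
  shows "(right_u ^^ j) y \<in> I"
proof (induction j)
  case (Suc j)
  then show ?case using idealD(4)[OF assms(1) u_carr] by (simp add: right_u_def)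
qed (use assms in simp)

text \<open>The sum \<open>[g 0, y] + [y, g 0]\<close> is a multiple of \<open>w\<close>, since the
  \<open>g 1\<close> parts cancel; iterated right multiplication by \<open>u\<close> leaves only the
  coefficient \<open>p 0\<close>, at \<open>g (m - 1)\<close>. If \<open>p 0 = 0\<close>, then
  \<open>[g 0, y]\<close> is a multiple of \<open>g 1\<close>, from which \<open>u\<close> produces
  all later \<open>g i\<close>.\<close>

lemma ideal_N_element:
  assumes I: "alg_ideal A I" and y: "y \<in> I" "y = a \<odot> u + b \<odot> w + G p 0"
  shows "p 0 \<noteq> 0 \<Longrightarrow> w \<in> I" and "p 0 \<noteq> 0 \<Longrightarrow> g (m - 1) \<in> I"
    and "p 0 = 0 \<Longrightarrow> a \<noteq> 0 \<Longrightarrow> g (Suc i) \<in> I"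
proof -
  note ID = idealD[OF I]
  have cancel: "v \<in> I" if "r \<odot> v \<in> I" "r \<noteq> 0" for r v
    using cv.subspace_scale[OF ID(1) that(1), of "inverse r"] that(2) by simp
  have G0: "G p 0 = p 0 \<odot> g 0 + G (\<lambda>k. p (Suc k)) (Suc 0)" by (rule G_split)
  have left: "B (g 0) y = a \<odot> g 1 + p 0 \<odot> w"
    unfolding y(2) G0 by (simp add: bilin brackets)
  have right: "B y (g 0) = - (a \<odot> g 1) + p 0 \<odot> w"
    unfolding y(2) G0 by (simp add: bilin brackets)
  have "B (g 0) y + B y (g 0) = (2 * p 0) \<odot> w"
    unfolding left right by (simp add: fun_eq_iff pointwise algebra_simps)
  moreover have "B (g 0) y + B y (g 0) \<in> I"
    using cv.subspace_add[OF ID(1)] ID(3)[OF g_carr y(1)] ID(4)[OF g_carr y(1)] by blast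
  ultimately have "(2 * p 0) \<odot> w \<in> I" by simp
  then show "p 0 \<noteq> 0 \<Longrightarrow> w \<in> I" using cancel[of "2 * p 0" w] by simp
  have "right_u y = G p 1"
    unfolding y(2) right_u_def by (simp add: bilin brackets)
  moreover have "(right_u ^^ (m - 2)) (G p 1) = G p (m - 1)"
    using m_ge by (simp add: right_u_iter Suc_diff_Suc numeral_2_eq_2)
  ultimately have "(right_u ^^ (m - 2)) (right_u y) = p 0 \<odot> g (m - 1)"
    by (metis G_last)
  moreover have "right_u y \<in> I" using ID(4)[OF u_carr y(1)] by (simp add: right_u_def)
  ultimately have "p 0 \<odot> g (m - 1) \<in> I"
    using right_u_closed[OF I, of "right_u y" "m - 2"] by metis
  then show "p 0 \<noteq> 0 \<Longrightarrow> g (m - 1) \<in> I" using cancel by blast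
  show "g (Suc i) \<in> I" if "p 0 = 0" "a \<noteq> 0"
  proof (induction i)
    case 0
    have "a \<odot> g 1 \<in> I" using left that ID(3)[OF g_carr y(1), of 0] by simp
    then show "g (Suc 0) \<in> I" using cancel that by simp
  next
    case (Suc i)
    then show "g (Suc (Suc i)) \<in> I" using ID(4)[OF u_carr Suc] by (simp add: gu)
  qed
qed

text \<open>Right multiplication by \<open>u\<close> pushes the lowest nonzero coefficient to
  \<open>g (m - 1)\<close>; elements with nothing to push already lie in the centre of the
  nilradical or are covered by \<open>ideal_N_element\<close>.\<close>

lemma ideal_meets_center:
  assumes I: "alg_ideal A I" and y: "y \<in> I" "y \<in> N" "y \<noteq> 0"
  obtains z b b' where "z \<in> I" "z = b \<odot> w + b' \<odot> g (m - 1)" "z \<noteq> 0"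
proof -
  obtain a b p where yy: "y = a \<odot> u + b \<odot> w + G p 0" using y(2) by (rule coords_N_expand)
  note el = ideal_N_element[OF I y(1) yy]
  have glast: "g (m - 1) \<in> I \<Longrightarrow> thesis"
    using that[of "g (m - 1)" 0 1] g_last_nonzero by simp
  consider "p 0 \<noteq> 0" | "p 0 = 0" "a \<noteq> 0" | "p 0 = 0" "a = 0" "\<exists>k<m. p k \<noteq> 0"
    | "a = 0" "\<forall>k<m. p k = 0"
    by blast
  then show ?thesis
  proof cases
    case 1
    then show ?thesis using el glast by blast
  next
    case 2
    then have "g (Suc (m - 2)) \<in> I" using el by blast
    then show ?thesis using glast m_ge by (simp add: Suc_diff_Suc numeral_2_eq_2)
  next
    case 3
    define k where "k = (LEAST k. p k \<noteq> 0)"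
    have k: "p k \<noteq> 0" "k < m" "\<And>i. i < k \<Longrightarrow> p i = 0"
      using 3(3) LeastI_ex[of "\<lambda>k. p k \<noteq> 0"] Least_le[of "\<lambda>k. p k \<noteq> 0"] not_less_Least[of _ "\<lambda>k. p k \<noteq> 0"]
      unfolding k_def by (blast, meson le_less_trans, blast)
    show ?thesis
    proof (cases "k = m - 1")
      case True
      then have "G p 0 = p k \<odot> g (m - 1)" using G_lead[OF k(2,3)] by simp
      then show ?thesis using that[OF y(1), of b "p k"] yy 3(2) y(3) by simp
    next
      case False
      then obtain j where j: "m - 1 - k = Suc j" using k(2) by (metis Suc_diff_Suc Suc_lessE diff_Suc_1 linorder_neqE_nat not_less_eq)
      have "right_u y = G p 1"
        unfolding yy right_u_def by (simp add: bilin brackets)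
      then have "(right_u ^^ Suc j) y = G p (m - 1 - k)"
        unfolding j funpow_Suc_right by (simp add: right_u_iter)
      also have "\<dots> = p k \<odot> g (m - 1)" by (rule G_lead[OF k(2,3)])
      finally have "p k \<odot> g (m - 1) \<in> I" using right_u_closed[OF I y(1)] by metis
      then show ?thesis using that[of "p k \<odot> g (m - 1)" 0 "p k"] g_last_nonzero k(1) by simp
    qed
  next
    case 4
    then have "G p 0 = 0" by (simp add: gsum_def)
    then show ?thesis using that[OF y(1), of b 0] yy 4 y(3) by simp
  qed
qed

text \<open>The component of \<open>z\<close> along \<open>x\<close> makes \<open>[z, g 0]\<close>
  (if \<open>ga\<close> is nonzero) or \<open>[z, u]\<close> (otherwise) an element of
  \<open>I\<close> with a nonzero component along \<open>g 0\<close> or \<open>u\<close>,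
  respectively. In the second case the membership of \<open>w\<close> stays open and is settled in
  \<open>no_decomposition\<close>.\<close>

lemma ideal_outside_N:
  assumes I: "alg_ideal A I" and z: "z \<in> I" "z \<notin> N"
  shows "g (m - 1) \<in> I"
    and "w \<in> I \<or> (\<exists>y\<in>I. \<exists>a. a \<noteq> 0 \<and> rep y 0 a 0)"
proof -
  note ID = idealD[OF I]
  have zc: "z \<in> coords (m + 3)" using z ID by blast
  obtain s a r where rep: "rep z s a r" using zc by (rule rep_exists)
  then have s: "s \<noteq> 0" using rep_N_iff[OF rep zc] z(2) by simp
  have "g (m - 1) \<in> I \<and> (w \<in> I \<or> (\<exists>y\<in>I. \<exists>a. a \<noteq> 0 \<and> rep y 0 a 0))"
  proof (cases "ga = 0")
    case False
    let ?y = "B z (g 0)"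
    have yI: "?y \<in> I" using ID(4)[OF g_carr z(1)] .
    have "?y \<in> N" using bracket_N[OF zc g_carr] .
    then obtain a' b p where y: "?y = a' \<odot> u + b \<odot> w + G p 0" by (rule coords_N_expand)
    have "rep ?y 0 a' (p 0)" unfolding y by (rule rep_N)
    moreover have "rep ?y 0 (de * s - al * (0 * s)) (ga * s)"
      using rep_bracket[OF rep zc rep_g0 g_carr] by simp
    ultimately have "p 0 = ga * s" using rep_unique by blast
    then show ?thesis using ideal_N_element(1,2)[OF I yI y] False s by auto
  next
    case True
    let ?y = "B z u"
    have yI: "?y \<in> I" using ID(4)[OF u_carr z(1)] .
    have "?y \<in> N" using bracket_N[OF zc u_carr] .
    then obtain a' b p where y: "?y = a' \<odot> u + b \<odot> w + G p 0" by (rule coords_N_expand)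
    have "rep ?y 0 a' (p 0)" unfolding y by (rule rep_N)
    moreover have rep': "rep ?y 0 (al * s) 0"
      using rep_bracket[OF rep zc rep_u u_carr] by simp
    ultimately have "p 0 = 0" "a' = al * s" using rep_unique by blast+
    moreover have al: "al * s \<noteq> 0" using True not_nil s by simp
    ultimately have "g (Suc (m - 2)) \<in> I" using ideal_N_element(3)[OF I yI y, of "m - 2"] by simp
    moreover have "Suc (m - 2) = m - 1" using m_ge by simp
    ultimately show ?thesis using rep' yI al by metis
  qed
  then show "g (m - 1) \<in> I" "w \<in> I \<or> (\<exists>y\<in>I. \<exists>a. a \<noteq> 0 \<and> rep y 0 a 0)" by auto
qed

text \<open>The two ideals cannot both contain \<open>g (m - 1)\<close>, so \<open>J\<close> lies in
  the nilradical and meets its centre nontrivially. But that centre, spanned by \<open>w\<close> and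
  \<open>g (m - 1)\<close>, lies in \<open>I\<close>.\<close>

lemma no_decomposition:
  assumes I: "alg_ideal A I" and J: "alg_ideal A J" and J0: "J \<noteq> {0}"
    and IJ: "I \<inter> J = {0}" and sum: "{y + z | y z. y \<in> I \<and> z \<in> J} = coords (m + 3)"
    and z: "z \<in> I" "z \<notin> N"
  shows False
proof -
  note ID = idealD[OF I] and JD = idealD[OF J]
  have gI: "g (m - 1) \<in> I" using ideal_outside_N[OF I z] by blast
  have JN: "J \<subseteq> N"
  proof
    fix y assume "y \<in> J"
    then show "y \<in> N" using ideal_outside_N(1)[OF J, of y] gI IJ g_last_nonzero by blast
  qed
  have wI: "w \<in> I"
    using ideal_outside_N(2)[OF I z]
  proof
    assume "\<exists>y\<in>I. \<exists>a. a \<noteq> 0 \<and> rep y 0 a 0"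
    then obtain y a where y: "y \<in> I" "a \<noteq> 0" "rep y 0 a 0" by blast
    \<comment> \<open>Of the summands of \<open>g 0\<close>, the one in \<open>J\<close> has no
      component along \<open>g 0\<close>, as \<open>g (m - 1)\<close> would lie in \<open>J\<close>
      otherwise. Hence the one in \<open>I\<close> has such a component, and \<open>w\<close>
      follows.\<close>
    obtain i j where ij: "i \<in> I" "j \<in> J" "g 0 = i + j" using sum g_carr[of 0] by blast
    have jN: "j \<in> N" and iN: "i \<in> N"
    proof -
      show "j \<in> N" using ij JN by blast
      then show "i \<in> N" using ij(3) g_coords[of 0] cv.subspace_diff[OF subspace_coords, of "g 0" _ j] by simp
    qed
    obtain a1 b1 p1 where i: "i = a1 \<odot> u + b1 \<odot> w + G p1 0" using iN by (rule coords_N_expand)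
    obtain a2 b2 p2 where j: "j = a2 \<odot> u + b2 \<odot> w + G p2 0" using jN by (rule coords_N_expand)
    have yN: "y \<in> N" using y(3) by (rule rep_coords)
    obtain a3 b3 p3 where y3: "y = a3 \<odot> u + b3 \<odot> w + G p3 0" using yN by (rule coords_N_expand)
    then have a3: "a3 = a" "p3 0 = 0" using rep_N rep_unique y(3) by metis+
    have "p2 0 = 0"
    proof (rule ccontr)
      assume p2: "p2 0 \<noteq> 0"
      then have "g (m - 1) \<in> J" using ideal_N_element(2)[OF J ij(2) j] by blast
      then show False using gI IJ g_last_nonzero by blast
    qed
    moreover have "rep (g 0) 0 (a1 + a2) (p1 0 + p2 0)"
      using rep_add[OF rep_N[of a1 b1 p1] rep_N[of a2 b2 p2]] ij(3) i j by simp
    then have "p1 0 + p2 0 = 1" using rep_unique rep_g0 by blast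
    ultimately show "w \<in> I" using ideal_N_element(1)[OF I ij(1) i] by simp
  qed
  have "0 \<in> J" using JD(1) by (rule cv.subspace_0)
  with J0 obtain y where y: "y \<in> J" "y \<noteq> 0" by blast
  then have "y \<in> N" using JN by blast
  then obtain v b b' where v: "v \<in> J" "v = b \<odot> w + b' \<odot> g (m - 1)" "v \<noteq> 0"
    using ideal_meets_center[OF J y(1) _ y(2)] by blast
  have "v \<in> I" unfolding v(2) using wI gI ID(1) by (intro cv.subspace_add cv.subspace_scale)
  then show False using v IJ by blast
qed

lemma indecomposable_A: "indecomposable_alg A"
  unfolding indecomposable_alg_def
proof (rule notI, elim exE conjE)
  fix I J
  assume I: "alg_ideal A I" and J: "alg_ideal A J" and I0: "I \<noteq> {0}" and J0: "J \<noteq> {0}"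
    and IJ: "I \<inter> J = {0}" and sum: "{y + z | y z. y \<in> I \<and> z \<in> J} = carr A"
  have sum': "{z + y | z y. z \<in> J \<and> y \<in> I} = carr A"
    unfolding sum[symmetric] by (rule Collect_cong) (metis add.commute)
  obtain i j where ij: "i \<in> I" "j \<in> J" "x = i + j" using sum x_coords carr_A by blast
  have "x \<notin> N" using x_outside unfolding coords_def by (auto intro!: exI[of _ "m + 3"])
  then have "i \<notin> N \<or> j \<notin> N"
    using ij(3) cv.subspace_add[OF subspace_coords] by auto
  then show False
    using no_decomposition[OF I J J0 IJ sum[unfolded carr_A] ij(1)]
      no_decomposition[OF J I I0 _ sum'[unfolded carr_A] ij(2)] IJ
    by (metis Int_commute)
qed

lemma dim_A: "alg_dim A = m + 3"
  by (simp add: alg_dim_def scal_A carr_A dim_coords)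

end

section \<open>The listed algebras\<close>

lemma bilinear_table: "bilinear_bracket (brk (table_alg d T))"
  by unfold_locales
    (simp_all add: table_alg_def pointwise distrib_right distrib_left cv.scale_left_distrib sum.distrib
      cv.scale_sum_right mult.assoc mult.left_commute)

lemma table_bvec:
  assumes "i \<in> {1..d}" "j \<in> {1..d}"
  shows "brk (table_alg d T) (\<e> i) (\<e> j) = T i j"
proof -
  have 1: "\<e> i i' * \<e> j j' = (if i' = i then if j' = j then 1 else 0 else 0)" for i' j'
    by (simp add: bvec_def)
  have "brk (table_alg d T) (\<e> i) (\<e> j) = (\<Sum>i'=1..d. if i' = i then (\<Sum>j'=1..d. if j' = j then T i j else 0) else 0)"
    unfolding table_alg_def calg.simps 1
    by (intro sum.cong refl) (auto simp: if_distrib[of "\<lambda>r. r \<odot> _"] cong: if_cong)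
  also have "\<dots> = T i j" using assms by simp
  finally show ?thesis .
qed

text \<open>The square of this vector is zero, and
  \<open>[\<e> 3, \<e> 1 - \<e> 3] = \<e> 4 - \<e> 2\<close>, which therefore becomes
  \<open>g 1\<close> of the frame.\<close>

definition eu :: cvec where "eu = \<e> 1 - \<e> 3"

definition eg :: "nat \<Rightarrow> nat \<Rightarrow> cvec" where
  "eg n i = (if i = 0 then \<e> 3 else if i = 1 then \<e> 4 - \<e> 2 else if i + 3 \<le> n then \<e> (i + 3) else 0)"

lemma L4_ext_table:
  "L4_ext n r l s = table_alg (n + 1) (\<lambda>i j. if i \<le> n \<and> j \<le> n then L4_table n i j
     else if i \<le> n then r i else if j \<le> n then l j else s)"
  by (simp add: L4_ext_def)

lemma L4_ext_bvec:
  shows "i \<in> {1..n} \<Longrightarrow> j \<in> {1..n} \<Longrightarrow> brk (L4_ext n r l s) (\<e> i) (\<e> j) = L4_table n i j"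
    and "i \<in> {1..n} \<Longrightarrow> brk (L4_ext n r l s) (\<e> i) (\<e> (n + 1)) = r i"
    and "i \<in> {1..n} \<Longrightarrow> brk (L4_ext n r l s) (\<e> (n + 1)) (\<e> i) = l i"
    and "brk (L4_ext n r l s) (\<e> (n + 1)) (\<e> (n + 1)) = s"
  by (simp_all add: L4_ext_table table_bvec)

lemma L4_frame_L4_ext:
  assumes n: "n = m + 2" "2 \<le> m"
  shows "L4_frame (brk (L4_ext n r l s)) m eu (\<e> 2) (eg n)"
proof -
  let ?B = "brk (L4_ext n r l s)"
  interpret bilinear_bracket ?B unfolding L4_ext_table by (rule bilinear_table)
  note T = L4_ext_bvec(1)
  have n4: "4 \<le> n" "3 \<le> n - Suc 0" using n by auto
  show ?thesis
  proof
    show "2 \<le> m" by fact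
    show "eg n i = 0" if "m \<le> i" for i using that n by (simp add: eg_def)
    show "?B eu eu = 0" "?B eu (\<e> 2) = 0" "?B (\<e> 2) eu = 0" "?B (\<e> 2) (\<e> 2) = 0"
      using n4 by (simp_all add: eu_def bilin T L4_table_def fun_eq_iff pointwise)
    show "?B (eg n i) eu = eg n (Suc i)" "?B eu (eg n i) = - eg n (Suc i)" for i
      using n4 by (auto simp: eu_def eg_def bilin T L4_table_def fun_eq_iff pointwise algebra_simps eval_nat_numeral)
    show "?B (eg n i) (eg n j) = (if i = 0 \<and> j = 0 then \<e> 2 else 0)" for i j
      using n4 by (auto simp: eu_def eg_def bilin T L4_table_def)
    show "?B (eg n i) (\<e> 2) = 0" "?B (\<e> 2) (eg n i) = 0" for i
      using n4 by (auto simp: eu_def eg_def bilin T L4_table_def)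
    fix a b assume ab: "a \<odot> \<e> 2 + b \<odot> eg n (m - 1) = 0"
    have "(a \<odot> \<e> 2 + b \<odot> eg n (m - 1)) (m + 2) = b"
      using n by (auto simp: eg_def bvec_def pointwise)
    with ab have b: "b = 0" by (simp add: zero_fun_apply)
    then have "(a \<odot> \<e> 2 + b \<odot> eg n (m - 1)) 2 = a"
      by (simp add: bvec_def pointwise)
    with ab b show "a = 0 \<and> b = 0" by (metis zero_fun_apply)
  qed
qed

lemma eg_coords: "n = m + 2 \<Longrightarrow> 2 \<le> m \<Longrightarrow> eg n i \<in> coords (m + 2)"
  by (auto simp: eg_def coords_def bvec_def pointwise)

text \<open>From \<open>i = 5\<close> on, \<open>\<e> i\<close> is \<open>g (i - 3)\<close>, so its
  \<open>c\<close>-terms start at \<open>g (i - 2)\<close>; the condition on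
  \<open>l 4 - l 2\<close> is the one for \<open>g 1\<close>.\<close>

lemma L4_ext_bracketsI:
  assumes n: "n = m + 2" "2 \<le> m"
    and xu: "l 1 - l 3 = al \<odot> (\<e> 1 - \<e> 3) + gsum m (eg n) d 1 + fu \<odot> \<e> 2"
    and xg0: "l 3 = ga \<odot> \<e> 3 + de \<odot> (\<e> 1 - \<e> 3) + gsum m (eg n) c 1 + fv \<odot> \<e> 2"
    and ux: "r 1 - r 3 = su \<odot> \<e> 2 - (l 1 - l 3)"
    and g0x: "r 3 = sv \<odot> \<e> 2 - l 3"
    and xx: "s = ta \<odot> eg n (m - 1) + ze \<odot> \<e> 2"
    and xw: "l 2 = (2 * ga) \<odot> \<e> 2" and wx: "r 2 = 0"
    and xg1: "l 4 - l 2 = (ga + al) \<odot> (\<e> 4 - \<e> 2) + gsum m (eg n) c 2"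
    and xg: "\<And>i. 5 \<le> i \<Longrightarrow> i \<le> n \<Longrightarrow> l i = (ga + (of_nat i - 3) * al) \<odot> \<e> i + gsum m (eg n) c (i - 2)"
    and gx1: "r 4 = l 2 - l 4" and gx: "\<And>i. 5 \<le> i \<Longrightarrow> i \<le> n \<Longrightarrow> r i = - l i"
  shows "L4_ext_brackets (brk (L4_ext n r l s)) m eu (\<e> 2) (eg n) (\<e> (n + 1)) al ga de c d fu fv su sv ta ze"
proof -
  let ?B = "brk (L4_ext n r l s)"
  interpret L4_frame ?B m eu "\<e> 2" "eg n" using L4_frame_L4_ext[OF n] .
  note T = L4_ext_bvec L4_ext_bvec[unfolded Suc_eq_plus1[symmetric]]
  have n4: "4 \<le> n" using n by simp
  show ?thesis
  proof
    show "eu \<in> coords (m + 2)" "\<e> 2 \<in> coords (m + 2)" "\<e> (n + 1) \<in> coords (m + 3)" "\<e> (n + 1) (m + 3) \<noteq> 0"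
      using n by (auto simp: coords_def eu_def bvec_def pointwise)
    show "eg n i \<in> coords (m + 2)" for i using eg_coords[OF n] .
    show "?B (\<e> (n + 1)) eu = al \<odot> eu + G d 1 + fu \<odot> \<e> 2"
      using n4 xu by (simp add: eu_def bilin T)
    show "?B (\<e> (n + 1)) (eg n 0) = ga \<odot> eg n 0 + de \<odot> eu + G c 1 + fv \<odot> \<e> 2"
      using n4 xg0 by (simp add: eu_def eg_def bilin T)
    show "?B eu (\<e> (n + 1)) = su \<odot> \<e> 2 - ?B (\<e> (n + 1)) eu"
      using n4 ux by (simp add: eu_def bilin T)
    show "?B (eg n 0) (\<e> (n + 1)) = sv \<odot> \<e> 2 - ?B (\<e> (n + 1)) (eg n 0)"
      using n4 g0x by (simp add: eg_def bilin T)
    show "?B (\<e> (n + 1)) (\<e> (n + 1)) = ta \<odot> eg n (m - 1) + ze \<odot> \<e> 2"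
      using xx L4_ext_bvec(4) by simp
    show "?B (\<e> (n + 1)) (\<e> 2) = (2 * ga) \<odot> \<e> 2" "?B (\<e> 2) (\<e> (n + 1)) = 0"
      using n4 xw wx T by simp_all
    show "?B (\<e> (n + 1)) (eg n (Suc i)) = (ga + of_nat (Suc i) * al) \<odot> eg n (Suc i) + G c (Suc (Suc i))" for i
    proof (cases "i = 0")
      case True
      then show ?thesis using n4 xg1 by (simp add: eg_def bilin T numeral_2_eq_2)
    next
      case False
      show ?thesis
      proof (cases "Suc i < m")
        case True
        then have "l (i + 4) = (ga + (of_nat (i + 4) - 3) * al) \<odot> \<e> (i + 4) + G c (i + 4 - 2)"
          using False n by (intro xg) auto
        moreover have "of_nat (i + 4) - 3 = (of_nat (Suc i) :: complex)" by simp
        moreover have "eg n (Suc i) = \<e> (i + 4)" using True False n by (simp add: eg_def numeral_eq_Suc)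
        moreover have "i + 4 - 2 = Suc (Suc i)" by simp
        ultimately show ?thesis using L4_ext_bvec(3)[of "i + 4"] True n by simp
      next
        case False
        then show ?thesis using g_zero[of "Suc i"] G_ge[of "Suc (Suc i)"] by (simp add: zero_right)
      qed
    qed
    show "?B (eg n (Suc i)) (\<e> (n + 1)) = - ?B (\<e> (n + 1)) (eg n (Suc i))" for i
    proof (cases "i = 0")
      case True
      then show ?thesis using n4 gx1 wx by (simp add: eg_def bilin T)
    next
      case False
      then show ?thesis
        using L4_ext_bvec(2)[of "i + 4" n r l s] L4_ext_bvec(3)[of "i + 4" n r l s] gx[of "i + 4"]
        by (simp add: eg_def bilin add.commute)
    qed
  qed
qed

lemma carr_L4_ext: "carr (L4_ext n r l s) = coords (n + 1)" "scal (L4_ext n r l s) = cscale"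
  by (simp_all add: L4_ext_table table_alg_def coords_def)

lemma table_sum_restrict:
  fixes n :: nat
  assumes "\<And>i. i \<notin> {1..n} \<Longrightarrow> x i = (0::complex)" "\<And>i. i \<notin> {1..n} \<Longrightarrow> y i = 0"
  shows "(\<Sum>i=1..n + 1. \<Sum>j=1..n + 1. (x i * y j) \<odot> T i j) = (\<Sum>i=1..n. \<Sum>j=1..n. (x i * y j) \<odot> T i j)"
proof -
  have "x (Suc n) = 0" "y (Suc n) = 0" using assms by auto
  then show ?thesis by simp
qed

lemma subalg_L4_ext: "subalg (L4_ext n r l s) (coords n) \<cong>\<^sub>a L4 n"
proof -
  have "brk (L4_ext n r l s) x y = brk (L4 n) x y" if "x \<in> coords n" "y \<in> coords n" for x y
  proof -
    have "brk (L4_ext n r l s) x y = (\<Sum>i=1..n. \<Sum>j=1..n. (x i * y j) \<odot>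
      (if i \<le> n \<and> j \<le> n then L4_table n i j else if i \<le> n then r i else if j \<le> n then l j else s))"
      unfolding L4_ext_table table_alg_def calg.simps
      by (rule table_sum_restrict) (use that in \<open>auto simp: coords_def\<close>)
    also have "\<dots> = brk (L4 n) x y"
      unfolding L4_def table_alg_def calg.simps by (intro sum.cong refl) auto
    finally show ?thesis .
  qed
  moreover have "carr (L4 n) = coords n" "scal (L4 n) = cscale"
    by (simp_all add: L4_def table_alg_def coords_def)
  ultimately show ?thesis
    unfolding alg_iso_def subalg_def
    by (intro exI[of _ id]) (simp add: carr_L4_ext)
qed

lemma L4_ext_solvable_ext:
  assumes "n = m + 2"
    and "L4_ext_brackets (brk (L4_ext n r l s)) m u w g x al ga de c d fu fv su sv ta ze"
    and "su = 0" "ga = 0 \<or> fu = 0 \<and> fv = 0 \<and> sv = 0" "ta = 0 \<or> ga + of_nat (m - 1) * al = 0"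
      "de = 0 \<or> m = 2" "al \<noteq> 0 \<or> ga \<noteq> 0"
  shows "solvable_ext_of_L4 n (L4_ext n r l s)"
proof -
  interpret L4_ext_brackets "brk (L4_ext n r l s)" m u w g x al ga de c d fu fv su sv ta ze by fact
  interpret L4_model_algebra "brk (L4_ext n r l s)" m u w g x al ga de c d fu fv su sv ta ze "L4_ext n r l s"
    by unfold_locales (use assms carr_L4_ext[of n r l s] in \<open>simp_all add: numeral_3_eq_3\<close>)
  show ?thesis
    unfolding solvable_ext_of_L4_def
    using left_leibniz_A solvable_A indecomposable_A dim_A is_nilradical_N subalg_L4_ext assms(1)
    by auto
qed

lemma gsum_zero: "gsum m g (\<lambda>k. 0) i = 0"
  by (simp add: gsum_def)

section \<open>Frames and parameters of the eight families\<close>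

lemma alg1_frame:
  assumes n: "n = m + 2" "2 \<le> m"
  shows "L4_ext_brackets (brk (alg1 n a)) m eu (\<e> 2) (eg n) (\<e> (n + 1))
    (- 1) (- a) 0 (\<lambda>_. 0) (\<lambda>_. 0) 0 0 0 0 0 0"
  unfolding alg1_def
  by (rule L4_ext_bracketsI[OF n]) (simp_all add: gsum_zero fun_eq_iff pointwise algebra_simps)

text \<open>For \<open>n = 4\<close> the square \<open>\<e> 4\<close> of the new basis vector equals
  \<open>g 1 + \<e> 2\<close>, hence the exceptional value 1 of \<open>ze\<close>.\<close>

lemma alg2_frame:
  assumes n: "n = m + 2" "2 \<le> m"
  shows "L4_ext_brackets (brk (alg2 n)) m eu (\<e> 2) (eg n) (\<e> (n + 1))
    (- 1) (of_nat n - 3) 0 (\<lambda>_. 0) (\<lambda>_. 0) 0 0 0 0 1 (if n = 4 then 1 else 0)"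
proof -
  have "\<e> n = eg n (m - 1) + (if n = 4 then 1 else 0) \<odot> \<e> 2"
    using n by (auto simp: eg_def)
  then show ?thesis
    unfolding alg2_def
    by (intro L4_ext_bracketsI[OF n]) (simp_all add: gsum_zero fun_eq_iff pointwise algebra_simps)
qed

text \<open>The tail of \<open>[x, g 0]\<close> in family (iii): \<open>\<e> 4\<close> is absent,
  \<open>\<e> 5\<close> has index 1, and the signs are those of left multiplication by
  \<open>x\<close>.\<close>

definition alg3_coeff :: "complex \<Rightarrow> (nat \<Rightarrow> complex) \<Rightarrow> nat \<Rightarrow> complex" where
  "alg3_coeff \<epsilon> b k = (if k = 0 then 0 else if k = 1 then - \<epsilon> else - b (k - 1))"

lemma gsum_alg3_coeff:
  assumes n: "n = m + 2" "2 \<le> m" and i: "3 \<le> i"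
  shows "gsum m (eg n) (alg3_coeff \<epsilon> b) (i - 2) =
    - (\<epsilon> \<odot> (if i + 2 \<le> n then \<e> (i + 2) else 0)) - (\<Sum>k=i+3..n. b (k - i - 2) \<odot> (if k \<le> n then \<e> k else 0))"
proof -
  interpret L4_frame "brk (L4_ext n (\<lambda>_. 0) (\<lambda>_. 0) 0)" m eu "\<e> 2" "eg n" using L4_frame_L4_ext[OF n] .
  obtain j where j: "i = j + 3" using i by (metis add.commute le_Suc_ex)
  have tail: "(\<Sum>k<m. b (Suc k) \<odot> eg n (k + (j + 3))) = (\<Sum>k=i+3..n. b (k - i - 2) \<odot> (if k \<le> n then \<e> k else 0))"
  proof -
    \<comment> \<open>The summands with \<open>k + i + 3 > n\<close> vanish; the others are then
      reindexed by \<open>k + (i + 3)\<close>.\<close>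
    have "(\<Sum>k<m. b (Suc k) \<odot> eg n (k + (j + 3))) = (\<Sum>k<n - (i + 2). b (Suc k) \<odot> eg n (k + (j + 3)))"
      by (rule sum.mono_neutral_right) (use n j in \<open>auto simp: eg_def\<close>)
    also have "\<dots> = (\<Sum>k=i+3..n. b (k - i - 2) \<odot> (if k \<le> n then \<e> k else 0))"
      by (rule sum.reindex_bij_witness[of _ "\<lambda>k. k - (i + 3)" "\<lambda>k. k + (i + 3)"])
        (use n j in \<open>auto simp: eg_def Suc_diff_le eval_nat_numeral\<close>)
    finally show ?thesis .
  qed
  have "G (alg3_coeff \<epsilon> b) (j + 1) = - (\<epsilon> \<odot> eg n (j + 2)) + G (\<lambda>k. alg3_coeff \<epsilon> b (Suc (Suc k))) (j + 3)"
    by (subst G_split, subst G_split) (simp add: alg3_coeff_def eval_nat_numeral)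
  also have "G (\<lambda>k. alg3_coeff \<epsilon> b (Suc (Suc k))) (j + 3) = - (\<Sum>k<m. b (Suc k) \<odot> eg n (k + (j + 3)))"
    by (simp add: gsum_def alg3_coeff_def sum_negf)
  also have "eg n (j + 2) = (if i + 2 \<le> n then \<e> (i + 2) else 0)"
    by (simp add: eg_def j)
  finally show ?thesis using tail by (simp add: j)
qed

text \<open>In this table \<open>[x, \<e> 1] = - \<e> 3\<close>, so \<open>[x, u]\<close> is minus
  the tail of \<open>[x, \<e> 3]\<close>; therefore \<open>d\<close> is the negative of
  \<open>c\<close>.\<close>

lemma alg3_frame:
  assumes n: "n = m + 2" "2 \<le> m"
  shows "L4_ext_brackets (brk (alg3 n \<epsilon> b)) m eu (\<e> 2) (eg n) (\<e> (n + 1))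
    0 (- 1) 0 (alg3_coeff \<epsilon> b) (\<lambda>k. - alg3_coeff \<epsilon> b k) 0 0 0 0 0 0"
proof -
  interpret L4_frame "brk (L4_ext n (\<lambda>_. 0) (\<lambda>_. 0) 0)" m eu "\<e> 2" "eg n" using L4_frame_L4_ext[OF n] .
  define tail where "tail i = \<epsilon> \<odot> (if i + 2 \<le> n then \<e> (i + 2) else 0)
    + (\<Sum>k=i+3..n. b (k - i - 2) \<odot> (if k \<le> n then \<e> k else 0))" for i
  have tail: "G (alg3_coeff \<epsilon> b) (i - 2) = - tail i" if "3 \<le> i" for i
    using gsum_alg3_coeff[OF n that] by (simp add: tail_def)
  have alg3: "alg3 n \<epsilon> b = L4_ext n
      (\<lambda>i. if i = 1 then \<e> 3 else if 3 \<le> i \<and> i \<le> n then - ((if i = 4 then 1 else 0) \<odot> \<e> 2) + \<e> i + tail i else 0)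
      (\<lambda>i. if i = 1 then - \<e> 3 else if i = 2 then (- 2) \<odot> \<e> 2
        else if 3 \<le> i \<and> i \<le> n then - ((if i = 4 then 1 else 0) \<odot> \<e> 2) - \<e> i - tail i else 0) 0"
  proof -
    have eq: "r = r' \<Longrightarrow> l = l' \<Longrightarrow> L4_ext n r l 0 = L4_ext n r' l' 0" for r r' l l' by simp
    show ?thesis
      unfolding alg3_def Let_def
      by (intro eq ext) (use n in \<open>auto simp: tail_def diff_diff_eq add.assoc\<close>)
  qed
  have neg: "G (\<lambda>k. - alg3_coeff \<epsilon> b k) 1 = tail 3"
    using tail[of 3] by (simp add: G_minus)
  have n4: "3 \<le> n" "4 \<le> n" using n by auto
  show ?thesis
    unfolding alg3
    by (rule L4_ext_bracketsI[OF n])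
      (use n4 neg tail[of 3] tail[of 4] tail in \<open>simp_all add: fun_eq_iff pointwise algebra_simps\<close>)
qed

lemma alg4_frame:
  assumes n: "n = m + 2" "2 \<le> m"
  shows "L4_ext_brackets (brk (alg4 n \<epsilon> d f)) m eu (\<e> 2) (eg n) (\<e> (n + 1))
    (- 1) 0 0 (\<lambda>_. 0) (\<lambda>_. 0) f d 0 (d + f) 0 \<epsilon>"
  unfolding alg4_def
  by (rule L4_ext_bracketsI[OF n]) (simp_all add: gsum_zero fun_eq_iff pointwise algebra_simps)

lemma alg5_frame:
  "L4_ext_brackets (brk (alg5 a b)) 2 eu (\<e> 2) (eg 4) (\<e> (4 + 1))
    (1 - a) (- (b + 1)) (- 1) (\<lambda>_. 0) (\<lambda>_. 0) 0 0 0 0 0 0"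
  unfolding alg5_def
  by (rule L4_ext_bracketsI) (simp_all add: gsum_zero fun_eq_iff pointwise algebra_simps)

lemma alg6_frame:
  "L4_ext_brackets (brk (alg6 a)) 2 eu (\<e> 2) (eg 4) (\<e> (4 + 1))
    (1 - a) (a - 1) (- 1) (\<lambda>_. 0) (\<lambda>_. 0) 0 0 0 0 1 1"
  unfolding alg6_def
  by (rule L4_ext_bracketsI) (simp_all add: gsum_zero fun_eq_iff pointwise algebra_simps eg_def)

lemma alg7_frame:
  "L4_ext_brackets (brk (alg7 \<epsilon> a d f)) 2 eu (\<e> 2) (eg 4) (\<e> (4 + 1))
    (1 - a) 0 (- 1) (\<lambda>_. 0) (\<lambda>_. 0) f d 0 (d + f) 0 \<epsilon>"
  unfolding alg7_def
  by (rule L4_ext_bracketsI) (simp_all add: gsum_zero fun_eq_iff pointwise algebra_simps)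

lemma alg8_frame:
  "L4_ext_brackets (brk (alg8 \<epsilon> c d)) 2 eu (\<e> 2) (eg 4) (\<e> (4 + 1))
    1 0 (- 1) (\<lambda>_. 0) (\<lambda>_. 0) (- c) (d + 2 * c) 0 (d + 2 * c) 0 \<epsilon>"
  unfolding alg8_def
  by (rule L4_ext_bracketsI) (simp_all add: gsum_zero fun_eq_iff pointwise algebra_simps)

lemma is_L4_ext:
  "\<exists>r l s. alg1 n a = L4_ext n r l s" "\<exists>r l s. alg2 n = L4_ext n r l s"
  "\<exists>r l s. alg3 n \<epsilon> b = L4_ext n r l s" "\<exists>r l s. alg4 n \<epsilon> x y = L4_ext n r l s"
  "\<exists>r l s. alg5 a x = L4_ext 4 r l s" "\<exists>r l s. alg6 a = L4_ext 4 r l s"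
  "\<exists>r l s. alg7 \<epsilon> a x y = L4_ext 4 r l s" "\<exists>r l s. alg8 \<epsilon> a x = L4_ext 4 r l s"
  unfolding alg1_def alg2_def alg3_def alg4_def alg5_def alg6_def alg7_def alg8_def Let_def by blast+

lemma solvable_ext_if_frame:
  assumes "n = m + 2" "\<exists>r l s. A = L4_ext n r l s"
    and "L4_ext_brackets (brk A) m u w g x al ga de c d fu fv su sv ta ze"
    and "su = 0" "ga = 0 \<or> fu = 0 \<and> fv = 0 \<and> sv = 0" "ta = 0 \<or> ga + of_nat (m - 1) * al = 0"
      "de = 0 \<or> m = 2" "al \<noteq> 0 \<or> ga \<noteq> 0"
  shows "solvable_ext_of_L4 n A"
  using assms L4_ext_solvable_ext by blast

lemma listed_solvable_ext:
  assumes "4 \<le> n" "A \<in> listed_algs n"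
  shows "solvable_ext_of_L4 n A"
proof -
  define m where "m = n - 2"
  have n: "n = m + 2" "2 \<le> m" using assms by (auto simp: m_def)
  note S = solvable_ext_if_frame[OF n(1)]
  have 1: "solvable_ext_of_L4 n (alg1 n a)" for a
    by (rule S[OF is_L4_ext(1) alg1_frame[OF n]]) auto
  have 2: "solvable_ext_of_L4 n (alg2 n)"
    by (rule S[OF is_L4_ext(2) alg2_frame[OF n]]) (use n in \<open>auto simp: of_nat_diff\<close>)
  have 3: "solvable_ext_of_L4 n (alg3 n e b)" for e b
    by (rule S[OF is_L4_ext(3) alg3_frame[OF n]]) auto
  have 4: "solvable_ext_of_L4 n (alg4 n e d f)" for e d f
    by (rule S[OF is_L4_ext(4) alg4_frame[OF n]]) auto
  note S4 = solvable_ext_if_frame[of 4 2]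
  have 5: "solvable_ext_of_L4 4 (alg5 a b)" if "b = -1 \<longrightarrow> a \<noteq> 1" for a b
    by (rule S4[OF _ is_L4_ext(5) alg5_frame]) (use that in \<open>auto simp: eq_neg_iff_add_eq_0 minus_equation_iff[of b]\<close>)
  have 6: "solvable_ext_of_L4 4 (alg6 a)" if "a \<noteq> 1" for a
    by (rule S4[OF _ is_L4_ext(6) alg6_frame]) (use that in auto)
  have 7: "solvable_ext_of_L4 4 (alg7 e a d f)" if "a \<noteq> 1" for e a d f
    by (rule S4[OF _ is_L4_ext(7) alg7_frame]) (use that in auto)
  have 8: "solvable_ext_of_L4 4 (alg8 e c d)" for e c d
    by (rule S4[OF _ is_L4_ext(8) alg8_frame]) auto
  show ?thesis
    using assms(2) 1 2 3 4 5 6 7 8 unfolding listed_algs_def by (auto split: if_splits)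
qed

section \<open>Changes of frame\<close>

text \<open>Only left multiplication by \<open>x\<close> is fixed here. The consequences are thus
  available in \<open>exists_frame\<close>, before the symmetric parts of the brackets with
  \<open>x\<close> are known to be multiples of \<open>w\<close>.\<close>

locale L4_left_frame = L4_coords_frame +
  fixes al ga de :: complex and c d :: "nat \<Rightarrow> complex" and fu fv :: complex
  assumes xu: "B x u = al \<odot> u + G d 1 + fu \<odot> w"
    and xg0: "B x (g 0) = ga \<odot> g 0 + de \<odot> u + G c 1 + fv \<odot> w"
    and leib: "B (B p q) r = B p (B q r) - B q (B p r)"
begin

lemma derivation: "B x (B p q) = B (B x p) q + B p (B x q)"
  using leib[of x p q] by simp

lemma x_w: "B x w = (2 * ga) \<odot> w"
proof -
  have "B x w = B (B x (g 0)) (g 0) + B (g 0) (B x (g 0))"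
    using derivation[of "g 0" "g 0"] by (simp add: gg)
  also have "\<dots> = (2 * ga) \<odot> w"
    by (simp add: xg0 bilin gg ug gu Gg gG wg gw fun_eq_iff pointwise algebra_simps)
  finally show ?thesis .
qed

text \<open>\<open>w\<close> is the square of \<open>g 0\<close>, and squares annihilate from the
  left.\<close>

lemma w_x: "B w x = 0"
  using leib[of "g 0" "g 0" x] by (simp add: gg)

text \<open>The derivation is applied to \<open>g (i + 1) = [g i, u]\<close>: each bracket with
  \<open>u\<close> adds the eigenvalue \<open>al\<close> and shifts the tail
  \<open>G c\<close>.\<close>

lemma x_g: "B x (g (Suc i)) = (ga + of_nat (Suc i) * al) \<odot> g (Suc i) + G c (Suc (Suc i))"
proof (induction i)
  case 0
  have "B x (g (Suc 0)) = B (B x (g 0)) u + B (g 0) (B x u)"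
    using derivation[of "g 0" u] by (simp add: gu)
  then show "B x (g (Suc 0)) = (ga + of_nat (Suc 0) * al) \<odot> g (Suc 0) + G c (Suc (Suc 0))"
    by (simp add: xg0 xu bilin gu uu Gu wu gG gw fun_eq_iff pointwise algebra_simps)
next
  case (Suc i)
  have "B x (g (Suc (Suc i))) = B (B x (g (Suc i))) u + B (g (Suc i)) (B x u)"
    using derivation[of "g (Suc i)" u] by (simp add: gu)
  then show "B x (g (Suc (Suc i))) = (ga + of_nat (Suc (Suc i)) * al) \<odot> g (Suc (Suc i)) + G c (Suc (Suc (Suc i)))"
    unfolding Suc by (simp add: xu bilin gu Gu gG gw fun_eq_iff pointwise algebra_simps)
qed

text \<open>The induction uses the Leibniz identity for \<open>(g i, u, x)\<close>. The hypotheses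
  ask only that the symmetric parts vanish in these brackets, as every combination of
  \<open>w\<close> and \<open>g (m - 1)\<close> does.\<close>

lemma g_x:
  assumes "\<And>i. B (g i) (B x u + B u x) = 0" "B u (B x (g 0) + B (g 0) x) = 0"
  shows "B (g (Suc i)) x = - B x (g (Suc i))"
proof (induction i)
  case 0
  have "B (g 0) (B u x) = - B (g 0) (B x u)" "B u (B (g 0) x) = - B u (B x (g 0))"
    using assms(1)[of 0] assms(2) by (simp_all add: bilin eq_neg_iff_add_eq_0 add.commute)
  moreover have "B (g (Suc 0)) x = B (g 0) (B u x) - B u (B (g 0) x)"
    using leib[of "g 0" u x] by (simp add: gu)
  ultimately show "B (g (Suc 0)) x = - B x (g (Suc 0))"
    unfolding x_g by (simp add: xu xg0 bilin gu ug uu uG uw wu gG gw fun_eq_iff pointwise algebra_simps)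
next
  case (Suc i)
  have "B (g (Suc i)) (B u x) = - B (g (Suc i)) (B x u)"
    using assms(1)[of "Suc i"] by (simp add: bilin eq_neg_iff_add_eq_0 add.commute)
  moreover have "B (g (Suc (Suc i))) x = B (g (Suc i)) (B u x) - B u (B (g (Suc i)) x)"
    using leib[of "g (Suc i)" u x] by (simp add: gu)
  ultimately show "B (g (Suc (Suc i))) x = - B x (g (Suc (Suc i)))"
    unfolding Suc x_g by (simp add: xu bilin gu ug uG gG gw fun_eq_iff pointwise algebra_simps)
qed

end

locale L4_leibniz_frame = L4_ext_frame +
  assumes leib: "B (B p q) r = B p (B q r) - B q (B p r)"
begin

sublocale left: L4_left_frame B m u w g x al ga de c d fu fv
  by unfold_locales (rule xu xg0 leib)+

sublocale L4_ext_brackets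
proof
  show "B (g (Suc i)) x = - B x (g (Suc i))" for i
    by (rule left.g_x) (simp_all add: ux g0x bilin gw uw)
qed (rule left.x_w left.w_x left.x_g)+

text \<open>The derivation applied to \<open>[g 0, g 1] = 0\<close> leaves \<open>de\<close> times
  \<open>[u, g 1] = - g 2\<close>.\<close>

lemma de_zero: "m = 2 \<or> de = 0"
proof (rule disjCI)
  assume "de \<noteq> 0"
  have "B (B x (g 0)) (g 1) + B (g 0) (B x (g 1)) = 0"
    using left.derivation[of "g 0" "g 1"] by (simp add: gg zero_right)
  then have "de \<odot> g 2 = 0"
    by (simp add: brackets bilin numeral_2_eq_2)
  with \<open>de \<noteq> 0\<close> show "m = 2" using g_nonzero[of 2] m_ge by (cases "m = 2") auto
qed

lemma w_coeff: "r \<odot> w = s \<odot> w \<Longrightarrow> r = s"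
  using w_nonzero by simp

text \<open>This relation and the next two compare coefficients in the Leibniz identity for
  \<open>(x, u, x)\<close>, \<open>(x, g 0, x)\<close> and \<open>(x, x, x)\<close>. Since
  \<open>[x, x]\<close> is central in the nilradical, its brackets with \<open>u\<close> and
  \<open>g 0\<close> drop out.\<close>

lemma su_relation: "(2 * ga - al) * su = 2 * ga * fu"
proof -
  have "B u (B x x) = 0"
    using m_ge g_zero[of m] by (simp add: xx bilin uw ug)
  then have "B (B x u) x = B x (B u x)" using leib[of x u x] by simp
  then have "(al * su) \<odot> w = (2 * ga * su - 2 * ga * fu) \<odot> w"
    by (simp add: brackets bilin del: cv.scale_cancel_right)
      (simp add: fun_eq_iff pointwise algebra_simps del: cv.scale_cancel_right)
  then have "al * su = 2 * ga * su - 2 * ga * fu" by (rule w_coeff)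
  then show ?thesis by (simp add: algebra_simps)
qed

lemma sv_relation: "ga * sv = de * su + 2 * ga * fv"
proof -
  have "B (g 0) (B x x) = 0"
    using m_ge by (simp add: xx bilin gw gg)
  then have "B (B x (g 0)) x = B x (B (g 0) x)" using leib[of x "g 0" x] by simp
  then have "(ga * sv + de * su) \<odot> w = (2 * ga * sv - 2 * ga * fv) \<odot> w"
    by (simp add: brackets bilin del: cv.scale_cancel_right)
      (simp add: fun_eq_iff pointwise algebra_simps del: cv.scale_cancel_right)
  then have "ga * sv + de * su = 2 * ga * sv - 2 * ga * fv" by (rule w_coeff)
  then show ?thesis by (simp add: algebra_simps)
qed

lemma ta_relation: "ta * (ga + of_nat (m - 1) * al) = 0"
proof -
  have m1: "m - 1 = Suc (m - 2)" using m_ge by simp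
  have "B x (g (m - 1)) = (ga + of_nat (m - 1) * al) \<odot> g (m - 1)"
    unfolding m1 using xg[of "m - 2"] G_ge[of "Suc (Suc (m - 2))"] by simp
  moreover have "B (g (m - 1)) x = - B x (g (m - 1))" unfolding m1 by (rule gx)
  moreover have "B (B x x) x = 0" using leib[of x x x] by simp
  then have "ta \<odot> B (g (m - 1)) x = 0" by (simp add: xx bilin wx)
  ultimately show ?thesis using g_last_nonzero by simp
qed

section \<open>Elementary changes of frame and their effect on the parameters\<close>

lemma scale_x:
  assumes "k \<noteq> 0"
  shows "L4_leibniz_frame B m u w g (k \<odot> x) (k * al) (k * ga) (k * de) (\<lambda>i. k * c i) (\<lambda>i. k * d i)
    (k * fu) (k * fv) (k * su) (k * sv) (k * k * ta) (k * k * ze)"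
proof
  show "k \<odot> x \<in> coords (m + 3)" using x_coords by (rule cv.subspace_scale[OF subspace_coords])
  show "(k \<odot> x) (m + 3) \<noteq> 0" using assms x_outside by (simp add: pointwise)
qed (rule u_coords w_coords g_coords leib |
    simp add: bilin xu xg0 ux g0x xx G_scale fun_eq_iff pointwise algebra_simps)+

text \<open>\<open>G p 0\<close> changes \<open>[x, u]\<close> by \<open>G p 1\<close>, hence
  \<open>d\<close> by \<open>p\<close>; \<open>r\<close> times \<open>u\<close> lowers
  \<open>c 0\<close> by \<open>r\<close>; \<open>w\<close> affects only \<open>[x, x]\<close>,
  through \<open>[x, w]\<close>. The terms \<open>p 0\<close> in \<open>fv\<close> and
  \<open>2 * p 0\<close> in \<open>sv\<close> stem from \<open>[g 0, g 0] = w\<close>.\<close>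

lemma translate_x:
  "L4_leibniz_frame B m u w g (x + (G p 0 + r \<odot> u + q \<odot> w)) al ga de
    (\<lambda>i. if i = 0 then c 0 - r else c i) (\<lambda>i. d i + p i) fu (fv + p 0) su (sv + 2 * p 0) ta
    (ze + r * su + p 0 * sv + 2 * ga * q + p 0 * p 0)"
proof -
  let ?y = "G p 0 + r \<odot> u + q \<odot> w"
  have y: "?y \<in> coords (m + 2)"
    by (intro cv.subspace_add cv.subspace_scale subspace_coords G_coords u_coords w_coords)
  then have "?y (m + 3) = 0" by (simp add: coords_def)
  have G0: "G p 0 = p 0 \<odot> g 0 + G (\<lambda>i. p (Suc i)) (Suc 0)" by (rule G_split)
  have Gc: "G (\<lambda>i. if i = 0 then c 0 - r else c i) 1 = G c 1 - r \<odot> g 1"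
    by (subst (1 2) G_split) (simp add: fun_eq_iff pointwise algebra_simps)
  show ?thesis
  proof
    show "x + ?y \<in> coords (m + 3)"
      using x_coords y coords_mono cv.subspace_add[OF subspace_coords] by blast
    show "(x + ?y) (m + 3) \<noteq> 0" using \<open>?y (m + 3) = 0\<close> x_outside by (simp add: pointwise)
    show "B (x + ?y) u = al \<odot> u + G (\<lambda>i. d i + p i) 1 + fu \<odot> w"
      unfolding G_add by (simp add: bilin brackets)
    show "B (x + ?y) (g 0) = ga \<odot> g 0 + de \<odot> u + G (\<lambda>i. if i = 0 then c 0 - r else c i) 1 + (fv + p 0) \<odot> w"
      unfolding Gc G0 by (simp add: bilin brackets) (simp add: fun_eq_iff pointwise algebra_simps)
    show "B u (x + ?y) = su \<odot> w - B (x + ?y) u"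
      by (simp add: bilin brackets)
    show "B (g 0) (x + ?y) = (sv + 2 * p 0) \<odot> w - B (x + ?y) (g 0)"
      unfolding G0 by (simp add: bilin brackets) (simp add: fun_eq_iff pointwise algebra_simps)
    show "B (x + ?y) (x + ?y) = ta \<odot> g (m - 1) + (ze + r * su + p 0 * sv + 2 * ga * q + p 0 * p 0) \<odot> w"
      unfolding G0 by (simp add: bilin brackets) (simp add: fun_eq_iff pointwise algebra_simps)
  qed (rule u_coords w_coords g_coords leib)+
qed

text \<open>\<open>w\<close> is central in the nilradical, so \<open>w\<close> and the
  \<open>g i\<close> with \<open>i > 0\<close> stay the same. The parameters change because
  \<open>x\<close> has eigenvalue \<open>2 * ga\<close> on \<open>w\<close> and because
  \<open>[x, u]\<close>, \<open>[x, g 0]\<close> are rewritten in the new vectors.\<close>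

lemma add_w:
  fixes p q :: complex
  defines "g' \<equiv> g(0 := g 0 + q \<odot> w)"
  shows "L4_leibniz_frame B m (u + p \<odot> w) w g' x al ga de c d
    (fu + (2 * ga - al) * p) (fv + ga * q - de * p) (su + 2 * ga * p) (sv + 2 * ga * q) ta ze"
proof -
  have g'S: "g' (Suc i) = g (Suc i)" and g'0: "g' 0 = g 0 + q \<odot> w" for i
    by (simp_all add: g'_def)
  have g'G: "gsum m g' s (Suc i) = G s (Suc i)" for s i by (simp add: gsum_def g'S)
  have m1: "m - 1 = Suc (m - 2)" using m_ge by simp
  have g': "i = 0 \<or> (\<exists>j. i = Suc j)" for i by (cases i) auto
  show ?thesis
  proof
    show "g' i = 0" if "m \<le> i" for i using that m_ge g_zero by (simp add: g'_def)
    show "B (g' i) (u + p \<odot> w) = g' (Suc i)" "B (u + p \<odot> w) (g' i) = - g' (Suc i)"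
      "B (g' i) w = 0" "B w (g' i) = 0" "g' i \<in> coords (m + 2)" for i
      using g'[of i] g_coords w_coords
      by (auto simp: g'S g'0 bilin brackets intro!: cv.subspace_add cv.subspace_scale subspace_coords)
    show "B (g' i) (g' j) = (if i = 0 \<and> j = 0 then w else 0)" for i j
      using g'[of i] g'[of j] by (auto simp: g'S g'0 bilin brackets)
    show "a \<odot> w + b \<odot> g' (m - 1) = 0 \<Longrightarrow> a = 0 \<and> b = 0" for a b
      using indep_center[of a b] unfolding m1 g'S .
    show "u + p \<odot> w \<in> coords (m + 2)"
      using u_coords w_coords by (intro cv.subspace_add cv.subspace_scale subspace_coords)
    show "B x (u + p \<odot> w) = al \<odot> (u + p \<odot> w) + gsum m g' d 1 + (fu + (2 * ga - al) * p) \<odot> w"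
      by (simp add: g'G bilin brackets) (simp add: fun_eq_iff pointwise algebra_simps)
    show "B x (g' 0) = ga \<odot> g' 0 + de \<odot> (u + p \<odot> w) + gsum m g' c 1 + (fv + ga * q - de * p) \<odot> w"
      by (simp add: g'G g'0 bilin brackets) (simp add: fun_eq_iff pointwise algebra_simps)
    show "B (u + p \<odot> w) x = (su + 2 * ga * p) \<odot> w - B x (u + p \<odot> w)"
      by (simp add: bilin brackets) (simp add: fun_eq_iff pointwise algebra_simps)
    show "B (g' 0) x = (sv + 2 * ga * q) \<odot> w - B x (g' 0)"
      by (simp add: g'0 bilin brackets) (simp add: fun_eq_iff pointwise algebra_simps)
    show "B x x = ta \<odot> g' (m - 1) + ze \<odot> w" using xx unfolding m1 g'S .
  qed (rule m_ge w_coords x_coords x_outside leib | simp add: bilin brackets)+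
qed

text \<open>The factors \<open>k\<close> on \<open>u\<close> and \<open>h\<close> on
  \<open>g 0\<close> force those on \<open>g i\<close> and \<open>w\<close>, which are iterated
  brackets of \<open>u\<close> and \<open>g 0\<close>.\<close>

lemma rescale:
  assumes k: "k \<noteq> 0" and h: "h \<noteq> 0"
  shows "L4_leibniz_frame B m (k \<odot> u) ((h * h) \<odot> w) (\<lambda>i. (h * k ^ i) \<odot> g i) x al ga (de * h / k)
    (\<lambda>i. c i / k ^ Suc i) (\<lambda>i. d i * k / (h * k ^ Suc i)) (fu * k / (h * h)) (fv / h)
    (su * k / (h * h)) (sv / h) (ta / (h * k ^ (m - 1))) (ze / (h * h))"
proof -
  let ?g = "\<lambda>i. (h * k ^ i) \<odot> g i"
  have Gd: "gsum m ?g (\<lambda>i. d i * k / (h * k ^ Suc i)) 1 = k \<odot> G d 1"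
    unfolding gsum_def cv.scale_sum_right using k h by (intro sum.cong refl) simp
  have Gc: "gsum m ?g (\<lambda>i. c i / k ^ Suc i) 1 = h \<odot> G c 1"
    unfolding gsum_def cv.scale_sum_right using k h by (intro sum.cong refl) simp
  show ?thesis
  proof
    show "?g i = 0" if "m \<le> i" for i using that g_zero by simp
    show "(h * k ^ i) \<odot> g i \<in> coords (m + 2)" for i
      using g_coords by (intro cv.subspace_scale subspace_coords)
    show "a \<odot> (h * h) \<odot> w + b \<odot> (h * k ^ (m - 1)) \<odot> g (m - 1) = 0 \<Longrightarrow> a = 0 \<and> b = 0" for a b
      using indep_center[of "a * (h * h)" "b * (h * k ^ (m - 1))"] k h by simp
    show "k \<odot> u \<in> coords (m + 2)" "(h * h) \<odot> w \<in> coords (m + 2)"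
      using u_coords w_coords by (auto intro: cv.subspace_scale subspace_coords)
    show "B x (k \<odot> u) = al \<odot> k \<odot> u + gsum m ?g (\<lambda>i. d i * k / (h * k ^ Suc i)) 1 + (fu * k / (h * h)) \<odot> (h * h) \<odot> w"
      unfolding Gd using h by (simp add: bilin brackets) (simp add: fun_eq_iff pointwise algebra_simps)
    show "B x ((h * k ^ 0) \<odot> g 0) = ga \<odot> (h * k ^ 0) \<odot> g 0 + (de * h / k) \<odot> k \<odot> u
        + gsum m ?g (\<lambda>i. c i / k ^ Suc i) 1 + (fv / h) \<odot> (h * h) \<odot> w"
      unfolding Gc using h k by (simp add: bilin brackets) (simp add: fun_eq_iff pointwise algebra_simps)
    show "B (k \<odot> u) x = (su * k / (h * h)) \<odot> (h * h) \<odot> w - B x (k \<odot> u)"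
      using h by (simp add: bilin brackets) (simp add: fun_eq_iff pointwise algebra_simps)
    show "B ((h * k ^ 0) \<odot> g 0) x = (sv / h) \<odot> (h * h) \<odot> w - B x ((h * k ^ 0) \<odot> g 0)"
      using h by (simp add: bilin brackets) (simp add: fun_eq_iff pointwise algebra_simps)
    show "B x x = (ta / (h * k ^ (m - 1))) \<odot> (h * k ^ (m - 1)) \<odot> g (m - 1) + (ze / (h * h)) \<odot> (h * h) \<odot> w"
      using h k xx by simp
  qed (rule m_ge x_coords x_outside leib | simp add: bilin brackets algebra_simps)+
qed

text \<open>The new \<open>g 0\<close> has with \<open>g 1\<close> the bracket \<open>- p\<close>
  times \<open>g 2\<close>, which vanishes for \<open>m = 2\<close>.\<close>

lemma add_u:
  fixes p :: complex
  assumes m: "m = 2"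
  defines "g' \<equiv> g(0 := g 0 + p \<odot> u)"
  shows "L4_leibniz_frame B m u w g' x al ga (de + p * (al - ga)) (\<lambda>i. c i + p * d i) d
    fu (fv + p * fu) su (sv + p * su) ta ze"
proof -
  have g'S: "g' (Suc i) = g (Suc i)" and g'0: "g' 0 = g 0 + p \<odot> u" for i
    by (simp_all add: g'_def)
  have g'G: "gsum m g' s (Suc i) = G s (Suc i)" for s i by (simp add: gsum_def g'S)
  have m1: "m - 1 = Suc (m - 2)" using m by simp
  have g': "i = 0 \<or> (\<exists>j. i = Suc j)" for i by (cases i) auto
  have g2: "g (Suc (Suc i)) = 0" for i using m by (intro g_zero) simp
  show ?thesis
  proof
    show "g' i = 0" if "m \<le> i" for i using that m g_zero by (simp add: g'_def)
    show "B (g' i) u = g' (Suc i)" "B u (g' i) = - g' (Suc i)"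
      "B (g' i) w = 0" "B w (g' i) = 0" "g' i \<in> coords (m + 2)" for i
      using g'[of i] g_coords u_coords
      by (auto simp: g'S g'0 bilin brackets intro!: cv.subspace_add cv.subspace_scale subspace_coords)
    show "B (g' i) (g' j) = (if i = 0 \<and> j = 0 then w else 0)" for i j
      using g'[of i] g'[of j] by (auto simp: g'S g'0 bilin brackets g2)
    show "a \<odot> w + b \<odot> g' (m - 1) = 0 \<Longrightarrow> a = 0 \<and> b = 0" for a b
      using indep_center[of a b] unfolding m1 g'S .
    show "B x u = al \<odot> u + gsum m g' d 1 + fu \<odot> w"
      by (simp add: g'G xu)
    show "B x (g' 0) = ga \<odot> g' 0 + (de + p * (al - ga)) \<odot> u + gsum m g' (\<lambda>i. c i + p * d i) 1 + (fv + p * fu) \<odot> w"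
      by (simp add: g'G g'0 G_add G_scale bilin brackets) (simp add: fun_eq_iff pointwise algebra_simps)
    show "B (g' 0) x = (sv + p * su) \<odot> w - B x (g' 0)"
      by (simp add: g'0 bilin brackets) (simp add: fun_eq_iff pointwise algebra_simps)
    show "B x x = ta \<odot> g' (m - 1) + ze \<odot> w" using xx unfolding m1 g'S .
  qed (rule m_ge u_coords w_coords x_coords x_outside leib | simp add: bilin brackets)+
qed

text \<open>The hypothesis on \<open>q\<close> says that the tail \<open>G c 1\<close> of
  \<open>[x, g 0]\<close> is absorbed if \<open>g 0\<close> is replaced by
  \<open>g 0 + G q 1\<close>. The same polynomial in \<open>u\<close> is applied to every
  \<open>g i\<close>, which keeps \<open>[g i, u] = g (i + 1)\<close>.\<close>

lemma add_G:
  assumes q: "B x (G q 1) + G c 1 = ga \<odot> G q 1" and d: "d = (\<lambda>_. 0)"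
  shows "L4_leibniz_frame B m u w (\<lambda>i. g i + G q (Suc i)) x al ga de (\<lambda>_. 0) (\<lambda>_. 0) fu fv su sv ta ze"
proof -
  let ?g = "\<lambda>i. g i + G q (Suc i)"
  have last: "?g (m - 1) = g (m - 1)" using G_ge m_ge by simp
  show ?thesis
  proof
    show "?g i = 0" if "m \<le> i" for i using that g_zero G_ge by simp
    show "g i + G q (Suc i) \<in> coords (m + 2)" for i
      using g_coords G_coords by (intro cv.subspace_add subspace_coords)
    show "a \<odot> w + b \<odot> (g (m - 1) + G q (Suc (m - 1))) = 0 \<Longrightarrow> a = 0 \<and> b = 0" for a b
      using indep_center[of a b] last by simp
    show "B x u = al \<odot> u + gsum m ?g (\<lambda>_. 0) 1 + fu \<odot> w"
      by (simp add: xu d gsum_zero)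
    have "B x (g 0 + G q (Suc 0)) = B x (g 0) + (ga \<odot> G q 1 - G c 1)"
      using q by (simp add: bilin algebra_simps)
    then show "B x (g 0 + G q (Suc 0)) = ga \<odot> (g 0 + G q (Suc 0)) + de \<odot> u + gsum m ?g (\<lambda>_. 0) 1 + fv \<odot> w"
      by (simp add: xg0 gsum_zero fun_eq_iff pointwise algebra_simps)
    show "B (g 0 + G q (Suc 0)) x = sv \<odot> w - B x (g 0 + G q (Suc 0))"
      by (simp add: bilin Gx g0x)
    show "B x x = ta \<odot> (g (m - 1) + G q (Suc (m - 1))) + ze \<odot> w" using xx last by simp
  qed (rule m_ge u_coords w_coords x_coords x_outside leib ux | simp add: bilin brackets)+
qed

text \<open>
  On the span of the \<open>g i\<close> with \<open>i \<ge> 1\<close>, left multiplication by \<open>x\<close> minus \<open>ga\<close> is triangular with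
  diagonal entries \<open>i * al\<close>, hence invertible.
\<close>

lemma triangular_solution:
  assumes al: "al \<noteq> 0"
  obtains q where "B x (G q 1) + G c 1 = ga \<odot> G q 1"
proof -
  \<comment> \<open>Successive approximation: after \<open>j\<close> steps the error
    \<open>G p (Suc j)\<close> starts at \<open>g (Suc j)\<close>, and after \<open>m\<close> steps
    it is zero.\<close>
  have "\<exists>q p. B x (G q 1) + G c 1 = ga \<odot> G q 1 + G p (Suc j)" if "j \<le> m" for j
    using that
  proof (induction j)
    case 0
    have "B x (G (\<lambda>_. 0) 1) + G c 1 = ga \<odot> G (\<lambda>_. 0) 1 + G c (Suc 0)"
      by (simp add: G_zero zero_right)
    then show "\<exists>q p. B x (G q 1) + G c 1 = ga \<odot> G q 1 + G p (Suc 0)" by blast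
  next
    case (Suc j)
    then obtain q p where qp: "B x (G q 1) + G c 1 = ga \<odot> G q 1 + G p (Suc j)" by auto
    \<comment> \<open>Adding \<open>t\<close> times \<open>g (Suc j)\<close> changes the error at
      \<open>g (Suc j)\<close> by \<open>t * (j + 1) * al\<close>, which cancels
      \<open>p 0\<close>.\<close>
    define t where "t = - p 0 / (of_nat (Suc j) * al)"
    have t: "t * (of_nat (Suc j) * al) = - p 0" using al by (simp add: t_def del: of_nat_Suc)
    let ?q = "\<lambda>k. q k + (if k = j then t else 0)"
    have "G (\<lambda>k. if k = j then t else 0) 1 = t \<odot> g (Suc j)"
      using Suc.prems by (simp add: gsum_def if_distrib[of "\<lambda>r. r \<odot> _"] cong: if_cong)
    then have Gq: "G ?q 1 = G q 1 + t \<odot> g (Suc j)" unfolding G_add by simp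
    have Gp: "G p (Suc j) = p 0 \<odot> g (Suc j) + G (\<lambda>k. p (Suc k)) (Suc (Suc j))" by (rule G_split)
    have "B x (G ?q 1) + G c 1 = (B x (G q 1) + G c 1) + t \<odot> B x (g (Suc j))"
      unfolding Gq by (simp add: bilin)
    also have "\<dots> = ga \<odot> G q 1 + G p (Suc j) + t \<odot> ((ga + of_nat (Suc j) * al) \<odot> g (Suc j) + G c (Suc (Suc j)))"
      unfolding qp xg ..
    also have "\<dots> = ga \<odot> G q 1 + p 0 \<odot> g (Suc j) + (t * ga) \<odot> g (Suc j) + (t * (of_nat (Suc j) * al)) \<odot> g (Suc j)
        + (G (\<lambda>k. p (Suc k)) (Suc (Suc j)) + t \<odot> G c (Suc (Suc j)))"
      unfolding Gp by (simp add: fun_eq_iff pointwise algebra_simps del: of_nat_Suc)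
    also have "\<dots> = ga \<odot> G ?q 1 + G (\<lambda>k. p (Suc k) + t * c k) (Suc (Suc j))"
      unfolding Gq t by (simp add: G_add G_scale fun_eq_iff pointwise algebra_simps)
    finally show "\<exists>q p. B x (G q 1) + G c 1 = ga \<odot> G q 1 + G p (Suc (Suc j))" by blast
  qed
  then obtain q p where "B x (G q 1) + G c 1 = ga \<odot> G q 1 + G p (Suc m)" by blast
  then show ?thesis using that G_ge[of "Suc m"] by simp
qed

end

section \<open>Normal forms\<close>

lemma remove_d:
  assumes "L4_leibniz_frame B m u w g x al ga de c d fu fv su sv ta ze"
  obtains x' fv' sv' ze' where "L4_leibniz_frame B m u w g x' al ga de c (\<lambda>_. 0) fu fv' su sv' ta ze'"
proof -
  interpret L4_leibniz_frame B m u w g x al ga de c d fu fv su sv ta ze by fact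
  have "(\<lambda>i. if i = 0 then c 0 - 0 else c i) = c" by auto
  then show ?thesis using that translate_x[of "\<lambda>i. - d i" 0 0] by simp
qed

lemma remove_c:
  assumes "L4_leibniz_frame B m u w g x al ga de c (\<lambda>_. 0) fu fv su sv ta ze" and "al \<noteq> 0"
  obtains g' where "L4_leibniz_frame B m u w g' x al ga de (\<lambda>_. 0) (\<lambda>_. 0) fu fv su sv ta ze"
proof -
  interpret L4_leibniz_frame B m u w g x al ga de c "\<lambda>_. 0" fu fv su sv ta ze by fact
  show ?thesis using triangular_solution[OF assms(2)] add_G that by blast
qed

text \<open>For nonzero \<open>de\<close>, where \<open>m = 2\<close>, this diagonalises the
  triangular action of \<open>x\<close> on \<open>u\<close> and \<open>g 0\<close>: up to tails and
  multiples of \<open>w\<close>, the eigenvector for \<open>ga\<close> is \<open>g 0\<close> plus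
  \<open>de / (ga - al)\<close> times \<open>u\<close>.\<close>

lemma remove_de:
  assumes "L4_leibniz_frame B m u w g x al ga de c (\<lambda>_. 0) fu fv su sv ta ze" and "al \<noteq> ga"
  obtains g' p where "L4_leibniz_frame B m u w g' x al ga 0 c (\<lambda>_. 0) fu (fv + p * fu) su (sv + p * su) ta ze"
proof -
  interpret L4_leibniz_frame B m u w g x al ga de c "\<lambda>_. 0" fu fv su sv ta ze by fact
  show ?thesis
    using de_zero
  proof
    assume "m = 2"
    then have "L4_leibniz_frame B m u w (g(0 := g 0 + (de / (ga - al)) \<odot> u)) x al ga
      (de + de / (ga - al) * (al - ga)) c (\<lambda>_. 0) fu (fv + de / (ga - al) * fu) su (sv + de / (ga - al) * su) ta ze"
      using add_u[of "de / (ga - al)"] by simp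
    moreover have "de + de / (ga - al) * (al - ga) = 0"
    proof -
      have "de / (ga - al) * (al - ga) = - (de / (ga - al) * (ga - al))"
        by (simp only: mult_minus_right[symmetric] minus_diff_eq)
      also have "\<dots> = - de" using assms(2) by simp
      finally show ?thesis by simp
    qed
    ultimately show ?thesis using that by metis
  next
    assume "de = 0"
    then show ?thesis using that[of g 0] L4_leibniz_frame_axioms by simp
  qed
qed

text \<open>
  Multiples of \<open>w\<close> added to \<open>u\<close> and \<open>g 0\<close> annihilate \<open>su\<close> and \<open>sv\<close>; the relations imposed by the Leibniz
  identity then leave no room for \<open>fu\<close> and \<open>fv\<close>.
\<close>

lemma remove_central:
  assumes "L4_leibniz_frame B m u w g x al ga de c d fu fv su sv ta ze" and ga: "ga \<noteq> 0"
  obtains u' g' x' where "L4_leibniz_frame B m u' w g' x' al ga de c d 0 0 0 0 ta z0"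
proof -
  interpret L4_leibniz_frame B m u w g x al ga de c d fu fv su sv ta ze by fact
  obtain u' g' fu' fv' where 1: "L4_leibniz_frame B m u' w g' x al ga de c d fu' fv' 0 0 ta ze"
    using add_w[where p = "- su / (2 * ga)" and q = "- sv / (2 * ga)"] ga by auto
  interpret F1: L4_leibniz_frame B m u' w g' x al ga de c d fu' fv' 0 0 ta ze by fact
  have "fu' = 0" "fv' = 0" using F1.su_relation F1.sv_relation ga by auto
  moreover have "(\<lambda>i. if i = 0 then c 0 - 0 else c i) = c" by auto
  \<comment> \<open>Adding \<open>q\<close> times \<open>w\<close> to \<open>x\<close> changes the
    coefficient of \<open>w\<close> in \<open>[x, x]\<close> by \<open>2 * ga * q\<close>, so every
    value \<open>z0\<close> is attained; family (ii) with \<open>n = 4\<close> requires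
    \<open>z0 = 1\<close>.\<close>
  ultimately show ?thesis
    using that F1.translate_x[of "\<lambda>_. 0" 0 "(z0 - ze) / (2 * ga)"] ga by (simp add: F1.G_zero)
qed

section \<open>The case distinction on the eigenvalues \<open>al\<close> and
  \<open>ga\<close>\<close>

locale extension_algebra =
  fixes M :: "cvec calg" and m n :: nat
  assumes carr_M: "carr M = coords (m + 3)" and scal_M: "scal M = cscale" and n: "n = m + 2" "2 \<le> m"
begin

abbreviation is_frame where "is_frame \<equiv> L4_leibniz_frame (brk M) m"

lemma iso_L4_ext:
  assumes "is_frame u w g x al ga de c d fu fv su sv ta ze"
    and "L4_ext_brackets (brk A) m u' w' g' x' al ga de c d fu fv su sv ta ze"
    and "\<exists>r l s. A = L4_ext n r l s"
  shows "M \<cong>\<^sub>a A"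
proof -
  interpret L4_leibniz_frame "brk M" m u w g x al ga de c d fu fv su sv ta ze by fact
  have "carr A = coords (m + 3)" "scal A = cscale"
    using assms(3) n carr_L4_ext by (auto simp: eval_nat_numeral)
  then show ?thesis
    using ext_frames_iso[OF L4_ext_brackets_axioms assms(2)] carr_M scal_M by blast
qed

abbreviation listed :: bool where "listed \<equiv> \<exists>A \<in> listed_algs n. M \<cong>\<^sub>a A"

lemma listed_mem:
  "alg1 n a \<in> listed_algs n" "alg2 n \<in> listed_algs n"
  "\<epsilon> \<in> {0, 1} \<Longrightarrow> alg3 n \<epsilon> b \<in> listed_algs n"
  "\<epsilon> \<in> {0, 1} \<Longrightarrow> (\<epsilon> = 0 \<longrightarrow> (r, s) \<noteq> (0, 0)) \<Longrightarrow> alg4 n \<epsilon> r s \<in> listed_algs n"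
  "n = 4 \<Longrightarrow> (r = - 1 \<longrightarrow> a \<noteq> 1) \<Longrightarrow> alg5 a r \<in> listed_algs n"
  unfolding listed_algs_def by (blast, blast, blast, blast, simp, blast)

lemma listed1:
  assumes "is_frame u w g x (- 1) ga 0 (\<lambda>_. 0) (\<lambda>_. 0) 0 0 0 0 0 0"
  shows listed
proof -
  have "M \<cong>\<^sub>a alg1 n (- ga)"
    using iso_L4_ext[OF assms _ is_L4_ext(1)] alg1_frame[OF n, of "- ga"] by simp
  then show ?thesis using listed_mem(1) by blast
qed

text \<open>All of \<open>c\<close>, \<open>d\<close>, \<open>de\<close> and the central parameters
  can be removed, so only \<open>ga\<close> and \<open>ta\<close> remain. A nonzero
  \<open>ta\<close> forces the eigenvalue \<open>ga - (m - 1)\<close> on \<open>g (m - 1)\<close> to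
  be zero, whence family (ii); otherwise family (i) results.\<close>

lemma case_diagonal:
  assumes F: "is_frame u w g x (- 1) ga de c d fu fv su sv ta ze" and ga: "ga \<noteq> 0"
    and de: "de = 0 \<or> ga \<noteq> - 1"
  shows listed
proof -
  obtain x1 fv1 sv1 ze1 where F1: "is_frame u w g x1 (- 1) ga de c (\<lambda>_. 0) fu fv1 su sv1 ta ze1"
    using remove_d[OF F] by blast
  \<comment> \<open>The reductions common to both cases, for any coefficient \<open>t\<close> of
    \<open>g (m - 1)\<close> and any target \<open>z0\<close> for that of \<open>w\<close> in
    \<open>[x, x]\<close>.\<close>
  have step: "\<exists>u' g' x'. is_frame u' w' g' x' (- 1) ga 0 (\<lambda>_. 0) (\<lambda>_. 0) 0 0 0 0 t z0"
    if H: "is_frame u' w' g' x1 (- 1) ga de c' (\<lambda>_. 0) fu' fv' su' sv' t ze'" and D: "de = 0 \<or> ga \<noteq> -1"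
    for u' w' g' de c' fu' fv' su' sv' t ze' z0
  proof -
    obtain u2 g2 x2 where F2: "is_frame u2 w' g2 x2 (- 1) ga de c' (\<lambda>_. 0) 0 0 0 0 t z0"
      using remove_central[OF H ga] by blast
    have "\<exists>g3. is_frame u2 w' g3 x2 (- 1) ga 0 c' (\<lambda>_. 0) 0 0 0 0 t z0"
    proof (cases "de = 0")
      case False
      then have "- 1 \<noteq> ga" using D by auto
      from remove_de[OF F2 this] obtain g3 p where
        "is_frame u2 w' g3 x2 (- 1) ga 0 c' (\<lambda>_. 0) 0 (0 + p * 0) 0 (0 + p * 0) t z0" by blast
      then show ?thesis by auto
    qed (use F2 in blast)
    then obtain g3 where F3: "is_frame u2 w' g3 x2 (- 1) ga 0 c' (\<lambda>_. 0) 0 0 0 0 t z0" by blast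
    have "- 1 \<noteq> (0::complex)" by simp
    from remove_c[OF F3 this] show ?thesis by blast
  qed
  show ?thesis
  proof (cases "ta = 0")
    case True
    then show ?thesis using step[OF F1 de, of 0] listed1 by blast
  next
    case False
    interpret F1: L4_leibniz_frame "brk M" m u w g x1 "- 1" ga de c "\<lambda>_. 0" fu fv1 su sv1 ta ze1 by fact
    have "ga = of_nat (m - 1)" using F1.ta_relation False by simp
    also have "\<dots> = of_nat n - 3" using n by (simp add: of_nat_diff)
    finally have gan: "ga = of_nat n - 3" .
    have "de * ta = 0 \<or> ga \<noteq> -1" using de by auto
    moreover have "is_frame u ((ta * ta) \<odot> w) (\<lambda>i. ta \<odot> g i) x1 (- 1) ga (de * ta)
        c (\<lambda>_. 0) (fu / (ta * ta)) (fv1 / ta) (su / (ta * ta)) (sv1 / ta) 1 (ze1 / (ta * ta))"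
      using F1.rescale[of 1 ta] False by simp
    ultimately obtain u' g' x' where
      "is_frame u' ((ta * ta) \<odot> w) g' x' (- 1) ga 0 (\<lambda>_. 0) (\<lambda>_. 0) 0 0 0 0 1 (if n = 4 then 1 else 0)"
      using step by blast
    then have "M \<cong>\<^sub>a alg2 n" unfolding gan using iso_L4_ext[OF _ alg2_frame[OF n] is_L4_ext(2)] by blast
    then show ?thesis using listed_mem(2) by blast
  qed
qed

text \<open>With \<open>al = 0\<close> the operator of \<open>triangular_solution\<close> is not
  invertible and the tail \<open>c\<close> survives, except for \<open>c 0\<close>, which a
  translation of \<open>x\<close> by a multiple of \<open>u\<close> removes. The eigenvalue of
  \<open>x\<close> on \<open>g (m - 1)\<close> is \<open>- 1\<close>, hence
  \<open>ta = 0\<close>.\<close>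

lemma case_al_zero:
  assumes F: "is_frame u w g x 0 (- 1) de c d fu fv su sv ta ze"
  shows listed
proof -
  have neg_one: "- 1 \<noteq> (0::complex)" by simp
  obtain x1 fv1 sv1 ze1 where F1: "is_frame u w g x1 0 (- 1) de c (\<lambda>_. 0) fu fv1 su sv1 ta ze1"
    using remove_d[OF F] by blast
  obtain u2 g2 x2 where F2: "is_frame u2 w g2 x2 0 (- 1) de c (\<lambda>_. 0) 0 0 0 0 ta 0"
    using remove_central[OF F1 neg_one] by blast
  obtain g3 p where "is_frame u2 w g3 x2 0 (- 1) 0 c (\<lambda>_. 0) 0 (0 + p * 0) 0 (0 + p * 0) ta 0"
    using remove_de[OF F2 neg_one[symmetric]] by blast
  then have F3: "is_frame u2 w g3 x2 0 (- 1) 0 c (\<lambda>_. 0) 0 0 0 0 ta 0" by simp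
  interpret F3: L4_leibniz_frame "brk M" m u2 w g3 x2 0 "- 1" 0 c "\<lambda>_. 0" 0 0 0 0 ta 0 by fact
  have "ta = 0" using F3.ta_relation by simp
  define c1 where "c1 = (\<lambda>i. if i = 0 then 0 else c i)"
  have "(\<lambda>i. if i = 0 then c 0 - c 0 else c i) = c1" by (auto simp: c1_def)
  then have "is_frame u2 w g3 (x2 + (F3.G (\<lambda>_. 0) 0 + c 0 \<odot> u2 + 0 \<odot> w)) 0 (- 1) 0 c1 (\<lambda>_. 0) 0 0 0 0 0 0"
    using F3.translate_x[of "\<lambda>_. 0" "c 0" 0] \<open>ta = 0\<close> by simp
  then obtain x4 where F4: "is_frame u2 w g3 x4 0 (- 1) 0 c1 (\<lambda>_. 0) 0 0 0 0 0 0" by blast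
  interpret F4: L4_leibniz_frame "brk M" m u2 w g3 x4 0 "- 1" 0 c1 "\<lambda>_. 0" 0 0 0 0 0 0 by fact
  \<comment> \<open>Scaling \<open>u\<close> by \<open>k\<close> divides \<open>c1 1\<close> by
    \<open>k^2\<close>, so \<open>k^2 = - c1 1\<close> turns it into \<open>- 1\<close>, the entry
    \<open>- \<epsilon>\<close> of \<open>alg3_coeff\<close>.\<close>
  define k where "k = (if c1 1 = 0 then 1 else csqrt (- c1 1))"
  have k: "k \<noteq> 0" by (simp add: k_def)
  define \<epsilon> where "\<epsilon> = (if c1 1 = 0 then 0 else (1::complex))"
  define b where "b = (\<lambda>i. - c1 (Suc i) / k ^ Suc (Suc i))"
  have c2: "(\<lambda>i. c1 i / k ^ Suc i) = alg3_coeff \<epsilon> b"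
  proof
    fix i
    have "c1 1 / k ^ 2 = - \<epsilon>" by (simp add: k_def \<epsilon>_def)
    then show "c1 i / k ^ Suc i = alg3_coeff \<epsilon> b i"
      by (cases i) (auto simp: alg3_coeff_def b_def c1_def numeral_2_eq_2)
  qed
  have "is_frame (k \<odot> u2) w (\<lambda>i. k ^ i \<odot> g3 i) x4 0 (- 1) 0 (alg3_coeff \<epsilon> b) (\<lambda>_. 0) 0 0 0 0 0 0"
    using F4.rescale[OF k one_neq_zero] unfolding c2 by simp
  then obtain u5 w5 g5 where F5: "is_frame u5 w5 g5 x4 0 (- 1) 0 (alg3_coeff \<epsilon> b) (\<lambda>_. 0) 0 0 0 0 0 0"
    by blast
  interpret F5: L4_leibniz_frame "brk M" m u5 w5 g5 x4 0 "- 1" 0 "alg3_coeff \<epsilon> b" "\<lambda>_. 0" 0 0 0 0 0 0 by fact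
  \<comment> \<open>A last translation produces the \<open>d\<close> with which family (iii) is
    written, the negative of \<open>c\<close>; as its entry 0 is zero, \<open>fv\<close> and
    \<open>sv\<close> stay zero.\<close>
  have "(\<lambda>i. if i = 0 then alg3_coeff \<epsilon> b 0 - 0 else alg3_coeff \<epsilon> b i) = alg3_coeff \<epsilon> b" by auto
  moreover have "alg3_coeff \<epsilon> b 0 = 0" by (simp add: alg3_coeff_def)
  ultimately have "is_frame u5 w5 g5 (x4 + (F5.G (\<lambda>k. - alg3_coeff \<epsilon> b k) 0 + 0 \<odot> u5 + 0 \<odot> w5)) 0 (- 1) 0
      (alg3_coeff \<epsilon> b) (\<lambda>k. - alg3_coeff \<epsilon> b k) 0 0 0 0 0 0"
    using F5.translate_x[of "\<lambda>k. - alg3_coeff \<epsilon> b k" 0 0] by simp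
  then have "M \<cong>\<^sub>a alg3 n \<epsilon> b" using iso_L4_ext[OF _ alg3_frame[OF n] is_L4_ext(3)] by blast
  moreover have "\<epsilon> \<in> {0, 1}" by (simp add: \<epsilon>_def)
  ultimately show ?thesis using listed_mem(3) by blast
qed

text \<open>Here \<open>m = 2\<close> by \<open>de_zero\<close>, and \<open>ta = 0\<close> because
  \<open>x\<close> has eigenvalue \<open>2 * ga\<close> on \<open>g 1\<close>. Scaling
  \<open>u\<close> by \<open>- de\<close> gives \<open>de = - 1\<close> as in family (v).\<close>

lemma case_jordan:
  assumes F: "is_frame u w g x ga ga de c d fu fv su sv ta ze" and ga: "ga \<noteq> 0" and de: "de \<noteq> 0"
  shows listed
proof -
  obtain x1 fv1 sv1 ze1 where F1: "is_frame u w g x1 ga ga de c (\<lambda>_. 0) fu fv1 su sv1 ta ze1"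
    using remove_d[OF F] by blast
  obtain u2 g2 x2 where F2: "is_frame u2 w g2 x2 ga ga de c (\<lambda>_. 0) 0 0 0 0 ta 0"
    using remove_central[OF F1 ga] by blast
  obtain g3 where F3: "is_frame u2 w g3 x2 ga ga de (\<lambda>_. 0) (\<lambda>_. 0) 0 0 0 0 ta 0"
    using remove_c[OF F2 ga] by blast
  interpret F3: L4_leibniz_frame "brk M" m u2 w g3 x2 ga ga de "\<lambda>_. 0" "\<lambda>_. 0" 0 0 0 0 ta 0 by fact
  have m: "m = 2" using F3.de_zero de by blast
  then have "ta = 0" using F3.ta_relation ga by simp
  then have "is_frame (- de \<odot> u2) w (\<lambda>i. (- de) ^ i \<odot> g3 i) x2 ga ga (- 1) (\<lambda>_. 0) (\<lambda>_. 0) 0 0 0 0 0 0"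
    using F3.rescale[of "- de" 1] de by simp
  then obtain u4 w4 g4 where F4: "is_frame u4 w4 g4 x2 ga ga (- 1) (\<lambda>_. 0) (\<lambda>_. 0) 0 0 0 0 0 0"
    by blast
  have "M \<cong>\<^sub>a alg5 (1 - ga) (- ga - 1)"
    using iso_L4_ext[OF F4, of "alg5 (1 - ga) (- ga - 1)"] alg5_frame[of "1 - ga" "- ga - 1"]
      is_L4_ext(5)[of "1 - ga" "- ga - 1"] m n
    by simp
  moreover have "alg5 (1 - ga) (- ga - 1) \<in> listed_algs n"
    using n m ga by (intro listed_mem(5)) auto
  ultimately show ?thesis by blast
qed

text \<open>Now \<open>x\<close> annihilates \<open>w\<close>, so not all central parameters can be
  removed: \<open>fu\<close> is set freely by adding a multiple of \<open>w\<close> to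
  \<open>u\<close>, while \<open>fv\<close>, \<open>sv\<close> and the coefficient of
  \<open>w\<close> in \<open>[x, x]\<close> survive up to scaling and give family (iv).\<close>

lemma case_ga_zero:
  assumes F: "is_frame u w g x (- 1) 0 de c d fu fv su sv ta ze"
  shows listed
proof -
  have neg_one: "- 1 \<noteq> (0::complex)" by simp
  obtain x1 fv1 sv1 ze1 where F1: "is_frame u w g x1 (- 1) 0 de c (\<lambda>_. 0) fu fv1 su sv1 ta ze1"
    using remove_d[OF F] by blast
  obtain g2 p where F2: "is_frame u w g2 x1 (- 1) 0 0 c (\<lambda>_. 0) fu (fv1 + p * fu) su (sv1 + p * su) ta ze1"
    using remove_de[OF F1 neg_one] by blast
  obtain g3 where F3: "is_frame u w g3 x1 (- 1) 0 0 (\<lambda>_. 0) (\<lambda>_. 0) fu (fv1 + p * fu) su (sv1 + p * su) ta ze1"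
    using remove_c[OF F2 neg_one] by blast
  interpret F3: L4_leibniz_frame "brk M" m u w g3 x1 "- 1" 0 0 "\<lambda>_. 0" "\<lambda>_. 0" fu "fv1 + p * fu" su "sv1 + p * su" ta ze1 by fact
  have z: "ta = 0" "su = 0" using F3.ta_relation F3.su_relation n by auto
  \<comment> \<open>Scaling \<open>g 0\<close> by \<open>h\<close> divides \<open>ze1\<close> by
    \<open>h^2\<close>, which normalises it to 0 or 1.\<close>
  define h where "h = (if ze1 = 0 then 1 else csqrt ze1)"
  define \<epsilon> where "\<epsilon> = (if ze1 = 0 then 0 else (1::complex))"
  have h: "h \<noteq> 0" "ze1 / (h * h) = \<epsilon>"
    using power2_csqrt[of ze1] by (auto simp: h_def \<epsilon>_def power2_eq_square)
  have "is_frame u ((h * h) \<odot> w) (\<lambda>i. h \<odot> g3 i) x1 (- 1) 0 0 (\<lambda>_. 0) (\<lambda>_. 0)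
      (fu / (h * h)) ((fv1 + p * fu) / h) 0 ((sv1 + p * su) / h) 0 \<epsilon>"
    using F3.rescale[of 1 h] h z by simp
  then obtain u4 w4 g4 fu4 fv4 sv4 where
    F4: "is_frame u4 w4 g4 x1 (- 1) 0 0 (\<lambda>_. 0) (\<lambda>_. 0) fu4 fv4 0 sv4 0 \<epsilon>"
    by blast
  interpret F4: L4_leibniz_frame "brk M" m u4 w4 g4 x1 "- 1" 0 0 "\<lambda>_. 0" "\<lambda>_. 0" fu4 fv4 0 sv4 0 \<epsilon> by fact
  \<comment> \<open>In family (iv) \<open>sv = fv + fu\<close>; \<open>f\<close> is the value to
    which \<open>fu\<close> has to be moved.\<close>
  define f where "f = sv4 - fv4"
  have "is_frame (u4 + (f - fu4) \<odot> w4) w4 (g4(0 := g4 0 + 0 \<odot> w4)) x1 (- 1) 0 0 (\<lambda>_. 0) (\<lambda>_. 0) f fv4 0 (fv4 + f) 0 \<epsilon>"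
    using F4.add_w[where p = "f - fu4" and q = 0] by (simp add: f_def)
  then obtain u5 g5 where F5: "is_frame u5 w4 g5 x1 (- 1) 0 0 (\<lambda>_. 0) (\<lambda>_. 0) f fv4 0 (fv4 + f) 0 \<epsilon>"
    by blast
  show ?thesis
  proof (cases "\<epsilon> = 0 \<and> fv4 = 0 \<and> f = 0")
    \<comment> \<open>If all three parameters vanish, the algebra is the member of family (i) with
      \<open>a = 0\<close>.\<close>
    case True
    then show ?thesis using listed1[of u5 w4 g5 x1 0] F5 by simp
  next
    case False
    have "M \<cong>\<^sub>a alg4 n \<epsilon> fv4 f"
      using iso_L4_ext[OF F5 alg4_frame[OF n] is_L4_ext(4)] .
    moreover have "\<epsilon> \<in> {0, 1}" by (simp add: \<epsilon>_def)
    then have "alg4 n \<epsilon> fv4 f \<in> listed_algs n" using False by (intro listed_mem(4)) auto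
    ultimately show ?thesis by blast
  qed
qed

theorem classification:
  assumes F: "is_frame u w g x al ga de c d fu fv su sv ta ze" and nz: "al \<noteq> 0 \<or> ga \<noteq> 0"
  shows listed
proof -
  interpret L4_leibniz_frame "brk M" m u w g x al ga de c d fu fv su sv ta ze by fact
  consider "al = 0" "ga \<noteq> 0" | "al \<noteq> 0" "ga = 0" | "al \<noteq> 0" "ga \<noteq> 0" "de = 0 \<or> ga \<noteq> al"
    | "al \<noteq> 0" "ga = al" "de \<noteq> 0"
    using nz by blast
  then show ?thesis
  proof cases
    case 1
    then show ?thesis using scale_x[of "- 1 / ga"] case_al_zero by simp
  next
    case 2
    then show ?thesis using scale_x[of "- 1 / al"] case_ga_zero by simp
  next
    case 3
    then have "- 1 / al * ga \<noteq> 0" "- 1 / al * de = 0 \<or> - 1 / al * ga \<noteq> - 1"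
      by (auto simp: field_simps)
    moreover have "- 1 / al * al = - 1" "- 1 / al \<noteq> 0" using 3 by auto
    ultimately show ?thesis using scale_x[of "- 1 / al"] case_diagonal by metis
  next
    case 4
    then show ?thesis using case_jordan F by blast
  qed
qed

end

section \<open>Existence of a frame\<close>

locale L4_extension = L4_frame_algebra +
  assumes leib: "B (B p q) r = B p (B q r) - B q (B p r)"
    and xN: "y \<in> coords (m + 2) \<Longrightarrow> B x y \<in> coords (m + 2)"
    and Nx: "y \<in> coords (m + 2) \<Longrightarrow> B y x \<in> coords (m + 2)"
    and xx_coords: "B x x \<in> coords (m + 3)"
    and not_nilpotent: "\<not> nilpotent_alg A"
begin

lemma square_annihilates: "B (B p q + B q p) r = 0"
  by (simp add: add_left leib)

text \<open>Bracketing \<open>y\<close> with \<open>u\<close> shows that all \<open>p k\<close> with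
  \<open>k < m - 1\<close> vanish, and bracketing with \<open>g 0\<close> then gives
  \<open>a = 0\<close>. By \<open>square_annihilates\<close> this applies to symmetric
  brackets.\<close>

lemma left_annihilator:
  assumes "y \<in> N" "\<And>r. B y r = 0"
  obtains s t where "y = s \<odot> w + t \<odot> g (m - 1)"
proof -
  obtain a b p where y: "y = a \<odot> u + b \<odot> w + G p 0" using assms(1) by (rule coords_N_expand)
  define p' where "p' = (\<lambda>k. if k = 0 then 0 else p (k - 1))"
  have "B y u = G p (Suc 0)" by (simp add: y bilin uu wu Gu)
  moreover have "G p' 0 = G p (Suc 0)" by (subst G_split) (simp add: p'_def)
  ultimately have "0 \<odot> u + 0 \<odot> w + G p' 0 = 0" using assms(2) by simp
  from N_indep(3)[OF this] have p': "p' k = 0" if "k < m" for k using that .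
  have p: "p k = 0" if "k < m - 1" for k
    using p'[of "Suc k"] that by (simp add: p'_def)
  then have G: "G p 0 = p (m - 1) \<odot> g (m - 1)" using G_lead[of "m - 1" p] m_ge by simp
  have "B y (g 0) = - (a \<odot> g 1)" using m_ge by (simp add: y G bilin ug wg gg)
  then have "a = 0" using assms(2) g_nonzero[of 1] m_ge by simp
  then show ?thesis using that y G by simp
qed

lemma central: "B (s \<odot> w + t \<odot> g (m - 1)) u = 0" "B u (s \<odot> w + t \<odot> g (m - 1)) = 0"
    "B (g i) (s \<odot> w + t \<odot> g (m - 1)) = 0"
proof -
  have "g (Suc (m - 1)) = 0" "m - 1 \<noteq> 0" using m_ge by (auto intro: g_zero)
  then show "B (s \<odot> w + t \<odot> g (m - 1)) u = 0" "B u (s \<odot> w + t \<odot> g (m - 1)) = 0"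
    "B (g i) (s \<odot> w + t \<odot> g (m - 1)) = 0"
    by (simp_all add: bilin uw wu gu ug gg gw)
qed

text \<open>The point is that \<open>[x, u]\<close> has no component along \<open>g 0\<close>: the
  derivation applied to \<open>[g 0, u] + [u, g 0] = 0\<close> yields twice this component times
  \<open>w\<close>.\<close>

lemma x_bracket_expansions:
  obtains al ga de c d fu fv where
    "B x u = al \<odot> u + G d 1 + fu \<odot> w" "B x (g 0) = ga \<odot> g 0 + de \<odot> u + G c 1 + fv \<odot> w"
proof -
  obtain al b1 p1 where 1: "B x u = al \<odot> u + b1 \<odot> w + G p1 0"
    using coords_N_expand[OF xN[OF u_coords]] by blast
  obtain de b2 p2 where 2: "B x (g 0) = de \<odot> u + b2 \<odot> w + G p2 0"
    using coords_N_expand[OF xN[OF g_coords]] by blast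
  define d c where "d = (\<lambda>k. p1 (Suc k))" and "c = (\<lambda>k. p2 (Suc k))"
  have xu: "B x u = al \<odot> u + p1 0 \<odot> g 0 + G d (Suc 0) + b1 \<odot> w"
    unfolding 1 d_def by (subst G_split) (simp add: algebra_simps)
  have xg0: "B x (g 0) = p2 0 \<odot> g 0 + de \<odot> u + G c (Suc 0) + b2 \<odot> w"
    unfolding 2 c_def by (subst G_split) (simp add: algebra_simps)
  have der: "B x (B p q) = B (B x p) q + B p (B x q)" for p q
    using leib[of x p q] by simp
  have "B x (B (g 0) u + B u (g 0)) = 0" by (simp add: gu ug zero_right)
  then have "B (B x (g 0)) u + B (g 0) (B x u) + (B (B x u) (g 0) + B u (B x (g 0))) = 0"
    by (simp add: add_right der)
  moreover have "B (B x (g 0)) u + B (g 0) (B x u) + (B (B x u) (g 0) + B u (B x (g 0))) = (2 * p1 0) \<odot> w"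
    unfolding xu xg0
    by (simp add: bilin uu uw wu gu ug gg gw wg Gu uG gG Gg)
      (simp add: fun_eq_iff pointwise algebra_simps)
  ultimately have "p1 0 = 0" using w_nonzero by simp
  then show ?thesis using that[of al d b1 "p2 0" de c b2] xu xg0 by simp
qed

text \<open>
  The components \<open>tu\<close>, \<open>tv\<close> of the symmetric brackets along \<open>g (m - 1)\<close> vanish: otherwise the eigenvalue
  \<open>nu\<close> of \<open>x\<close> on \<open>g (m - 1)\<close> and one of \<open>al\<close>, \<open>ga\<close> would be zero, hence both.
\<close>

lemma exists_frame:
  "\<exists>al ga de c d fu fv su sv ta ze.
    L4_leibniz_frame B m u w g x al ga de c d fu fv su sv ta ze \<and> (al \<noteq> 0 \<or> ga \<noteq> 0)"
proof -
  obtain al ga de c d fu fv where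
    xu: "B x u = al \<odot> u + G d 1 + fu \<odot> w" and xg0: "B x (g 0) = ga \<odot> g 0 + de \<odot> u + G c 1 + fv \<odot> w"
    by (rule x_bracket_expansions)
  interpret left: L4_left_frame B m u w g x al ga de c d fu fv
    by unfold_locales (rule xu xg0 leib)+
  define z where "z = B x x"
  have zr: "B z r = 0" for r using square_annihilates[of x x r] by (simp add: z_def add_left leib)
  \<comment> \<open>The vector \<open>z = k x + y\<close> annihilates from the left. The component
    of \<open>[z, x]\<close> along \<open>x\<close> is \<open>k\<close> times that of
    \<open>z\<close>, hence \<open>k = 0\<close>.\<close>
  have "z \<in> N"
  proof -
    define k where "k = z (m + 3) / x (m + 3)"
    obtain y where y: "y \<in> N" "z = k \<odot> x + y"
      using coords_expand_x[OF xx_coords[folded z_def]] unfolding k_def by blast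
    have "B z x = k \<odot> z + B y x" by (subst y(2)) (simp add: bilin z_def)
    moreover have "(B y x) (m + 3) = 0" "y (m + 3) = 0"
      using Nx[OF y(1)] y(1) by (simp_all add: coords_def)
    ultimately have "k * z (m + 3) = 0"
      using zr[of x] by (metis add.right_neutral cscale_apply plus_fun_apply zero_fun_apply)
    then have "k = 0" using x_outside by (auto simp: k_def)
    then show ?thesis using y by simp
  qed
  then obtain ze ta where z: "z = ze \<odot> w + ta \<odot> g (m - 1)" using left_annihilator[OF _ zr] by blast
  have "\<exists>s t. B x y + B y x = s \<odot> w + t \<odot> g (m - 1)" if "y \<in> N" for y
    using left_annihilator[OF cv.subspace_add[OF subspace_coords xN[OF that] Nx[OF that]] square_annihilates]
    by blast
  then obtain su tu sv tv where su: "B x u + B u x = su \<odot> w + tu \<odot> g (m - 1)"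
    and sv: "B x (g 0) + B (g 0) x = sv \<odot> w + tv \<odot> g (m - 1)"
    using u_coords g_coords by meson
  have gx: "B (g (Suc i)) x = - B x (g (Suc i))" for i
    by (rule left.g_x) (simp_all add: su sv central del: One_nat_def)
  have Gx: "B (G p (Suc i)) x = - B x (G p (Suc i))" for p i
    by (simp add: gsum_def bilin gx sum_negf)
  show ?thesis
  proof (cases "al = 0 \<and> ga = 0")
    case True
    \<comment> \<open>If both eigenvalues vanish, the lower central series of the whole algebra
      descends through \<open>N\<close>, \<open>W\<close>, \<open>K\<close>, \<open>H 2\<close>,
      \<open>H 3\<close> and so on; \<open>W\<close> takes up the component of
      \<open>[x, g 0]\<close> along \<open>u\<close>.\<close>
    define W where "W = {a \<odot> u + k | a k. k \<in> K}"
    have W: "cv.subspace W"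
    proof (rule cv.subspaceI)
      show "0 \<in> W" unfolding W_def using cv.subspace_0[OF subspace_K]
        by (auto intro!: exI[of _ "0::complex"])
    next
      fix y y' assume "y \<in> W" "y' \<in> W"
      then obtain a k a' k' where "y = a \<odot> u + k" "y' = a' \<odot> u + k'" "k \<in> K" "k' \<in> K"
        by (auto simp: W_def)
      then have "y + y' = (a + a') \<odot> u + (k + k')" "k + k' \<in> K"
        using cv.subspace_add[OF subspace_K] by (auto simp: algebra_simps)
      then show "y + y' \<in> W" unfolding W_def by blast
    next
      fix r y assume "y \<in> W"
      then obtain a k where "y = a \<odot> u + k" "k \<in> K" by (auto simp: W_def)
      then have "r \<odot> y = (r * a) \<odot> u + r \<odot> k" "r \<odot> k \<in> K"
        using cv.subspace_scale[OF subspace_K] by (auto simp: algebra_simps)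
      then show "r \<odot> y \<in> W" unfolding W_def by blast
    qed
    have uW: "u \<in> W" unfolding W_def using cv.subspace_0[OF subspace_K]
      by (auto intro!: exI[of _ "1::complex"])
    have KW: "K \<subseteq> W" unfolding W_def
      by (auto intro!: exI[of _ "0::complex"])
    have xG: "B x (G q (Suc j)) \<in> H (Suc (Suc j))" for q j
    proof -
      have "B x (G q (Suc j)) = (\<Sum>k<m. q k \<odot> G c (Suc (Suc (k + j))))"
        using True left.x_g by (simp add: gsum_def[of m g q] bilin)
      also have "\<dots> \<in> H (Suc (Suc j))"
        by (intro cv.subspace_sum[OF subspace_H] cv.subspace_scale[OF subspace_H] G_H) simp
      finally show ?thesis .
    qed
    have H_mono: "H (Suc j) \<subseteq> H j" for j using G_H[of j "Suc j"] by (auto simp: H_def[of "Suc j"])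
    have xw: "B x w = 0" using left.x_w True by simp
    have xK: "B x k \<in> H 2" if k: "k \<in> K" for k
    proof -
      obtain b q where "k = b \<odot> w + G q (Suc 0)" using k by (auto simp: K_def)
      then show ?thesis using xG[of q 0] by (simp add: bilin xw numeral_2_eq_2)
    qed
    have H2K: "H 2 \<subseteq> K" using H_mono[of 1] H_K by (simp add: numeral_2_eq_2)
    \<comment> \<open>A bracket with an arbitrary left factor reduces to the left factors
      \<open>x\<close> and \<open>v\<close> in \<open>N\<close>.\<close>
    have split: "B y y' \<in> T"
      if T: "cv.subspace T" and y: "y \<in> coords (m + 3)" and y': "B x y' \<in> T" "\<And>v. v \<in> N \<Longrightarrow> B v y' \<in> T"
      for T y y'
    proof -
      obtain v where v: "v \<in> N" "y = (y (m + 3) / x (m + 3)) \<odot> x + v"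
        using coords_expand_x[OF y] by blast
      have "B ((y (m + 3) / x (m + 3)) \<odot> x + v) y' \<in> T"
        unfolding bilin by (intro cv.subspace_add[OF T] cv.subspace_scale[OF T] y' v(1))
      then show ?thesis using v(2) by simp
    qed
    have B1: "B y y' \<in> N" if yc: "y \<in> coords (m + 3)" "y' \<in> coords (m + 3)" for y y'
    proof (rule split[OF subspace_coords yc(1)])
      obtain v where v: "v \<in> N" "y' = (y' (m + 3) / x (m + 3)) \<odot> x + v"
        using coords_expand_x[OF yc(2)] by blast
      have "B x ((y' (m + 3) / x (m + 3)) \<odot> x + v) \<in> N"
        unfolding bilin z_def[symmetric]
        by (intro cv.subspace_add cv.subspace_scale subspace_coords xN v(1) \<open>z \<in> N\<close>)
      then show "B x y' \<in> N" using v(2) by simp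
      fix n assume n: "n \<in> N"
      have "B n v \<in> N" using bracket_NN[OF n v(1)] K_coords by blast
      then have "B n ((y' (m + 3) / x (m + 3)) \<odot> x + v) \<in> N"
        unfolding bilin by (intro cv.subspace_add cv.subspace_scale subspace_coords Nx n)
      then show "B n y' \<in> N" using v(2) by simp
    qed
    have B2: "B y y' \<in> W" if y: "y \<in> coords (m + 3)" "y' \<in> N" for y y'
    proof (rule split[OF W y(1)])
      obtain a b p where y': "y' = a \<odot> u + b \<odot> w + G p 0" using y(2) by (rule coords_N_expand)
      have G0: "G p 0 = p 0 \<odot> g 0 + G (\<lambda>k. p (Suc k)) (Suc 0)" by (rule G_split)
      have "B x y' = a \<odot> B x u + p 0 \<odot> B x (g 0) + B x (G (\<lambda>k. p (Suc k)) (Suc 0))"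
        unfolding y' G0 by (simp add: bilin xw)
      moreover have "B x (G (\<lambda>k. p (Suc k)) (Suc 0)) \<in> W" using xK[OF G1_K] H2K KW by blast
      moreover have "B x u \<in> W" "B x (g 0) \<in> W"
        using True uW w_K G1_K KW by (auto simp: xu xg0 intro!: cv.subspace_add[OF W] cv.subspace_scale[OF W])
      ultimately show "B x y' \<in> W"
        using cv.subspace_add[OF W] cv.subspace_scale[OF W] by simp
      show "B n y' \<in> W" if "n \<in> N" for n using bracket_NN[OF that y(2)] KW by blast
    qed
    have WN: "W \<subseteq> N"
      unfolding W_def using K_coords u_coords by (auto intro!: cv.subspace_add cv.subspace_scale subspace_coords)
    have B3: "B y y' \<in> K" if y: "y \<in> coords (m + 3)" "y' \<in> W" for y y'
    proof (rule split[OF subspace_K y(1)])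
      obtain a k where y': "y' = a \<odot> u + k" "k \<in> K" using y(2) by (auto simp: W_def)
      have "B x k \<in> K" using xK[OF y'(2)] H2K by blast
      then show "B x y' \<in> K"
        using True w_K G1_K
        by (auto simp: y'(1) bilin xu intro!: cv.subspace_add[OF subspace_K] cv.subspace_scale[OF subspace_K])
      show "B n y' \<in> K" if "n \<in> N" for n using bracket_NN[OF that] y(2) WN by blast
    qed
    have B4: "B y y' \<in> H 2" if y: "y \<in> coords (m + 3)" "y' \<in> K" for y y'
      by (rule split[OF subspace_H y(1) xK[OF y(2)]])
        (use bracket_NH[of _ y' 1] y(2) in \<open>simp add: numeral_2_eq_2\<close>)
    have B5: "B y y' \<in> H (Suc j)" if y: "y \<in> coords (m + 3)" "y' \<in> H j" "j \<ge> 1" for y y' j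
    proof (rule split[OF subspace_H y(1)])
      obtain q where "y' = G q j" using y(2) by (auto simp: H_def)
      then show "B x y' \<in> H (Suc j)" using xG[of q "j - 1"] y(3) by simp
      show "B n y' \<in> H (Suc j)" if "n \<in> N" for n using bracket_NH[OF that, of y' j] y by blast
    qed
    have "lower_central_series A 1 \<subseteq> N"
      using bracket_span_subset[OF subspace_coords B1] by (simp add: carr_A)
    then have "lower_central_series A 2 \<subseteq> W"
      using bracket_span_subset[OF W, of "carr A" "lower_central_series A 1"] B2
      by (auto simp: carr_A numeral_2_eq_2)
    then have "lower_central_series A 3 \<subseteq> K"
      using bracket_span_subset[OF subspace_K, of "carr A" "lower_central_series A 2"] B3
      by (auto simp: carr_A numeral_3_eq_3 numeral_2_eq_2)
    then have "lower_central_series A 4 \<subseteq> H 2"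
      using bracket_span_subset[OF subspace_H, of "carr A" "lower_central_series A 3" 2] B4
      by (auto simp: carr_A eval_nat_numeral)
    then have "lower_central_series A (4 + j) \<subseteq> H (2 + j)" for j
    proof (induction j)
      case (Suc j)
      have "bracket_span A (carr A) (lower_central_series A (4 + j)) \<subseteq> H (Suc (2 + j))"
        by (rule bracket_span_subset[OF subspace_H]) (use B5[of _ _ "2 + j"] Suc carr_A in auto)
      then show "lower_central_series A (4 + Suc j) \<subseteq> H (2 + Suc j)"
        unfolding add_Suc_right lower_central_series.simps .
    qed simp
    from this[of m] have "lower_central_series A (4 + m) \<subseteq> {0}" by (auto simp: H_def G_ge)
    moreover have "0 \<in> lower_central_series A (4 + m)"
      using zero_bracket_span[of "carr A" "lower_central_series A (3 + m)"] by (simp add: eval_nat_numeral)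
    ultimately have "lower_central_series A (4 + m) = {0}" by blast
    then show ?thesis using not_nilpotent unfolding nilpotent_alg_def by blast
  next
    case False
    define Su Sv where "Su = su \<odot> w + tu \<odot> g (m - 1)" and "Sv = sv \<odot> w + tv \<odot> g (m - 1)"
    define nu where "nu = ga + of_nat (m - 1) * al"
    have m1: "m - 1 = Suc (m - 2)" using m_ge by simp
    have xl: "B x (g (m - 1)) = nu \<odot> g (m - 1)"
      unfolding nu_def m1 using left.x_g[of "m - 2"] G_ge[of "Suc (Suc (m - 2))"] by simp
    have lx: "B (g (m - 1)) x = - (nu \<odot> g (m - 1))" using gx[of "m - 2"] xl m1 by simp
    have ux: "B u x = Su - B x u" using su by (simp add: Su_def algebra_simps)
    have g0x: "B (g 0) x = Sv - B x (g 0)" using sv by (simp add: Sv_def algebra_simps)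
    \<comment> \<open>The Leibniz identity for \<open>(x, u, x)\<close>, where
      \<open>[u, [x, x]] = 0\<close>: after substituting \<open>[u, x] = Su - [x, u]\<close>, only
      terms in \<open>Su\<close> and \<open>w\<close> remain. \<open>Sv\<close> is treated
      alike.\<close>
    have Su: "B x Su = al \<odot> Su + (2 * ga * fu) \<odot> w"
    proof -
      have "B (B x u) x = B (al \<odot> u + G d 1 + fu \<odot> w) x" by (simp only: xu)
      also have "\<dots> = al \<odot> (Su - B x u) - B x (G d 1)" by (simp add: bilin ux Gx left.w_x)
      finally have 1: "B (B x u) x = al \<odot> (Su - B x u) - B x (G d 1)" .
      have "B x (B x u) = B x (al \<odot> u + G d 1 + fu \<odot> w)" by (simp only: xu)
      also have "\<dots> = al \<odot> B x u + B x (G d 1) + (2 * ga * fu) \<odot> w"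
        by (simp add: bilin left.x_w mult.commute)
      finally have 2: "B x (B x u) = al \<odot> B x u + B x (G d 1) + (2 * ga * fu) \<odot> w" .
      have "B (B x u) x = B x (B u x)" using leib[of x u x] central(2) by (simp add: z_def[symmetric] z)
      then have "al \<odot> (Su - B x u) - B x (G d 1) = B x Su - (al \<odot> B x u + B x (G d 1) + (2 * ga * fu) \<odot> w)"
        unfolding 1 ux by (simp only: diff_right 2)
      then show ?thesis by (simp add: algebra_simps)
    qed
    have Sv: "B x Sv = ga \<odot> Sv + de \<odot> Su + (2 * ga * fv) \<odot> w"
    proof -
      have "B (B x (g 0)) x = B (ga \<odot> g 0 + de \<odot> u + G c 1 + fv \<odot> w) x" by (simp only: xg0)
      also have "\<dots> = ga \<odot> (Sv - B x (g 0)) + de \<odot> (Su - B x u) - B x (G c 1)"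
        by (simp add: bilin ux g0x Gx left.w_x)
      finally have 1: "B (B x (g 0)) x = ga \<odot> (Sv - B x (g 0)) + de \<odot> (Su - B x u) - B x (G c 1)" .
      have "B x (B x (g 0)) = B x (ga \<odot> g 0 + de \<odot> u + G c 1 + fv \<odot> w)" by (simp only: xg0)
      also have "\<dots> = ga \<odot> B x (g 0) + de \<odot> B x u + B x (G c 1) + (2 * ga * fv) \<odot> w"
        by (simp add: bilin left.x_w mult.commute)
      finally have 2: "B x (B x (g 0)) = ga \<odot> B x (g 0) + de \<odot> B x u + B x (G c 1) + (2 * ga * fv) \<odot> w" .
      have "B (B x (g 0)) x = B x (B (g 0) x)" using leib[of x "g 0" x] central(3) by (simp add: z_def[symmetric] z)
      then have "ga \<odot> (Sv - B x (g 0)) + de \<odot> (Su - B x u) - B x (G c 1)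
          = B x Sv - (ga \<odot> B x (g 0) + de \<odot> B x u + B x (G c 1) + (2 * ga * fv) \<odot> w)"
        unfolding 1 g0x by (simp only: diff_right 2)
      then show ?thesis by (simp add: algebra_simps)
    qed
    \<comment> \<open>\<open>Su\<close> and \<open>Sv\<close> annihilate \<open>x\<close> from the
      left, as does \<open>w\<close>, whereas \<open>[g (m - 1), x]\<close> is \<open>- nu\<close>
      times \<open>g (m - 1)\<close>.\<close>
    have nu_t: "nu * tu = 0" "nu * tv = 0"
    proof -
      have "B Su x = 0" "B Sv x = 0"
        unfolding Su_def Sv_def su[symmetric] sv[symmetric] by (rule square_annihilates)+
      then show "nu * tu = 0" "nu * tv = 0"
        using g_last_nonzero by (auto simp: Su_def Sv_def bilin left.w_x lx simp del: One_nat_def)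
    qed
    have al_nu: "nu = 0 \<Longrightarrow> al = 0 \<Longrightarrow> False" "nu = 0 \<Longrightarrow> ga = 0 \<Longrightarrow> False"
      using False m_ge by (auto simp: nu_def)
    have tu: "tu = 0"
    proof -
      have "(2 * ga * su - al * su - 2 * ga * fu) \<odot> w + (nu * tu - al * tu) \<odot> g (m - 1) = 0"
        using Su unfolding Su_def
        by (simp add: bilin left.x_w xl del: One_nat_def)
            (simp add: fun_eq_iff pointwise algebra_simps del: One_nat_def)
      from indep_center[OF this] have "nu * tu = al * tu" by simp
      then show ?thesis using nu_t(1) al_nu(1) by auto
    qed
    have tv: "tv = 0"
    proof -
      have "(2 * ga * sv - ga * sv - de * su - 2 * ga * fv) \<odot> w + (nu * tv - ga * tv) \<odot> g (m - 1) = 0"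
        using Sv unfolding Sv_def Su_def tu
        by (simp add: bilin left.x_w xl del: One_nat_def)
            (simp add: fun_eq_iff pointwise algebra_simps del: One_nat_def)
      from indep_center[OF this] have "nu * tv = ga * tv" by simp
      then show ?thesis using nu_t(2) al_nu(2) by auto
    qed
    have "L4_leibniz_frame B m u w g x al ga de c d fu fv su sv ta ze"
    proof
      show "B u x = su \<odot> w - B x u" "B (g 0) x = sv \<odot> w - B x (g 0)"
        using ux g0x by (simp_all add: Su_def Sv_def tu tv)
      show "B x x = ta \<odot> g (m - 1) + ze \<odot> w" using z by (simp add: z_def add.commute)
    qed (rule xu xg0 leib)+
    then show ?thesis using False by blast
  qed
qed

end

section \<open>From abstract algebras to multiplication tables\<close>

lemma alg_iso_trans:
  assumes "L \<cong>\<^sub>a M" "M \<cong>\<^sub>a A" and closed: "\<And>x y. x \<in> carr L \<Longrightarrow> y \<in> carr L \<Longrightarrow> x + y \<in> carr L"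
  shows "L \<cong>\<^sub>a A"
proof -
  obtain f where f: "bij_betw f (carr L) (carr M)" "\<forall>x\<in>carr L. \<forall>y\<in>carr L. f (x + y) = f x + f y"
    "\<forall>c. \<forall>x\<in>carr L. f (scal L c x) = scal M c (f x)"
    "\<forall>x\<in>carr L. \<forall>y\<in>carr L. f (brk L x y) = brk M (f x) (f y)"
    using assms(1) unfolding alg_iso_def by blast
  obtain h where h: "bij_betw h (carr M) (carr A)" "\<forall>x\<in>carr M. \<forall>y\<in>carr M. h (x + y) = h x + h y"
    "\<forall>c. \<forall>x\<in>carr M. h (scal M c x) = scal A c (h x)"
    "\<forall>x\<in>carr M. \<forall>y\<in>carr M. h (brk M x y) = brk A (h x) (h y)"
    using assms(2) unfolding alg_iso_def by blast
  have "f x \<in> carr M" if "x \<in> carr L" for x using f(1) that by (auto simp: bij_betw_def)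
  then show ?thesis
    unfolding alg_iso_def using f h
    by (intro exI[of _ "h \<circ> f"]) (auto intro: bij_betw_trans)
qed

locale nilradical_iso =
  fixes L :: "'a::ab_group_add calg" and NL :: "'a set" and f :: "'a \<Rightarrow> cvec" and n m :: nat
  assumes n: "n = m + 2" "2 \<le> m"
    and leibniz_L: "left_leibniz L" and dim_L: "alg_dim L = n + 1" and nilradical: "is_nilradical L NL"
    and f_bij: "bij_betw f NL (coords n)"
    and f_add: "y \<in> NL \<Longrightarrow> z \<in> NL \<Longrightarrow> f (y + z) = f y + f z"
    and f_scale: "y \<in> NL \<Longrightarrow> f (scal L c y) = c \<odot> f y"
    and f_brk: "y \<in> NL \<Longrightarrow> z \<in> NL \<Longrightarrow> f (brk L y z) = brk (L4 n) (f y) (f z)"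
begin

lemma fd_L: "fd_algebra L"
  using leibniz_L by (simp add: left_leibniz_def)

sublocale V: vector_space "scal L"
  using fd_L by (simp add: fd_algebra_def)

lemma subspace_L: "V.subspace (carr L)"
  and brk_closed: "y \<in> carr L \<Longrightarrow> z \<in> carr L \<Longrightarrow> brk L y z \<in> carr L"
  and brk_linear: "y \<in> carr L \<Longrightarrow> y' \<in> carr L \<Longrightarrow> z \<in> carr L \<Longrightarrow> brk L (y + y') z = brk L y z + brk L y' z"
    "y \<in> carr L \<Longrightarrow> z \<in> carr L \<Longrightarrow> z' \<in> carr L \<Longrightarrow> brk L y (z + z') = brk L y z + brk L y z'"
    "y \<in> carr L \<Longrightarrow> z \<in> carr L \<Longrightarrow> brk L (scal L c y) z = scal L c (brk L y z)"
    "y \<in> carr L \<Longrightarrow> z \<in> carr L \<Longrightarrow> brk L y (scal L c z) = scal L c (brk L y z)"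
  using fd_L by (simp_all add: fd_algebra_def)

lemma leib_L: "y \<in> carr L \<Longrightarrow> z \<in> carr L \<Longrightarrow> t \<in> carr L \<Longrightarrow>
    brk L (brk L y z) t = brk L y (brk L z t) - brk L z (brk L y t)"
  using leibniz_L by (simp add: left_leibniz_def)

lemma ideal_NL: "alg_ideal L NL"
  using nilradical by (simp add: is_nilradical_def maximal_nilpotent_ideal_def nilpotent_ideal_def)

lemma subspace_NL: "V.subspace NL" and NL_carr: "NL \<subseteq> carr L"
  and NL_brk: "y \<in> carr L \<Longrightarrow> z \<in> NL \<Longrightarrow> brk L y z \<in> NL" "y \<in> carr L \<Longrightarrow> z \<in> NL \<Longrightarrow> brk L z y \<in> NL"
  using ideal_NL by (auto simp: alg_ideal_def)

definition E :: "nat \<Rightarrow> 'a" where "E i = inv_into NL f (\<e> i)"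

lemma E_NL: "i \<in> {1..n} \<Longrightarrow> E i \<in> NL" and f_E: "i \<in> {1..n} \<Longrightarrow> f (E i) = \<e> i"
  using f_bij bvec_coords unfolding E_def bij_betw_def
  by (auto intro: inv_into_into f_inv_into_f simp del: atLeastAtMost_iff)

lemma f_zero: "f 0 = 0"
  using f_scale[of 0 0] V.subspace_0[OF subspace_NL] by simp

lemma f_E_sum:
  assumes "I \<subseteq> {1..n}"
  shows "f (\<Sum>i\<in>I. scal L (r i) (E i)) = (\<Sum>i\<in>I. r i \<odot> \<e> i)"
  using finite_subset[OF assms finite_atLeastAtMost] assms
proof (induction I)
  case empty
  show "f (\<Sum>i\<in>{}. scal L (r i) (E i)) = (\<Sum>i\<in>{}. r i \<odot> \<e> i)"
    using f_zero by (simp only: sum.empty)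
next
  case (insert i I)
  have "scal L (r i) (E i) \<in> NL" "(\<Sum>i\<in>I. scal L (r i) (E i)) \<in> NL"
    using insert.prems E_NL by (auto intro!: V.subspace_scale[OF subspace_NL] V.subspace_sum[OF subspace_NL])
  then have "f (scal L (r i) (E i) + (\<Sum>i\<in>I. scal L (r i) (E i))) = r i \<odot> \<e> i + f (\<Sum>i\<in>I. scal L (r i) (E i))"
    using f_add f_scale[OF E_NL, of i "r i"] f_E[of i] insert.prems by simp
  also have "f (\<Sum>i\<in>I. scal L (r i) (E i)) = (\<Sum>i\<in>I. r i \<odot> \<e> i)" using insert by blast
  finally show "f (\<Sum>i\<in>insert i I. scal L (r i) (E i)) = (\<Sum>i\<in>insert i I. r i \<odot> \<e> i)"
    unfolding sum.insert[OF insert.hyps] .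
qed

lemma E_independent:
  assumes "(\<Sum>i\<in>{1..n}. scal L (r i) (E i)) = 0" "i \<in> {1..n}"
  shows "r i = 0"
proof -
  have "(\<Sum>i\<in>{1..n}. r i \<odot> \<e> i) = 0"
    using f_E_sum[of "{1..n}" r] assms(1) f_zero by simp
  then show ?thesis using bvec_family assms(2) by blast
qed

lemma span_E: "V.span (E ` {1..n}) = NL"
proof
  show "V.span (E ` {1..n}) \<subseteq> NL"
    by (rule V.span_minimal[OF _ subspace_NL]) (use E_NL in auto)
  show "NL \<subseteq> V.span (E ` {1..n})"
  proof
    fix y assume y: "y \<in> NL"
    let ?s = "\<Sum>i\<in>{1..n}. scal L (f y i) (E i)"
    have "f y \<in> coords n" using y f_bij by (auto simp: bij_betw_def)
    then have "f ?s = f y" using f_E_sum[of "{1..n}" "f y"] coords_expand[of "f y" n] by simp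
    moreover have "?s \<in> NL"
      using E_NL by (auto intro!: V.subspace_scale[OF subspace_NL] V.subspace_sum[OF subspace_NL])
    ultimately have "?s = y" using f_bij y by (auto simp: bij_betw_def inj_on_def)
    moreover have "?s \<in> V.span (E ` {1..n})" by (intro V.span_sum V.span_scale V.span_base) auto
    ultimately show "y \<in> V.span (E ` {1..n})" by simp
  qed
qed

lemma outside_exists: "\<exists>x. x \<in> carr L \<and> x \<notin> NL"
proof (rule ccontr)
  assume "\<not> ?thesis"
  then have eq: "carr L = NL" using NL_carr by blast
  have "inj_on E {1..n}" "V.independent (E ` {1..n})"
    by (rule V.independent_family; use E_independent in blast)+
  then have "V.dim NL = n" using V.dim_span_eq_card_independent span_E by (metis card_image card_atLeastAtMost diff_Suc_1)
  then show False using dim_L by (simp add: alg_dim_def eq)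
qed

end

section \<open>Transport of the structure constants to coordinates\<close>

locale nilradical_basis = nilradical_iso +
  fixes x :: 'a
  assumes x_carr: "x \<in> carr L" and x_NL: "x \<notin> NL"
begin

definition F :: "nat \<Rightarrow> 'a" where "F i = (if i \<le> n then E i else x)"

definition comb :: "cvec \<Rightarrow> 'a" where "comb c = (\<Sum>i\<in>{1..n + 1}. scal L (c i) (F i))"

lemma F_carr: "i \<in> {1..n + 1} \<Longrightarrow> F i \<in> carr L"
  using E_NL NL_carr x_carr by (auto simp: F_def)

lemma comb_carr: "comb c \<in> carr L"
  unfolding comb_def by (intro V.subspace_sum[OF subspace_L] V.subspace_scale[OF subspace_L] F_carr)

lemma comb_split: "comb c = (\<Sum>i\<in>{1..n}. scal L (c i) (E i)) + scal L (c (n + 1)) x"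
  by (simp add: comb_def F_def)

sublocale comb: Vector_Spaces.linear cscale "scal L" comb
  by unfold_locales
    (simp_all add: comb_def pointwise V.scale_left_distrib sum.distrib V.scale_sum_right
      del: sum.cl_ivl_Suc)

lemma E_sum_NL: "(\<Sum>i\<in>{1..n}. scal L (c i) (E i)) \<in> NL"
  using E_NL by (intro V.subspace_sum[OF subspace_NL] V.subspace_scale[OF subspace_NL]) auto

lemma comb_NL: "comb c \<in> NL \<longleftrightarrow> c (n + 1) = 0"
proof
  assume "comb c \<in> NL"
  moreover have "scal L (c (n + 1)) x = comb c - (\<Sum>i\<in>{1..n}. scal L (c i) (E i))"
    by (simp only: comb_split add_diff_cancel_left')
  ultimately have "scal L (c (n + 1)) x \<in> NL"
    using V.subspace_diff[OF subspace_NL _ E_sum_NL] by metis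
  then show "c (n + 1) = 0"
    using V.subspace_scale[OF subspace_NL, of "scal L (c (n + 1)) x" "inverse (c (n + 1))"] x_NL
    by (cases "c (n + 1) = 0") (simp_all del: add_Suc_right)
qed (use E_sum_NL in \<open>simp add: comb_split\<close>)

lemma F_independent:
  assumes "(\<Sum>i\<in>{1..n + 1}. scal L (c i) (F i)) = 0" "i \<in> {1..n + 1}"
  shows "c i = 0"
proof -
  have 0: "comb c = 0" using assms(1) by (simp add: comb_def)
  then have last: "c (n + 1) = 0" using comb_NL[of c] V.subspace_0[OF subspace_NL] by metis
  then have "c j = 0" if "j \<in> {1..n}" for j
    using E_independent[of c j] that 0 by (simp add: comb_split)
  then show ?thesis using last assms(2) by (cases "i = n + 1") auto
qed

lemma inj_comb: "inj_on comb (coords (n + 1))"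
proof (rule inj_onI)
  fix c c' assume c: "c \<in> coords (n + 1)" "c' \<in> coords (n + 1)" and eq: "comb c = comb c'"
  have "comb (c - c') = 0" using eq by (simp add: comb.diff)
  then have "(c - c') i = 0" if "i \<in> {1..n + 1}" for i
    using F_independent[of "c - c'"] that by (simp only: comb_def)
  then show "c = c'"
    using c by (intro ext) (metis (mono_tags, lifting) coords_def eq_iff_diff_eq_0 mem_Collect_eq minus_apply)
qed

lemma comb_image: "comb ` coords (n + 1) = carr L"
proof
  show "comb ` coords (n + 1) \<subseteq> carr L" using comb_carr by blast
  show "carr L \<subseteq> comb ` coords (n + 1)"
  proof
    fix y assume y: "y \<in> carr L"
    have ind: "inj_on F {1..n + 1}" "V.independent (F ` {1..n + 1})"
      by (rule V.independent_family; use F_independent in blast)+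
    obtain T where T: "finite T" "V.span T = carr L" using fd_L by (auto simp: fd_algebra_def)
    have "carr L \<subseteq> V.span (F ` {1..n + 1})"
    proof (rule V.full_independent_spans[OF ind(2) _ _ _ T(1)])
      show "card (F ` {1..n + 1}) = V.dim (carr L)"
        unfolding card_image[OF ind(1)] using dim_L by (simp add: alg_dim_def)
    qed (use T F_carr in auto)
    then obtain c where c: "y = (\<Sum>i\<in>{1..n + 1}. scal L (c i) (F i))"
      using V.span_family[OF ind(1)] y by (metis finite_atLeastAtMost subsetD)
    let ?c = "\<lambda>i. if i \<in> {1..n + 1} then c i else 0"
    have "y = comb ?c" unfolding c comb_def by (rule sum.cong) auto
    moreover have "?c \<in> coords (n + 1)" by (simp add: coords_def)
    ultimately show "y \<in> comb ` coords (n + 1)" by blast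
  qed
qed

definition co :: "'a \<Rightarrow> cvec" where "co y = inv_into (coords (n + 1)) comb y"

lemma comb_co: "y \<in> carr L \<Longrightarrow> comb (co y) = y" and co_coords: "y \<in> carr L \<Longrightarrow> co y \<in> coords (n + 1)"
  unfolding co_def comb_image[symmetric] by (simp_all only: f_inv_into_f inv_into_into)

lemma co_comb: "c \<in> coords (n + 1) \<Longrightarrow> co (comb c) = c"
  unfolding co_def by (rule inv_into_f_f[OF inj_comb])

lemma co_eqI: "c \<in> coords (n + 1) \<Longrightarrow> comb c = y \<Longrightarrow> co y = c"
  using co_comb by blast

lemma co_add: "y \<in> carr L \<Longrightarrow> z \<in> carr L \<Longrightarrow> co (y + z) = co y + co z"
  by (rule co_eqI, intro cv.subspace_add subspace_coords co_coords) (simp_all only: comb.add comb_co)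

lemma co_scale: "y \<in> carr L \<Longrightarrow> co (scal L c y) = c \<odot> co y"
  by (rule co_eqI, intro cv.subspace_scale subspace_coords co_coords) (simp_all only: comb.scale comb_co)

lemma co_diff: "y \<in> carr L \<Longrightarrow> z \<in> carr L \<Longrightarrow> co (y - z) = co y - co z"
  by (rule co_eqI, intro cv.subspace_diff subspace_coords co_coords) (simp_all only: comb.diff comb_co)

lemma co_NL: "y \<in> NL \<Longrightarrow> co y \<in> coords n"
proof -
  assume y: "y \<in> NL"
  then have "co y \<in> coords (n + 1)" "comb (co y) = y" using NL_carr co_coords comb_co by blast+
  then have "co y \<in> coords (n + 1)" "co y (n + 1) = 0" using comb_NL y by metis+
  then show ?thesis by (auto simp: coords_def le_Suc_eq)
qed

lemma comb_coords_n:
  assumes "c \<in> coords n"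
  shows "comb c \<in> NL" "f (comb c) = c"
proof -
  have "c (n + 1) = 0" using assms by (simp add: coords_def)
  then show "comb c \<in> NL" using comb_NL by blast
  have "comb c = (\<Sum>i\<in>{1..n}. scal L (c i) (E i))" using \<open>c (n + 1) = 0\<close> by (simp add: comb_split)
  then show "f (comb c) = c" using f_E_sum[of "{1..n}" c] coords_expand[OF assms] by simp
qed

lemma comb_bvec: "i \<in> {1..n + 1} \<Longrightarrow> comb (\<e> i) = F i"
proof -
  assume i: "i \<in> {1..n + 1}"
  have "comb (\<e> i) = (\<Sum>j\<in>{1..n + 1}. if j = i then F i else 0)"
    unfolding comb_def by (rule sum.cong) (auto simp: bvec_def)
  then show ?thesis using i by simp
qed

text \<open>The algebra \<open>L\<close> in the basis formed by the \<open>E i\<close> and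
  \<open>x\<close>. Since \<open>f\<close> is an isomorphism, the brackets of the \<open>E i\<close>
  are those of \<open>L4_table\<close>, so \<open>A\<close> has the shape of the listed
  tables.\<close>

definition A :: "cvec calg" where
  "A = L4_ext n (\<lambda>i. co (brk L (E i) x)) (\<lambda>i. co (brk L x (E i))) (co (brk L x x))"

lemma brk_A_truncate:
  "brk A a b = brk A (\<lambda>i. if i \<in> {1..n + 1} then a i else 0) (\<lambda>i. if i \<in> {1..n + 1} then b i else 0)"
  unfolding A_def L4_ext_table table_alg_def calg.simps by (intro sum.cong) auto

text \<open>Stated for all vectors, as both sides ignore coordinates outside
  \<open>1..n + 1\<close>. This supplies the Leibniz identity without carrier conditions, as the
  frame locales assume it.\<close>

lemma brk_A: "brk A a b = co (brk L (comb a) (comb b))"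
proof -
  let ?t = "\<lambda>a i. if i \<in> {1..n + 1} then a i else (0::complex)"
  have t: "?t a \<in> coords (n + 1)" "comb (?t a) = comb a" for a
    by (simp add: coords_def) (simp add: comb_def)
  have "brk A (?t a) (?t b) = co (brk L (comb (?t a)) (comb (?t b)))"
  proof (rule bilinear_eq_on_span[of "brk A" _ "\<e> ` {1..n + 1}"])
    show "bilinear_bracket (brk A)" unfolding A_def L4_ext_table by (rule bilinear_table)
    show "bilinear_bracket (\<lambda>a b. co (brk L (comb a) (comb b)))"
      by unfold_locales (simp_all add: comb.add comb.scale brk_linear comb_carr brk_closed co_add co_scale)
    show "?t a \<in> cv.span (\<e> ` {1..n + 1})" "?t b \<in> cv.span (\<e> ` {1..n + 1})"
      using t(1) span_bvec by blast+
    fix p q assume "p \<in> \<e> ` {1..n + 1}" "q \<in> \<e> ` {1..n + 1}"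
    then obtain i j where ij: "i \<in> {1..n + 1}" "j \<in> {1..n + 1}" "p = \<e> i" "q = \<e> j" by blast
    have main: "L4_table n i j = co (brk L (E i) (E j))" if "i \<in> {1..n}" "j \<in> {1..n}"
    proof -
      have EE: "brk L (E i) (E j) \<in> NL" using E_NL that NL_brk NL_carr by blast
      have "f (brk L (E i) (E j)) = L4_table n i j"
        using f_brk[OF E_NL E_NL] that f_E table_bvec[of i n j "L4_table n"] by (simp add: L4_def)
      moreover have "f (brk L (E i) (E j)) = co (brk L (E i) (E j))"
        using comb_coords_n(2)[OF co_NL[OF EE]] comb_co EE NL_carr by auto
      ultimately show ?thesis by simp
    qed
    consider "i \<in> {1..n}" "j \<in> {1..n}" | "i \<in> {1..n}" "j = n + 1" | "i = n + 1" "j \<in> {1..n}" | "i = n + 1" "j = n + 1"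
      using ij(1,2) by force
    then show "brk A p q = co (brk L (comb p) (comb q))"
      using main unfolding ij(3,4) A_def comb_bvec[OF ij(1)] comb_bvec[OF ij(2)]
      by cases (simp_all only: L4_ext_bvec F_def, simp_all)
  qed
  then show ?thesis using brk_A_truncate t(2) by metis
qed

lemma scal_A: "scal A = cscale"
  by (simp add: A_def carr_L4_ext)

lemma iso_A: "L \<cong>\<^sub>a A"
proof -
  have "bij_betw co (carr L) (coords (n + 1))"
    unfolding co_def using bij_betw_inv_into[of comb "coords (n + 1)" "carr L"] inj_comb comb_image
    by (simp add: bij_betw_def)
  moreover have "carr A = coords (n + 1)" "scal A = cscale" by (simp_all add: A_def carr_L4_ext)
  ultimately show ?thesis
    unfolding alg_iso_def
    by (intro exI[of _ co]) (auto simp: co_add co_scale brk_A comb_co)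
qed

lemma lower_central_L: "lower_central_series L k \<subseteq> comb ` lower_central_series A k"
proof (induction k)
  case 0
  then show ?case using comb_image by (simp add: A_def carr_L4_ext)
next
  case (Suc k)
  let ?X = "{brk L y z | y z. y \<in> carr L \<and> z \<in> lower_central_series L k}"
  let ?Y = "{brk A a b | a b. a \<in> carr A \<and> b \<in> lower_central_series A k}"
  have "?X \<subseteq> comb ` ?Y"
  proof
    fix t assume "t \<in> ?X"
    then obtain y z where t: "t = brk L y z" "y \<in> carr L" "z \<in> lower_central_series L k" by blast
    obtain b where b: "z = comb b" "b \<in> lower_central_series A k" using t(3) Suc by blast
    have "t = comb (brk A (co y) b)" using t b by (simp add: brk_A comb_co brk_closed comb_carr)
    moreover have "co y \<in> carr A" using co_coords[OF t(2)] by (simp add: A_def carr_L4_ext)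
    ultimately show "t \<in> comb ` ?Y" using b(2) by blast
  qed
  then have "V.span ?X \<subseteq> V.span (comb ` ?Y)" by (rule V.span_mono)
  also have "\<dots> = comb ` cv.span ?Y" by (rule comb.span_image)
  finally show ?case by (simp only: bracket_span_def lower_central_series.simps scal_A)
qed

text \<open>Otherwise \<open>L\<close> would be a nilpotent ideal of itself, and maximality would
  give \<open>carr L = NL\<close>, although \<open>x\<close> lies outside \<open>NL\<close>.\<close>

lemma not_nilpotent_A: "\<not> nilpotent_alg A"
proof
  assume "nilpotent_alg A"
  then obtain k where "lower_central_series A k = {0}" by (auto simp: nilpotent_alg_def)
  then have "lower_central_series L k \<subseteq> {0}" using lower_central_L[of k] by (simp add: comb.zero)
  moreover have "0 \<in> lower_central_series L k"
    by (cases k) (simp_all add: bracket_span_def V.span_zero V.subspace_0[OF subspace_L])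
  ultimately have "nilpotent_alg L" unfolding nilpotent_alg_def by blast
  then have "nilpotent_ideal L (carr L)"
    using subspace_L brk_closed by (simp add: nilpotent_ideal_def alg_ideal_def subalg_def)
  then have "carr L = NL"
    using nilradical NL_carr by (auto simp: is_nilradical_def maximal_nilpotent_ideal_def)
  then show False using x_carr x_NL by blast
qed

lemma listed_L: "\<exists>A' \<in> listed_algs n. L \<cong>\<^sub>a A'"
proof -
  have n3: "n + 1 = m + 3" using n by simp
  interpret L4_frame "brk A" m eu "\<e> 2" "eg n"
    unfolding A_def by (rule L4_frame_L4_ext[OF n])
  have x: "comb (\<e> (n + 1)) = x" by (simp add: comb_bvec F_def)
  have comb_N: "comb y \<in> NL" if "y \<in> coords (m + 2)" for y
    using comb_coords_n(1) that n by simp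
  have co_N: "y \<in> NL \<Longrightarrow> co y \<in> coords (m + 2)" for y
    using co_NL[of y] by (subst n(1)[symmetric])
  interpret ext: L4_extension "brk A" m eu "\<e> 2" "eg n" "\<e> (n + 1)" A
  proof
    show "eu \<in> coords (m + 2)" "\<e> 2 \<in> coords (m + 2)" "\<e> (n + 1) \<in> coords (m + 3)" "\<e> (n + 1) (m + 3) \<noteq> 0"
      using n by (auto simp: coords_def eu_def bvec_def pointwise)
    show "eg n i \<in> coords (m + 2)" for i using eg_coords[OF n] .
    show "carr A = coords (m + 3)" "scal A = cscale" using n3 by (simp_all only: A_def carr_L4_ext)
    show "brk A (brk A p q) r = brk A p (brk A q r) - brk A q (brk A p r)" for p q r
    proof -
      have c: "brk L (comb p) (brk L (comb q) (comb r)) \<in> carr L" "brk L (comb q) (brk L (comb p) (comb r)) \<in> carr L"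
        by (simp_all only: brk_closed comb_carr)
      have "brk A (brk A p q) r = co (brk L (brk L (comb p) (comb q)) (comb r))"
        by (simp only: brk_A comb_co brk_closed comb_carr)
      also have "\<dots> = co (brk L (comb p) (brk L (comb q) (comb r)) - brk L (comb q) (brk L (comb p) (comb r)))"
        by (simp only: leib_L comb_carr)
      also have "\<dots> = co (brk L (comb p) (brk L (comb q) (comb r))) - co (brk L (comb q) (brk L (comb p) (comb r)))"
        by (rule co_diff[OF c])
      also have "\<dots> = brk A p (brk A q r) - brk A q (brk A p r)"
        by (simp only: brk_A comb_co brk_closed comb_carr)
      finally show ?thesis .
    qed
    show "brk A (\<e> (n + 1)) y \<in> coords (m + 2)" "brk A y (\<e> (n + 1)) \<in> coords (m + 2)"
      if "y \<in> coords (m + 2)" for y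
      using NL_brk[OF x_carr comb_N[OF that], THEN co_N] unfolding brk_A x .
    show "brk A (\<e> (n + 1)) (\<e> (n + 1)) \<in> coords (m + 3)"
      unfolding brk_A x using co_coords[OF brk_closed[OF x_carr x_carr]] by (simp only: n3)
  qed (simp_all add: not_nilpotent_A)
  interpret extension_algebra A m n
    by unfold_locales (use ext.carr_A ext.scal_A n in auto)
  obtain al ga de c d fu fv su sv ta ze
    where "L4_leibniz_frame (brk A) m eu (\<e> 2) (eg n) (\<e> (n + 1)) al ga de c d fu fv su sv ta ze"
      and "al \<noteq> 0 \<or> ga \<noteq> 0"
    using ext.exists_frame by blast
  then have "\<exists>A' \<in> listed_algs n. A \<cong>\<^sub>a A'" by (rule classification)
  then obtain A' where A': "A' \<in> listed_algs n" "A \<cong>\<^sub>a A'" by blast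
  have "L \<cong>\<^sub>a A'"
    by (rule alg_iso_trans[OF iso_A A'(2)]) (rule V.subspace_add[OF subspace_L])
  then show ?thesis using A'(1) by blast
qed

end

theorem theorem5p2p3:
  fixes n :: nat
  assumes "4 \<le> n"
  shows "(\<forall>A \<in> listed_algs n. solvable_ext_of_L4 n A) \<and>
         (\<forall>L :: 'a::ab_group_add calg. solvable_ext_of_L4 n L \<longrightarrow>
            (\<exists>A \<in> listed_algs n. L \<cong>\<^sub>a A))"
proof (intro conjI ballI allI impI)
  show "solvable_ext_of_L4 n A" if "A \<in> listed_algs n" for A
    using listed_solvable_ext[OF assms that] .
  fix L :: "'a calg" assume L: "solvable_ext_of_L4 n L"
  then obtain NL where NL: "is_nilradical L NL" "subalg L NL \<cong>\<^sub>a L4 n"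
    unfolding solvable_ext_of_L4_def by blast
  have L4: "carr (L4 n) = coords n" "scal (L4 n) = cscale"
    by (simp_all add: L4_def table_alg_def coords_def)
  obtain f where f: "bij_betw f NL (coords n)" "\<forall>y\<in>NL. \<forall>z\<in>NL. f (y + z) = f y + f z"
    "\<forall>c. \<forall>y\<in>NL. f (scal L c y) = c \<odot> f y" "\<forall>y\<in>NL. \<forall>z\<in>NL. f (brk L y z) = brk (L4 n) (f y) (f z)"
    using NL(2) unfolding alg_iso_def subalg_def L4 by auto
  interpret nilradical_iso L NL f n "n - 2"
    by unfold_locales (use assms L NL f in \<open>auto simp: solvable_ext_of_L4_def\<close>)
  obtain x where "x \<in> carr L" "x \<notin> NL" using outside_exists by blast
  then interpret nilradical_basis L NL f n "n - 2" x by unfold_locales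
  show "\<exists>A \<in> listed_algs n. L \<cong>\<^sub>a A" by (rule listed_L)
qed

end
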